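(* Let $S$ be a finite inverse semigroup, with notation as in the context. Let $a,b\in D_k$ be idempotents and let $$f=\sum_{s\in S}f(s)\lfloor s\rfloor\in\mathbb{C}S,$$ where $f(s)=0$ unless $s\in D_k$, $s^{-1}s=a$ and $ss^{-1}=b$. Let $$f_G=\sum_{s\in D_k:\ ss^{-1}=b,\ s^{-1}s=a}f(s)\,p_b^{-1}sp_a\in\mathbb{C}G_k.$$ Write $\mathrm{IRR}(G_k)=\{\rho_1,\dots,\rho_q\}$. Let $W_i$ be the isotypic subspace of $\mathbb{C}G_k$ of type $\rho_i$ and $V_i$ the isotypic subspace of $\mathbb{C}S$ of type $\bar\rho_i$. Let $f_G^i=\sum_{g\in G_k}c_i(g)g$ be the projection of $f_G$ onto $W_i$, viewed as an element of $\mathbb{C}S$ via $G_k\subseteq S$. Then: 1. $f=\sum_{i=1}^q\lfloor p_b\rfloor f_G^i\lfloor p_a^{-1}\rfloor$; 2. for each $i$, $\lfloor p_b\rfloor f_G^i\lfloor p_a^{-1}\rfloor$ is the projection of $f$ onto $V_i$; 3. $\lfloor p_b\rfloor f_G^i\lfloor p_a^{-1}\rfloor=\lfloor p_b\rfloor\big(\sum_{g\in G_k}c_i(g)\lfloor g\rfloor\big)\lfloor p_a^{-1}\rfloor$.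
   Context: **Inverse semigroups and the natural order.** $S$ is a finite inverse semigroup: every $x$ has a unique $x^{-1}$ with $xx^{-1}x=x$ and $x^{-1}xx^{-1}=x^{-1}$. The natural partial order is $t\le s$ iff $t=es$ for an idempotent $e$, with Möbius function $\mu$. **Groupoid basis.** $\lfloor s\rfloor=\sum_{t\le s}\mu(t,s)t$; $\{\lfloor s\rfloor\}_{s\in S}$ is a basis of $\mathbb{C}S$. **$\mathcal{D}$-classes and maximal subgroups.** Elements $s,t$ are $\mathcal D$-related if some $u\in S$ has $u^{-1}u=s^{-1}s$ and $uu^{-1}=t^{-1}t$. The $\mathcal D$-classes are $D_0,\dots,D_n$. For each $k$: - $r_k$ is the number of idempotents in $D_k$; - $e_k\in D_k$ is a fixed idempotent; - $G_k=\{s:s^{-1}s=ss^{-1}=e_k\}$; - for each idempotent $a\in D_k$, $p_a$ is a fixed element with $p_a^{-1}p_a=e_k$ and $p_ap_a^{-1}=a$, with $p_{e_k}=e_k$. **Decomposition of $\mathbb{C}S$.** $\mathbb{C}D_k=\mathrm{span}\{\lfloor s\rfloor:s\in D_k\}$, and $\mathbb{C}S=\bigoplus_k\mathbb{C}D_k$. The map $\lfloor s\rfloor\mapsto(p_{ss^{-1}}^{-1}sp_{s^{-1}s})E_{ss^{-1},s^{-1}s}$ is an algebra isomorphism $\mathbb{C}D_k\cong M_{r_k}(\mathbb{C}G_k)$. **Irreducible representations.** For $\rho\in\mathrm{IRR}(G_k)$ (a complete set of inequivalent irreducible representations of $\mathbb{C}G_k$), $\bar\rho$ is the representation of $\mathbb{C}S$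 given by $\bar\rho(gE_{f,e})=E_{f,e}\otimes\rho(g)$ on $\mathbb{C}D_k$ and $0$ on the other $\mathbb{C}D_j$. The $\bar\rho$, over all $k$, form a complete set of inequivalent irreducible representations of $\mathbb{C}S$. **Isotypic subspaces.** For a semisimple algebra $A$ ($\mathbb{C}S$ or $\mathbb{C}G_k$) regarded as a left module over itself, the isotypic subspace of type $\rho$ is the sum of all simple left ideals isomorphic to $\rho$. $A$ is the direct sum of its isotypic subspaces, and projections are taken with respect to this decomposition. *)

theory Defs
  imports Complex_Main
begin

text \<open>Finite inverse semigroups are modelled as a type of class finite and semigroup_mult;
  the semigroup S is the whole type.  The semigroup algebra CS is the space of all
  functions S to the complex numbers (the element s of S is the indicator function sdelta s),
  with the convolution product sconv.\<close>

definition inverse_semigroup :: "('a::{finite,semigroup_mult}) itself \<Rightarrow> bool" where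
  "inverse_semigroup _ \<longleftrightarrow> (\<forall>x::'a. \<exists>!y. x * y * x = x \<and> y * x * y = y)"

definition sinv :: "'a::semigroup_mult \<Rightarrow> 'a" where
  "sinv x = (THE y. x * y * x = x \<and> y * x * y = y)"

definition idem :: "'a::semigroup_mult \<Rightarrow> bool" where
  "idem e \<longleftrightarrow> e * e = e"

definition nle :: "'a::semigroup_mult \<Rightarrow> 'a \<Rightarrow> bool" where
  "nle t s \<longleftrightarrow> (\<exists>e. idem e \<and> t = e * s)"

definition mobius :: "('a::finite \<Rightarrow> 'a \<Rightarrow> bool) \<Rightarrow> 'a \<Rightarrow> 'a \<Rightarrow> int" where
  "mobius le = (THE m. \<forall>t s. m t s =
      (if t = s then 1
       else if le t s then - (\<Sum>u\<in>{u. le t u \<and> le u s \<and> u \<noteq> s}. m t u)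
       else 0))"

definition sdelta :: "'a \<Rightarrow> 'a \<Rightarrow> complex" where
  "sdelta s = (\<lambda>u. if u = s then 1 else 0)"

definition sconv :: "('a::{finite,semigroup_mult} \<Rightarrow> complex) \<Rightarrow> ('a \<Rightarrow> complex) \<Rightarrow> 'a \<Rightarrow> complex" where
  "sconv x y = (\<lambda>u. \<Sum>s\<in>UNIV. \<Sum>t\<in>UNIV. if s * t = u then x s * y t else 0)"

definition gfloor :: "'a::{finite,semigroup_mult} \<Rightarrow> 'a \<Rightarrow> complex" where
  "gfloor s = (\<lambda>u. if nle u s then of_int (mobius nle u s) else 0)"

definition Drel :: "'a::semigroup_mult \<Rightarrow> 'a \<Rightarrow> bool" where
  "Drel s t \<longleftrightarrow> (\<exists>u. sinv u * u = sinv s * s \<and> u * sinv u = sinv t * t)"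

definition Dclass :: "'a::semigroup_mult \<Rightarrow> 'a set" where
  "Dclass e = {s. Drel s e}"

definition maxsub :: "'a::semigroup_mult \<Rightarrow> 'a set" where
  "maxsub e = {s. sinv s * s = e \<and> s * sinv s = e}"

text \<open>Algebra-theoretic notions, relative to a subalgebra A of CS (for CS itself A = UNIV,
  for CG_k the functions supported on G_k).  Sums, scalar multiples are pointwise.\<close>

definition left_ideal :: "('a::{finite,semigroup_mult} \<Rightarrow> complex) set \<Rightarrow> ('a \<Rightarrow> complex) set \<Rightarrow> bool" where
  "left_ideal A L \<longleftrightarrow> L \<subseteq> A \<and> (\<lambda>u. 0) \<in> L
     \<and> (\<forall>x\<in>L. \<forall>y\<in>L. (\<lambda>u. x u + y u) \<in> L)
     \<and> (\<forall>c. \<forall>x\<in>L. (\<lambda>u. c * x u) \<in> L)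
     \<and> (\<forall>a\<in>A. \<forall>x\<in>L. sconv a x \<in> L)"

definition simple_left_ideal :: "('a::{finite,semigroup_mult} \<Rightarrow> complex) set \<Rightarrow> ('a \<Rightarrow> complex) set \<Rightarrow> bool" where
  "simple_left_ideal A L \<longleftrightarrow> left_ideal A L \<and> L \<noteq> {\<lambda>u. 0}
     \<and> (\<forall>L'. left_ideal A L' \<and> L' \<subseteq> L \<longrightarrow> L' = {\<lambda>u. 0} \<or> L' = L)"

definition mod_iso :: "('a::{finite,semigroup_mult} \<Rightarrow> complex) set \<Rightarrow> ('a \<Rightarrow> complex) set
     \<Rightarrow> ('i \<Rightarrow> complex) set \<Rightarrow> (('a \<Rightarrow> complex) \<Rightarrow> ('i \<Rightarrow> complex) \<Rightarrow> ('i \<Rightarrow> complex)) \<Rightarrow> bool" where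
  "mod_iso A L X act \<longleftrightarrow> (\<exists>\<phi>. bij_betw \<phi> L X
     \<and> (\<forall>x\<in>L. \<forall>y\<in>L. \<phi> (\<lambda>u. x u + y u) = (\<lambda>i. \<phi> x i + \<phi> y i))
     \<and> (\<forall>c. \<forall>x\<in>L. \<phi> (\<lambda>u. c * x u) = (\<lambda>i. c * \<phi> x i))
     \<and> (\<forall>a\<in>A. \<forall>y\<in>L. \<phi> (sconv a y) = act a (\<phi> y)))"

definition sum_of :: "('a \<Rightarrow> complex) set set \<Rightarrow> ('a \<Rightarrow> complex) set" where
  "sum_of \<LL> = {x. \<exists>F g. finite F \<and> F \<subseteq> \<LL> \<and> (\<forall>L\<in>F. g L \<in> L) \<and> x = (\<lambda>u. \<Sum>L\<in>F. g L u)}"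

definition isotypic :: "('a::{finite,semigroup_mult} \<Rightarrow> complex) set
     \<Rightarrow> ('i \<Rightarrow> complex) set \<Rightarrow> (('a \<Rightarrow> complex) \<Rightarrow> ('i \<Rightarrow> complex) \<Rightarrow> ('i \<Rightarrow> complex)) \<Rightarrow> ('a \<Rightarrow> complex) set" where
  "isotypic A X act = sum_of {L. simple_left_ideal A L \<and> mod_iso A L X act}"

definition isotypic_components :: "('a::{finite,semigroup_mult} \<Rightarrow> complex) set \<Rightarrow> ('a \<Rightarrow> complex) set set" where
  "isotypic_components A = {isotypic A L sconv | L. simple_left_ideal A L}"

definition iso_proj :: "('a::{finite,semigroup_mult} \<Rightarrow> complex) set \<Rightarrow> ('a \<Rightarrow> complex) set \<Rightarrow> ('a \<Rightarrow> complex) \<Rightarrow> 'a \<Rightarrow> complex" where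
  "iso_proj A V x = (THE y. y \<in> V \<and> (\<lambda>u. x u - y u) \<in> sum_of (isotypic_components A - {V}))"

definition galg :: "'a set \<Rightarrow> ('a \<Rightarrow> complex) set" where
  "galg G = {x. \<forall>u. u \<notin> G \<longrightarrow> x u = 0}"

definition cvec :: "nat \<Rightarrow> (nat \<Rightarrow> complex) set" where
  "cvec d = {v. \<forall>i. d \<le> i \<longrightarrow> v i = 0}"

definition matvec :: "nat \<Rightarrow> (nat \<Rightarrow> nat \<Rightarrow> complex) \<Rightarrow> (nat \<Rightarrow> complex) \<Rightarrow> nat \<Rightarrow> complex" where
  "matvec d M v = (\<lambda>i. if i < d then \<Sum>j<d. M i j * v j else 0)"

definition is_grep :: "'a::semigroup_mult set \<Rightarrow> 'a \<Rightarrow> ('a \<Rightarrow> nat \<Rightarrow> nat \<Rightarrow> complex) \<Rightarrow> nat \<Rightarrow> bool" where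
  "is_grep G e \<rho> d \<longleftrightarrow>
     (\<forall>i<d. \<forall>j<d. \<rho> e i j = (if i = j then 1 else 0))
   \<and> (\<forall>g\<in>G. \<forall>h\<in>G. \<forall>i<d. \<forall>j<d. \<rho> (g * h) i j = (\<Sum>l<d. \<rho> g i l * \<rho> h l j))"

definition irreducible_grep :: "'a::semigroup_mult set \<Rightarrow> 'a \<Rightarrow> ('a \<Rightarrow> nat \<Rightarrow> nat \<Rightarrow> complex) \<Rightarrow> nat \<Rightarrow> bool" where
  "irreducible_grep G e \<rho> d \<longleftrightarrow> is_grep G e \<rho> d \<and> 0 < d \<and>
     (\<forall>U. U \<subseteq> cvec d \<and> (\<lambda>i. 0) \<in> U \<and> (\<forall>v\<in>U. \<forall>w\<in>U. (\<lambda>i. v i + w i) \<in> U)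
        \<and> (\<forall>c. \<forall>v\<in>U. (\<lambda>i. c * v i) \<in> U) \<and> (\<forall>g\<in>G. \<forall>v\<in>U. matvec d (\<rho> g) v \<in> U)
        \<longrightarrow> U = {\<lambda>i. 0} \<or> U = cvec d)"

definition equiv_grep :: "'a set \<Rightarrow> ('a \<Rightarrow> nat \<Rightarrow> nat \<Rightarrow> complex) \<Rightarrow> nat \<Rightarrow> ('a \<Rightarrow> nat \<Rightarrow> nat \<Rightarrow> complex) \<Rightarrow> nat \<Rightarrow> bool" where
  "equiv_grep G \<rho> d \<rho>' d' \<longleftrightarrow> d = d' \<and> (\<exists>P Q.
      (\<forall>i<d. \<forall>j<d. (\<Sum>l<d. P i l * Q l j) = (if i = j then 1 else 0))
    \<and> (\<forall>i<d. \<forall>j<d. (\<Sum>l<d. Q i l * P l j) = (if i = j then 1 else 0))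
    \<and> (\<forall>g\<in>G. \<forall>i<d. \<forall>j<d. (\<Sum>l<d. P i l * \<rho> g l j) = (\<Sum>l<d. \<rho>' g i l * P l j)))"

definition complete_irr :: "'a::semigroup_mult set \<Rightarrow> 'a \<Rightarrow> (('a \<Rightarrow> nat \<Rightarrow> nat \<Rightarrow> complex) \<times> nat) set \<Rightarrow> bool" where
  "complete_irr G e R \<longleftrightarrow>
     (\<forall>(\<rho>, d)\<in>R. irreducible_grep G e \<rho> d)
   \<and> (\<forall>(\<rho>, d)\<in>R. \<forall>(\<rho>', d')\<in>R. equiv_grep G \<rho> d \<rho>' d' \<longrightarrow> (\<rho>, d) = (\<rho>', d'))
   \<and> (\<forall>\<rho>' d'. irreducible_grep G e \<rho>' d' \<longrightarrow> (\<exists>(\<rho>, d)\<in>R. equiv_grep G \<rho> d \<rho>' d'))"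

definition gact :: "'a set \<Rightarrow> ('a \<Rightarrow> nat \<Rightarrow> nat \<Rightarrow> complex) \<Rightarrow> nat \<Rightarrow> ('a \<Rightarrow> complex) \<Rightarrow> (nat \<Rightarrow> complex) \<Rightarrow> nat \<Rightarrow> complex" where
  "gact G \<rho> d x v = (\<lambda>i. if i < d then (\<Sum>g\<in>G. x g * (\<Sum>j<d. \<rho> g i j * v j)) else 0)"

text \<open>The representation rho-bar of CS on C^{r_k} tensor C^d, realised as functions on
  (idempotents of D_k) x {0..<d}: on the groupoid basis,
  rhobar(floor s) = E_{ss^-1, s^-1 s} tensor rho(p_{ss^-1}^-1 s p_{s^-1 s}) for s in D_k, and 0 for s outside D_k;
  extended linearly.\<close>
definition rhobar_space :: "'a::semigroup_mult set \<Rightarrow> nat \<Rightarrow> ('a \<times> nat \<Rightarrow> complex) set" where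
  "rhobar_space D d = {v. \<forall>f i. \<not> (f \<in> D \<and> idem f \<and> i < d) \<longrightarrow> v (f, i) = 0}"

definition rhobar_basis :: "'a::semigroup_mult set \<Rightarrow> ('a \<Rightarrow> 'a) \<Rightarrow> ('a \<Rightarrow> nat \<Rightarrow> nat \<Rightarrow> complex) \<Rightarrow> nat
     \<Rightarrow> 'a \<Rightarrow> ('a \<times> nat \<Rightarrow> complex) \<Rightarrow> 'a \<times> nat \<Rightarrow> complex" where
  "rhobar_basis D p \<rho> d s v = (\<lambda>(f, i).
     if s \<in> D \<and> f = s * sinv s \<and> i < d
     then (\<Sum>j<d. \<rho> (sinv (p (s * sinv s)) * s * p (sinv s * s)) i j * v (sinv s * s, j))
     else 0)"

definition rhobar :: "'a::{finite,semigroup_mult} set \<Rightarrow> ('a \<Rightarrow> 'a) \<Rightarrow> ('a \<Rightarrow> nat \<Rightarrow> nat \<Rightarrow> complex) \<Rightarrow> nat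
     \<Rightarrow> ('a \<Rightarrow> complex) \<Rightarrow> ('a \<times> nat \<Rightarrow> complex) \<Rightarrow> 'a \<times> nat \<Rightarrow> complex" where
  "rhobar D p \<rho> d = (THE R.
       (\<forall>x y. R (\<lambda>u. x u + y u) = (\<lambda>v w. R x v w + R y v w))
     \<and> (\<forall>c x. R (\<lambda>u. c * x u) = (\<lambda>v w. c * R x v w))
     \<and> (\<forall>s. R (gfloor s) = rhobar_basis D p \<rho> d s))"

definition fG_of :: "'a::semigroup_mult \<Rightarrow> ('a \<Rightarrow> 'a) \<Rightarrow> 'a \<Rightarrow> 'a \<Rightarrow> ('a \<Rightarrow> complex) \<Rightarrow> 'a \<Rightarrow> complex" where
  "fG_of e p a b f = (\<lambda>u. \<Sum>s\<in>{s \<in> Dclass e. s * sinv s = b \<and> sinv s * s = a}.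
                    if sinv (p b) * s * p a = u then f s else 0)"

end

(*
Both the group algebra of G (the maximal subgroup at e) and the semigroup algebra CS, the latter in
the coordinates of the groupoid basis, carry a positive definite form for which left multiplication
by x has an adjoint, again a left multiplication, by the conjugate of x composed with inversion.
Hence left ideals have complements, and non-isomorphic simple left ideals are orthogonal by Schur's
lemma; so the isotypic components are mutually orthogonal and the projections are well defined.

In the groupoid basis the D-class component of CS consists of matrices over CG.  For a simple left
ideal L of CG of type rho, the matrices with entries in L that live in column a form a simple left
ideal of CS of type rho-bar, and non-isomorphic L give non-isomorphic ideals.  The map
l |-> floor(p_b) l floor(p_a^-1) puts l at position (b, a) of the matrix, so it carries the component
W_i into V_i and f_G to f.  Applying it to the decomposition of f_G gives that of f.
*)
theory Submission
  imports Defs "HOL-Analysis.Analysis"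
begin

section \<open>Left ideals and isotypic components\<close>

text \<open>On CS the form has to be the standard one in groupoid coordinates: in the natural basis,
  left multiplication by a semigroup element can merge basis vectors, and its adjoint is then in
  general not a left multiplication (already for the two-element semilattice). In groupoid
  coordinates a basis element acts by a partial bijection, whose adjoint is the action of its
  inverse. On the group algebra, embedded by the elements of G themselves, natural coordinates
  serve, since there both products agree. This embedding differs from the one by the
  \<open>gfloor g\<close>; the gap is closed by the fact that an element strictly below g has a
  domain idempotent different from that of g, so that g and \<open>gfloor g\<close> act alike on
  \<open>gfloor t\<close> when the domain of g is the range of t. A projection is defined by asking
  that the remainder lie in the sum of the other components. So besides carrying W_i into V_i, the
  proof must know that inequivalent representations give different V_i, and that there are only
  finitely many of them.\<close>

definition csubspace :: "('i \<Rightarrow> complex) set \<Rightarrow> bool" where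
  "csubspace L \<longleftrightarrow> (\<lambda>u. 0) \<in> L \<and> (\<forall>x\<in>L. \<forall>y\<in>L. (\<lambda>u. x u + y u) \<in> L)
     \<and> (\<forall>c. \<forall>x\<in>L. (\<lambda>u. c * x u) \<in> L)"

lemma csubspace_zero: "csubspace L \<Longrightarrow> (\<lambda>u. 0) \<in> L"
  and csubspace_add: "csubspace L \<Longrightarrow> x \<in> L \<Longrightarrow> y \<in> L \<Longrightarrow> (\<lambda>u. x u + y u) \<in> L"
  and csubspace_scale: "csubspace L \<Longrightarrow> x \<in> L \<Longrightarrow> (\<lambda>u. c * x u) \<in> L"
  by (auto simp: csubspace_def)

lemma csubspace_diff: "csubspace L \<Longrightarrow> x \<in> L \<Longrightarrow> y \<in> L \<Longrightarrow> (\<lambda>u. x u - y u) \<in> L"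
  using csubspace_add[of L x "\<lambda>u. - 1 * y u"] csubspace_scale[of L y "-1"] by simp

lemma csubspace_sum:
  assumes "csubspace L" "\<And>i. i \<in> I \<Longrightarrow> x i \<in> L"
  shows "(\<lambda>u. \<Sum>i\<in>I. x i u) \<in> L"
  using assms(2)
proof (induction I rule: infinite_finite_induct)
  case (insert i I)
  then show ?case using csubspace_add[OF assms(1), of "x i" "\<lambda>u. \<Sum>i\<in>I. x i u"] by simp
qed (use csubspace_zero[OF assms(1)] in auto)

lemma left_ideal_iff:
  "left_ideal A L \<longleftrightarrow> L \<subseteq> A \<and> csubspace L \<and> (\<forall>a\<in>A. \<forall>x\<in>L. sconv a x \<in> L)"
  unfolding left_ideal_def csubspace_def by blast

lemma sum_of_incl: "L \<in> \<L> \<Longrightarrow> x \<in> L \<Longrightarrow> x \<in> sum_of \<L>"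
  unfolding sum_of_def by (rule CollectI, rule exI[of _ "{L}"], rule exI[of _ "\<lambda>_. x"]) auto

lemma sum_of_least:
  assumes "csubspace N" "\<And>L. L \<in> \<L> \<Longrightarrow> L \<subseteq> N"
  shows "sum_of \<L> \<subseteq> N"
proof
  fix x assume "x \<in> sum_of \<L>"
  then obtain F g where F: "F \<subseteq> \<L>" "\<forall>L\<in>F. g L \<in> L" "x = (\<lambda>u. \<Sum>L\<in>F. g L u)"
    unfolding sum_of_def by blast
  then have "g L \<in> N" if "L \<in> F" for L using that assms(2) by blast
  then show "x \<in> N" unfolding F(3) by (rule csubspace_sum[OF assms(1)])
qed

lemma csubspace_sum_of:
  assumes "\<And>L. L \<in> \<L> \<Longrightarrow> csubspace L"
  shows "csubspace (sum_of \<L>)"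
  unfolding csubspace_def
proof (intro conjI ballI allI)
  show "(\<lambda>u. 0) \<in> sum_of \<L>"
    unfolding sum_of_def by (rule CollectI, rule exI[of _ "{}"]) auto
next
  fix x y assume "x \<in> sum_of \<L>" "y \<in> sum_of \<L>"
  then obtain F g F' g' where F: "finite F" "F \<subseteq> \<L>" "\<forall>L\<in>F. g L \<in> L" "x = (\<lambda>u. \<Sum>L\<in>F. g L u)"
    and F': "finite F'" "F' \<subseteq> \<L>" "\<forall>L\<in>F'. g' L \<in> L" "y = (\<lambda>u. \<Sum>L\<in>F'. g' L u)"
    unfolding sum_of_def by blast
  \<comment> \<open>A sum in \<open>sum_of\<close> has only one summand from each member, so two
    sums are added after both families are extended by zero to the union of their index
    sets.\<close>
  let ?h = "\<lambda>f F L u. if L \<in> F then f L u else (0::complex)"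
  let ?g = "\<lambda>L u. ?h g F L u + ?h g' F' L u"
  have z: "(\<lambda>u. 0) \<in> L" if "L \<in> F \<union> F'" for L
    using that assms F(2) F'(2) csubspace_zero by blast
  have "?h g F L \<in> L" "?h g' F' L \<in> L" if "L \<in> F \<union> F'" for L
    using F(3) F'(3) z[OF that] by (cases "L \<in> F"; cases "L \<in> F'"; simp)+
  then have "?g L \<in> L" if "L \<in> F \<union> F'" for L
    using that assms F(2) F'(2) csubspace_add[of L "?h g F L" "?h g' F' L"] by blast
  moreover have "(\<lambda>u. x u + y u) = (\<lambda>u. \<Sum>L\<in>F \<union> F'. ?g L u)"
  proof
    fix u
    have "x u = (\<Sum>L\<in>F \<union> F'. ?h g F L u)"
      unfolding F(4) by (rule sum.mono_neutral_cong_left) (use F(1) F'(1) in auto)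
    moreover have "y u = (\<Sum>L\<in>F \<union> F'. ?h g' F' L u)"
      unfolding F'(4) by (rule sum.mono_neutral_cong_left) (use F(1) F'(1) in auto)
    ultimately show "x u + y u = (\<Sum>L\<in>F \<union> F'. ?g L u)" by (simp add: sum.distrib)
  qed
  ultimately show "(\<lambda>u. x u + y u) \<in> sum_of \<L>"
    unfolding sum_of_def
    by (intro CollectI exI[of _ "F \<union> F'"] exI[of _ ?g]) (use F F' in auto)
next
  fix c x assume "x \<in> sum_of \<L>"
  then obtain F g where F: "finite F" "F \<subseteq> \<L>" "\<forall>L\<in>F. g L \<in> L" "x = (\<lambda>u. \<Sum>L\<in>F. g L u)"
    unfolding sum_of_def by blast
  then have "\<forall>L\<in>F. (\<lambda>u. c * g L u) \<in> L" using assms csubspace_scale by blast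
  then show "(\<lambda>u. c * x u) \<in> sum_of \<L>"
    unfolding sum_of_def F(4)
    by (intro CollectI exI[of _ F] exI[of _ "\<lambda>L u. c * g L u"])
      (use F in \<open>auto simp: sum_distrib_left\<close>)
qed

lemma csubspace_isotypic: "csubspace (isotypic A X act)"
  unfolding isotypic_def
  by (rule csubspace_sum_of) (auto simp: simple_left_ideal_def left_ideal_iff)

lemma sconv_add_right: "sconv a (\<lambda>u. x u + y u) = (\<lambda>u. sconv a x u + sconv a y u)"
  unfolding sconv_def by (auto simp: fun_eq_iff sum.distrib[symmetric] algebra_simps intro!: sum.cong)

lemma sconv_scale_right: "sconv a (\<lambda>u. c * x u) = (\<lambda>u. c * sconv a x u)"
  unfolding sconv_def by (auto simp: fun_eq_iff sum_distrib_left algebra_simps intro!: sum.cong)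

lemma sconv_add_left: "sconv (\<lambda>u. x u + y u) a = (\<lambda>u. sconv x a u + sconv y a u)"
  unfolding sconv_def by (auto simp: fun_eq_iff sum.distrib[symmetric] algebra_simps intro!: sum.cong)

lemma sconv_scale_left: "sconv (\<lambda>u. c * x u) a = (\<lambda>u. c * sconv x a u)"
  unfolding sconv_def by (auto simp: fun_eq_iff sum_distrib_left algebra_simps intro!: sum.cong)

lemma sconv_zero [simp]: "sconv a (\<lambda>u. 0) = (\<lambda>u. 0)" "sconv (\<lambda>u. 0) a = (\<lambda>u. 0)"
  by (auto simp: sconv_def fun_eq_iff cong: if_cong)

lemma sconv_sum_right: "sconv a (\<lambda>u. \<Sum>i\<in>I. x i u) = (\<lambda>u. \<Sum>i\<in>I. sconv a (x i) u)"
  by (induction I rule: infinite_finite_induct) (simp_all add: sconv_add_right)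

lemma sconv_sum_left: "sconv (\<lambda>u. \<Sum>i\<in>I. x i u) a = (\<lambda>u. \<Sum>i\<in>I. sconv (x i) a u)"
  by (induction I rule: infinite_finite_induct) (simp_all add: sconv_add_left)

lemma sconv_diff_right: "sconv a (\<lambda>u. x u - y u) = (\<lambda>u. sconv a x u - sconv a y u)"
  using sconv_add_right[of a x "\<lambda>u. -1 * y u"] unfolding sconv_scale_right by simp

text \<open>Linearity is required only on L, because the maps that occur, such as those given by
  \<open>inv_into\<close>, have arbitrary values elsewhere.\<close>

definition clinear_on :: "('i \<Rightarrow> complex) set \<Rightarrow> (('i \<Rightarrow> complex) \<Rightarrow> 'j \<Rightarrow> complex) \<Rightarrow> bool" where
  "clinear_on L \<phi> \<longleftrightarrow>
       (\<forall>x\<in>L. \<forall>y\<in>L. \<phi> (\<lambda>u. x u + y u) = (\<lambda>i. \<phi> x i + \<phi> y i))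
     \<and> (\<forall>c. \<forall>x\<in>L. \<phi> (\<lambda>u. c * x u) = (\<lambda>i. c * \<phi> x i))"

lemma clinear_onD:
  assumes "clinear_on L \<phi>"
  shows "x \<in> L \<Longrightarrow> y \<in> L \<Longrightarrow> \<phi> (\<lambda>u. x u + y u) = (\<lambda>i. \<phi> x i + \<phi> y i)"
    and "x \<in> L \<Longrightarrow> \<phi> (\<lambda>u. c * x u) = (\<lambda>i. c * \<phi> x i)"
  using assms unfolding clinear_on_def by blast+

lemma clinear_on_zero:
  assumes "clinear_on L \<phi>" "csubspace L"
  shows "\<phi> (\<lambda>u. 0) = (\<lambda>i. 0)"
  using clinear_onD(2)[OF assms(1) csubspace_zero[OF assms(2)], of 0] by simp

lemma clinear_on_diff:
  assumes "clinear_on L \<phi>" "csubspace L" "x \<in> L" "y \<in> L"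
  shows "\<phi> (\<lambda>u. x u - y u) = (\<lambda>i. \<phi> x i - \<phi> y i)"
  using clinear_onD(1)[OF assms(1,3) csubspace_scale[OF assms(2,4), of "-1"]]
    clinear_onD(2)[OF assms(1,4), of "-1"] by simp

lemma clinear_on_sum:
  assumes "clinear_on L \<phi>" "csubspace L" "\<And>i. i \<in> I \<Longrightarrow> x i \<in> L"
  shows "\<phi> (\<lambda>u. \<Sum>i\<in>I. x i u) = (\<lambda>j. \<Sum>i\<in>I. \<phi> (x i) j)"
  using assms(3)
proof (induction I rule: infinite_finite_induct)
  case (insert i I)
  then show ?case
    using clinear_onD(1)[OF assms(1), of "x i" "\<lambda>u. \<Sum>i\<in>I. x i u"] csubspace_sum[OF assms(2), of I x]
    by simp
qed (use clinear_on_zero[OF assms(1,2)] in auto)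

lemma clinear_on_inj:
  assumes "clinear_on L \<phi>" "csubspace L"
    and "\<And>x. x \<in> L \<Longrightarrow> \<phi> x = (\<lambda>i. 0) \<Longrightarrow> x = (\<lambda>u. 0)"
  shows "inj_on \<phi> L"
proof (rule inj_onI)
  fix x y assume xy: "x \<in> L" "y \<in> L" "\<phi> x = \<phi> y"
  then have "(\<lambda>u. x u - y u) = (\<lambda>u. 0)"
    using assms(3) csubspace_diff[OF assms(2)] clinear_on_diff[OF assms(1,2)] by simp
  then show "x = y" by (simp add: fun_eq_iff)
qed

lemma clinear_on_image:
  assumes "clinear_on L \<phi>" "csubspace L"
  shows "csubspace (\<phi> ` L)"
  unfolding csubspace_def
proof (intro conjI ballI allI)
  show "(\<lambda>u. 0) \<in> \<phi> ` L"
    using clinear_on_zero[OF assms] csubspace_zero[OF assms(2)] by (metis imageI)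
  show "(\<lambda>u. x u + y u) \<in> \<phi> ` L" if xy: "x \<in> \<phi> ` L" "y \<in> \<phi> ` L" for x y
  proof -
    obtain x' y' where *: "x' \<in> L" "y' \<in> L" "x = \<phi> x'" "y = \<phi> y'" using xy by blast
    show ?thesis
      using imageI[OF csubspace_add[OF assms(2) *(1,2)], of \<phi>] clinear_onD(1)[OF assms(1) *(1,2)] *
      by simp
  qed
  show "(\<lambda>u. c * x u) \<in> \<phi> ` L" if x: "x \<in> \<phi> ` L" for c x
  proof -
    obtain x' where *: "x' \<in> L" "x = \<phi> x'" using x by blast
    show ?thesis
      using imageI[OF csubspace_scale[OF assms(2) *(1)], of \<phi> c] clinear_onD(2)[OF assms(1) *(1)] *
      by simp
  qed
qed

lemma clinear_on_inv_into:
  assumes "bij_betw \<phi> L X" "clinear_on L \<phi>" "csubspace L"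
  shows "clinear_on X (inv_into L \<phi>)"
proof -
  let ?k = "inv_into L \<phi>"
  have k: "?k v \<in> L" "\<phi> (?k v) = v" if "v \<in> X" for v
    using that assms(1) by (auto simp: bij_betw_def inv_into_into f_inv_into_f)
  have eq: "?k v = y" if "y \<in> L" "\<phi> y = v" for v y
    using that assms(1) by (metis bij_betw_def inv_into_f_f)
  show ?thesis
    unfolding clinear_on_def
    by (intro conjI ballI allI eq csubspace_add[OF assms(3)] csubspace_scale[OF assms(3)] k(1))
      (simp_all add: k clinear_onD[OF assms(2)])
qed

section \<open>Module maps and isomorphism types of left ideals\<close>

definition module_map :: "('a::{finite,semigroup_mult} \<Rightarrow> complex) set \<Rightarrow> ('a \<Rightarrow> complex) set
     \<Rightarrow> (('a \<Rightarrow> complex) \<Rightarrow> ('i \<Rightarrow> complex) \<Rightarrow> ('i \<Rightarrow> complex))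
     \<Rightarrow> (('a \<Rightarrow> complex) \<Rightarrow> 'i \<Rightarrow> complex) \<Rightarrow> bool" where
  "module_map A L act \<phi> \<longleftrightarrow> clinear_on L \<phi> \<and> (\<forall>a\<in>A. \<forall>y\<in>L. \<phi> (sconv a y) = act a (\<phi> y))"

lemma mod_iso_iff: "mod_iso A L X act \<longleftrightarrow> (\<exists>\<phi>. bij_betw \<phi> L X \<and> module_map A L act \<phi>)"
  unfolding mod_iso_def module_map_def clinear_on_def by (simp only: conj_assoc)

lemma module_map_clinear: "module_map A L act \<phi> \<Longrightarrow> clinear_on L \<phi>"
  and module_map_act: "module_map A L act \<phi> \<Longrightarrow> a \<in> A \<Longrightarrow> x \<in> L \<Longrightarrow> \<phi> (sconv a x) = act a (\<phi> x)"
  unfolding module_map_def by blast+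

lemmas module_mapD = clinear_onD[OF module_map_clinear] module_map_act

lemma left_ideal_kernel:
  assumes "left_ideal A L" "module_map A L act \<phi>" "\<And>a. act a (\<lambda>i. 0) = (\<lambda>i. 0)"
  shows "left_ideal A {x\<in>L. \<phi> x = (\<lambda>i. 0)}"
proof -
  have L: "csubspace L" using assms(1) by (simp add: left_ideal_iff)
  show ?thesis
    unfolding left_ideal_def
  proof (intro conjI ballI allI)
    show "{x\<in>L. \<phi> x = (\<lambda>i. 0)} \<subseteq> A" using assms(1) by (auto simp: left_ideal_def)
    show "(\<lambda>u. 0) \<in> {x\<in>L. \<phi> x = (\<lambda>i. 0)}"
      using csubspace_zero[OF L] clinear_on_zero[OF module_map_clinear[OF assms(2)] L] by simp
  next
    fix x y assume "x \<in> {x\<in>L. \<phi> x = (\<lambda>i. 0)}" "y \<in> {x\<in>L. \<phi> x = (\<lambda>i. 0)}"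
    then show "(\<lambda>u. x u + y u) \<in> {x\<in>L. \<phi> x = (\<lambda>i. 0)}"
      using csubspace_add[OF L, of x y] module_mapD(1)[OF assms(2), of x y] by simp
  next
    fix c x assume "x \<in> {x\<in>L. \<phi> x = (\<lambda>i. 0)}"
    then show "(\<lambda>u. c * x u) \<in> {x\<in>L. \<phi> x = (\<lambda>i. 0)}"
      using csubspace_scale[OF L, of x c] module_mapD(2)[OF assms(2), of x c] by simp
  next
    fix a x assume "a \<in> A" "x \<in> {x\<in>L. \<phi> x = (\<lambda>i. 0)}"
    then show "sconv a x \<in> {x\<in>L. \<phi> x = (\<lambda>i. 0)}"
      using module_mapD(3)[OF assms(2), of a x] assms(1,3) by (simp add: left_ideal_def)
  qed
qed

lemma left_ideal_image:
  assumes "left_ideal A L" "module_map A L sconv \<phi>" "\<phi> ` L \<subseteq> A"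
  shows "left_ideal A (\<phi> ` L)"
proof -
  have L: "csubspace L" using assms(1) by (simp add: left_ideal_iff)
  have "sconv a x \<in> \<phi> ` L" if ax: "a \<in> A" "x \<in> \<phi> ` L" for a x
  proof -
    obtain x' where *: "x' \<in> L" "x = \<phi> x'" using ax by blast
    then have "sconv a x' \<in> L" using assms(1) ax(1) by (simp add: left_ideal_def)
    then show ?thesis using module_map_act[OF assms(2) ax(1) *(1)] * by (metis imageI)
  qed
  then show ?thesis
    using clinear_on_image[OF module_map_clinear[OF assms(2)] L] assms(3) by (simp add: left_ideal_iff)
qed

lemma mod_iso_refl: "left_ideal A L \<Longrightarrow> mod_iso A L L sconv"
  unfolding mod_iso_iff module_map_def clinear_on_def by (rule exI[of _ "\<lambda>x. x"]) (auto simp: bij_betw_def)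

lemma mod_iso_trans:
  assumes "left_ideal A L'" "mod_iso A L L' sconv" "mod_iso A L' X act"
  shows "mod_iso A L X act"
proof -
  obtain \<phi> \<psi> where *: "bij_betw \<phi> L L'" "module_map A L sconv \<phi>"
      "bij_betw \<psi> L' X" "module_map A L' act \<psi>"
    using assms(2,3) unfolding mod_iso_iff by blast
  have "\<phi> x \<in> L'" if "x \<in> L" for x using that *(1) by (auto simp: bij_betw_def)
  then have "module_map A L act (\<psi> \<circ> \<phi>)"
    using *(2,4) unfolding module_map_def clinear_on_def by simp
  then show ?thesis using bij_betw_trans[OF *(1,3)] unfolding mod_iso_iff by blast
qed

text \<open>X and \<open>act\<close> are known only as the target of two isomorphisms, so linearity
  and equivariance of the composite are checked inside L': an element there is identified by its
  image under \<open>\<psi>\<close>.\<close>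

lemma mod_iso_cancel:
  assumes "left_ideal A L'" "left_ideal A L" "mod_iso A L X act" "mod_iso A L' X act"
  shows "mod_iso A L L' sconv"
proof -
  obtain \<phi> \<psi> where *: "bij_betw \<phi> L X" "module_map A L act \<phi>"
      "bij_betw \<psi> L' X" "module_map A L' act \<psi>"
    using assms(3,4) unfolding mod_iso_iff by blast
  let ?k = "inv_into L' \<psi>"
  have k: "?k (\<phi> x) \<in> L'" "\<psi> (?k (\<phi> x)) = \<phi> x" if "x \<in> L" for x
    using that *(1,3) by (auto simp: bij_betw_def inv_into_into f_inv_into_f)
  have eq: "?k (\<phi> x) = y" if "y \<in> L'" "\<psi> y = \<phi> x" for x y
    using that *(3) by (metis bij_betw_def inv_into_f_f)
  have "module_map A L sconv (?k \<circ> \<phi>)"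
    unfolding module_map_def clinear_on_def comp_def
  proof (intro conjI ballI allI eq)
    fix x y assume xy: "x \<in> L" "y \<in> L"
    show "\<psi> (\<lambda>i. ?k (\<phi> x) i + ?k (\<phi> y) i) = \<phi> (\<lambda>u. x u + y u)"
      using xy k module_mapD(1)[OF *(2)] module_mapD(1)[OF *(4)] by simp
  next
    fix c x assume "x \<in> L"
    then show "\<psi> (\<lambda>i. c * ?k (\<phi> x) i) = \<phi> (\<lambda>u. c * x u)"
      using k module_mapD(2)[OF *(2)] module_mapD(2)[OF *(4)] by simp
  next
    fix a x assume "a \<in> A" "x \<in> L"
    then show "\<psi> (sconv a (?k (\<phi> x))) = \<phi> (sconv a x)"
      using k module_mapD(3)[OF *(2)] module_mapD(3)[OF *(4)] by simp
  qed (use k assms(1) in \<open>auto simp: left_ideal_def\<close>)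
  moreover have "bij_betw (?k \<circ> \<phi>) L L'"
    using bij_betw_trans[OF *(1) bij_betw_inv_into[OF *(3)]] .
  ultimately show ?thesis unfolding mod_iso_iff by blast
qed

lemma mod_iso_sym:
  assumes "left_ideal A L'" "left_ideal A L" "mod_iso A L L' sconv"
  shows "mod_iso A L' L sconv"
  using mod_iso_cancel[OF assms(2,1) mod_iso_refl[OF assms(1)] assms(3)] .

text \<open>Replaces an abstract type (X, \<open>act\<close>) by a left ideal that realises it. In
  this way the isotypic subspaces given by representations become members of
  \<open>isotypic_components\<close>, which are indexed by ideals.\<close>

lemma isotypic_cong:
  assumes "left_ideal A L" "mod_iso A L X act"
  shows "isotypic A X act = isotypic A L sconv"
proof -
  have "mod_iso A L' X act \<longleftrightarrow> mod_iso A L' L sconv" if "simple_left_ideal A L'" for L'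
    using mod_iso_trans[OF assms(1) _ assms(2)] mod_iso_cancel[OF assms(1) _ _ assms(2)] that
    unfolding simple_left_ideal_def by metis
  then have "{L'. simple_left_ideal A L' \<and> mod_iso A L' X act}
      = {L'. simple_left_ideal A L' \<and> mod_iso A L' L sconv}" by auto
  then show ?thesis unfolding isotypic_def by simp
qed

lemma isotypic_incl:
  "simple_left_ideal A L \<Longrightarrow> mod_iso A L X act \<Longrightarrow> x \<in> L \<Longrightarrow> x \<in> isotypic A X act"
  unfolding isotypic_def by (rule sum_of_incl) auto

section \<open>Semisimplicity from a positive definite form with adjoints\<close>

locale star_algebra =
  fixes A :: "('a::{finite,semigroup_mult} \<Rightarrow> complex) set" and J :: "('a \<Rightarrow> complex) \<Rightarrow> (complex, 'a) vec"
  assumes A_sub: "csubspace A" and A_mult: "x \<in> A \<Longrightarrow> y \<in> A \<Longrightarrow> sconv x y \<in> A"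
    and J_add: "J (\<lambda>u. x u + y u) = J x + J y"
    and J_scale: "J (\<lambda>u. c * x u) = c *s J x"
    and J_zero_imp: "J x = 0 \<Longrightarrow> x = (\<lambda>u. 0)"
    and adjoint: "a \<in> A \<Longrightarrow> \<exists>a'\<in>A. \<forall>x\<in>A. \<forall>y\<in>A. J (sconv a x) \<bullet> J y = J x \<bullet> J (sconv a' y)"
begin

lemma J_zero [simp]: "J (\<lambda>u. 0) = 0"
  using J_scale[of 0 "\<lambda>u. 0"] by simp

lemma J_diff: "J (\<lambda>u. x u - y u) = J x - J y"
  using J_add[of x "\<lambda>u. -1 * y u"] unfolding J_scale by (simp add: vec.scale_minus_left)

lemma J_inj: "J x = J y \<Longrightarrow> x = y"
  using J_zero_imp[of "\<lambda>u. x u - y u"] by (simp add: J_diff fun_eq_iff)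

lemma scaleR_vec_eq: "r *\<^sub>R (v :: complex ^ 'b) = of_real r *s v"
  by (simp add: vec_eq_iff scaleR_conv_of_real[where 'a=complex])

text \<open>The inner product on complex vectors is the real part of the Hermitian form, so the
  Euclidean results used below see the image of L as a real subspace. Nothing is lost: for a complex
  subspace the real and the Hermitian orthogonal complements coincide.\<close>

lemma subspace_J: "csubspace L \<Longrightarrow> subspace (J ` L)"
  unfolding subspace_def
proof (intro conjI ballI allI)
  assume L: "csubspace L"
  show "0 \<in> J ` L" using csubspace_zero[OF L] J_zero by (metis imageI)
  show "x + y \<in> J ` L" if "x \<in> J ` L" "y \<in> J ` L" for x y
    using that csubspace_add[OF L] by (auto simp: J_add[symmetric])
  show "c *\<^sub>R x \<in> J ` L" if "x \<in> J ` L" for c x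
    using that csubspace_scale[OF L] by (auto simp: scaleR_vec_eq J_scale[symmetric])
qed

definition orth :: "('a \<Rightarrow> complex) \<Rightarrow> ('a \<Rightarrow> complex) set \<Rightarrow> bool" where
  "orth x L \<longleftrightarrow> (\<forall>z\<in>L. J x \<bullet> J z = 0)"

lemma orth_self: "orth x L \<Longrightarrow> x \<in> L \<Longrightarrow> x = (\<lambda>u. 0)"
  using J_zero_imp unfolding orth_def by (metis inner_eq_zero_iff)

lemma orth_commute: "(\<forall>x\<in>L. orth x N) \<longleftrightarrow> (\<forall>y\<in>N. orth y L)"
  unfolding orth_def by (metis inner_commute)

lemma projection_exists:
  assumes "csubspace L"
  shows "\<exists>y\<in>L. orth (\<lambda>u. x u - y u) L"
proof -
  have sp: "span (J ` L) = J ` L" using subspace_J[OF assms] by (simp add: span_eq_iff)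
  obtain y z where "y \<in> span (J ` L)" "\<And>w. w \<in> span (J ` L) \<Longrightarrow> orthogonal z w" "J x = y + z"
    using orthogonal_subspace_decomp_exists[of "J ` L" "J x"] by blast
  then obtain y' where y': "y' \<in> L" "y = J y'" "\<And>w. w \<in> L \<Longrightarrow> z \<bullet> J w = 0" "J x = y + z"
    unfolding sp orthogonal_def by blast
  then have "orth (\<lambda>u. x u - y' u) L" unfolding orth_def J_diff by auto
  with y'(1) show ?thesis by blast
qed

lemma J_scale_inner: "J (\<lambda>u. c * x u) \<bullet> J y = J x \<bullet> J (\<lambda>u. cnj c * y u)"
  unfolding J_scale inner_vec_def
  by (rule sum.cong) (auto simp: inner_complex_def algebra_simps)

text \<open>A scalar moves to the other argument as its conjugate and is absorbed by L
  there.\<close>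

lemma csubspace_orth:
  assumes "csubspace L"
  shows "csubspace {x. orth x L}"
  using csubspace_scale[OF assms] unfolding csubspace_def orth_def
  by (simp add: J_add inner_add_left J_scale_inner)

text \<open>The adjoint of left multiplication by a is left multiplication by some a' in A, which
  preserves L; hence left multiplication by a preserves the complement of L.\<close>

lemma left_ideal_orth:
  assumes "left_ideal A L"
  shows "left_ideal A {x\<in>A. orth x L}"
proof -
  have L: "csubspace L" "L \<subseteq> A" using assms by (auto simp: left_ideal_iff)
  have "orth (sconv a x) L" if ax: "a \<in> A" "x \<in> A" "orth x L" for a x
  proof -
    obtain a' where a': "a' \<in> A" "\<forall>x\<in>A. \<forall>y\<in>A. J (sconv a x) \<bullet> J y = J x \<bullet> J (sconv a' y)"
      using adjoint[OF ax(1)] by blast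
    have "sconv a' z \<in> L" if "z \<in> L" for z using that a' assms by (auto simp: left_ideal_def)
    then show ?thesis using ax a' L unfolding orth_def by auto
  qed
  then show ?thesis
    using A_sub csubspace_orth[OF L(1)] A_mult unfolding left_ideal_iff csubspace_def by auto
qed

text \<open>A proper left ideal has smaller real dimension, so descent ends at a simple one.\<close>

lemma simple_exists:
  assumes "left_ideal A N" "N \<noteq> {\<lambda>u. 0}"
  shows "\<exists>L. simple_left_ideal A L \<and> L \<subseteq> N"
  using assms
proof (induction "dim (J ` N)" arbitrary: N rule: less_induct)
  case less
  show ?case
  proof (cases "simple_left_ideal A N")
    case False
    then obtain L where L: "left_ideal A L" "L \<subseteq> N" "L \<noteq> {\<lambda>u. 0}" "L \<noteq> N"
      using less.prems unfolding simple_left_ideal_def by blast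
    have "dim (J ` L) < dim (J ` N)"
    proof (rule ccontr)
      assume "\<not> ?thesis"
      then have "J ` L = J ` N"
        using L less.prems subspace_J
        by (intro subspace_dim_equal) (auto simp: left_ideal_iff)
      then show False using L(2,4) J_inj by (metis inj_def inj_image_eq_iff)
    qed
    from less.hyps[OF this L(1,3)] L(2) show ?thesis by blast
  qed auto
qed

text \<open>Complete reducibility: if the sum T of all simple left ideals were proper, its
  orthogonal complement in A would be a nonzero left ideal and contain a simple one, which also lies
  in T and is therefore orthogonal to itself.\<close>

lemma A_eq_sum_of_simple: "A = sum_of {L. simple_left_ideal A L}" (is "_ = ?T")
proof (rule ccontr)
  assume neq: "A \<noteq> ?T"
  have li: "left_ideal A L" if "L \<in> {L. simple_left_ideal A L}" for L
    using that by (auto simp: simple_left_ideal_def)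
  have T: "csubspace ?T" by (rule csubspace_sum_of) (use li in \<open>auto simp: left_ideal_iff\<close>)
  have TA: "?T \<subseteq> A"
    by (rule sum_of_least) (use A_sub li in \<open>auto simp: left_ideal_iff\<close>)
  have "left_ideal A ?T"
    unfolding left_ideal_iff
  proof (intro conjI ballI T TA)
    fix a x assume a: "a \<in> A" and x: "x \<in> ?T"
    have "csubspace {x. sconv a x \<in> ?T}"
      using T unfolding csubspace_def sconv_add_right sconv_scale_right mem_Collect_eq by simp
    moreover have "L \<subseteq> {x. sconv a x \<in> ?T}" if "L \<in> {L. simple_left_ideal A L}" for L
      using li[OF that] a sum_of_incl[OF that] by (auto simp: left_ideal_def)
    ultimately show "sconv a x \<in> ?T" using sum_of_least x by (metis (no_types, lifting) mem_Collect_eq subsetD)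
  qed
  note N = left_ideal_orth[OF this]
  obtain x where x: "x \<in> A" "x \<notin> ?T" using neq TA by blast
  obtain y where y: "y \<in> ?T" "orth (\<lambda>u. x u - y u) ?T" using projection_exists[OF T] by blast
  have "(\<lambda>u. x u - y u) \<in> {x\<in>A. orth x ?T}"
    using y TA x csubspace_diff[OF A_sub] by auto
  moreover have "(\<lambda>u. x u - y u) \<noteq> (\<lambda>u. 0)" using x y by (auto simp: fun_eq_iff) (metis ext)
  ultimately obtain L where L: "simple_left_ideal A L" "L \<subseteq> {x\<in>A. orth x ?T}"
    using simple_exists[OF N] by blast
  have "z = (\<lambda>u. 0)" if "z \<in> L" for z
    using that L orth_self sum_of_incl[of L "{L. simple_left_ideal A L}" z] by blast
  moreover have "(\<lambda>u. 0) \<in> L" using L(1) by (auto simp: simple_left_ideal_def left_ideal_def)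
  ultimately have "L = {\<lambda>u. 0}" by blast
  then show False using L(1) by (auto simp: simple_left_ideal_def)
qed

text \<open>The orthogonal projection of one simple left ideal to another is a module map, so Schur's
  lemma applies to it.\<close>

lemma not_iso_imp_orth:
  assumes L: "simple_left_ideal A L" and L': "simple_left_ideal A L'"
    and niso: "\<not> mod_iso A L L' sconv" and x: "x \<in> L"
  shows "orth x L'"
proof (rule ccontr)
  assume nx: "\<not> orth x L'"
  have li: "left_ideal A L" "left_ideal A L'" using L L' by (auto simp: simple_left_ideal_def)
  then have sub: "csubspace L" "csubspace L'" "L \<subseteq> A" "L' \<subseteq> A" by (auto simp: left_ideal_iff)
  define P where "P x = (SOME y. y \<in> L' \<and> orth (\<lambda>u. x u - y u) L')" for x
  have P: "P x \<in> L'" "orth (\<lambda>u. x u - P x u) L'" for x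
    using someI_ex[of "\<lambda>y. y \<in> L' \<and> orth (\<lambda>u. x u - y u) L'"] projection_exists[OF sub(2)]
    unfolding P_def by blast+
  \<comment> \<open>Uniqueness of the projection; linearity and compatibility with the action are
    then instances of it.\<close>
  have Peq: "P x = y" if "y \<in> L'" "orth (\<lambda>u. x u - y u) L'" for x y
  proof -
    have "orth (\<lambda>u. (x u - y u) - (x u - P x u)) L'"
      using csubspace_diff[OF csubspace_orth[OF sub(2)]] that P[of x] by blast
    then have "(\<lambda>u. P x u - y u) = (\<lambda>u. 0)"
      using orth_self csubspace_diff[OF sub(2) P(1) that(1)] by simp
    then show ?thesis by (simp add: fun_eq_iff)
  qed
  have mm: "module_map A L sconv P"
    unfolding module_map_def clinear_on_def
  proof (intro conjI ballI allI Peq)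
    fix x y
    show "(\<lambda>i. P x i + P y i) \<in> L'" using csubspace_add[OF sub(2)] P by blast
    show "orth (\<lambda>u. x u + y u - (P x u + P y u)) L'"
      using csubspace_add[OF csubspace_orth[OF sub(2)], of "\<lambda>u. x u - P x u" "\<lambda>u. y u - P y u"]
        P(2)[of x] P(2)[of y] by (simp add: algebra_simps)
  next
    fix c x
    show "(\<lambda>i. c * P x i) \<in> L'" using csubspace_scale[OF sub(2)] P by blast
    show "orth (\<lambda>u. c * x u - c * P x u) L'"
      using csubspace_scale[OF csubspace_orth[OF sub(2)], of "\<lambda>u. x u - P x u" c] P(2)[of x]
      by (simp add: algebra_simps)
  next
    fix a y assume a: "a \<in> A" "y \<in> L"
    show "sconv a (P y) \<in> L'" using a P li by (auto simp: left_ideal_def)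
    have "(\<lambda>u. y u - P y u) \<in> {x\<in>A. orth x L'}"
      using a P sub csubspace_diff[OF A_sub] by blast
    then have "sconv a (\<lambda>u. y u - P y u) \<in> {x\<in>A. orth x L'}"
      using left_ideal_orth[OF li(2)] a(1) unfolding left_ideal_def by blast
    then show "orth (\<lambda>u. sconv a y u - sconv a (P y) u) L'" by (simp add: sconv_diff_right)
  qed
  \<comment> \<open>Schur's argument: the kernel misses x, since P x = 0 would make x orthogonal to
    L', so it is zero; the image contains P x, so it is all of L'.\<close>
  have "left_ideal A {x\<in>L. P x = (\<lambda>u. 0)}"
    by (rule left_ideal_kernel[OF li(1) mm]) simp
  moreover have "P x \<noteq> (\<lambda>u. 0)" using nx P(2)[of x] by auto
  ultimately have ker: "{x\<in>L. P x = (\<lambda>u. 0)} = {\<lambda>u. 0}"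
    using L x unfolding simple_left_ideal_def by blast
  have inj: "inj_on P L" by (rule clinear_on_inj[OF module_map_clinear[OF mm] sub(1)]) (use ker in auto)
  have "left_ideal A (P ` L)"
    by (rule left_ideal_image[OF li(1) mm]) (use P sub in blast)
  then have "P ` L = L'"
    using L' P x \<open>P x \<noteq> _\<close> unfolding simple_left_ideal_def by blast
  then have "mod_iso A L L' sconv" using inj mm unfolding mod_iso_iff bij_betw_def by blast
  with niso show False by blast
qed

text \<open>Orthogonality of simple ideals extends to their sums one side at a time, because the
  complement of a subspace is a subspace; \<open>orth_commute\<close> exchanges the two
  sides.\<close>

lemma isotypic_orth:
  assumes L: "simple_left_ideal A L" and L': "simple_left_ideal A L'"
    and niso: "\<not> mod_iso A L L' sconv" and x: "x \<in> isotypic A L sconv"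
  shows "orth x (isotypic A L' sconv)"
proof -
  have li: "left_ideal A L" if "simple_left_ideal A L" for L
    using that by (auto simp: simple_left_ideal_def)
  have o: "orth x L2" if "simple_left_ideal A L1" "mod_iso A L1 L sconv"
    "simple_left_ideal A L2" "mod_iso A L2 L' sconv" "x \<in> L1" for L1 L2 x
  proof (rule not_iso_imp_orth[OF that(1,3) _ that(5)])
    show "\<not> mod_iso A L1 L2 sconv"
    proof
      assume "mod_iso A L1 L2 sconv"
      then have "mod_iso A L1 L' sconv" using mod_iso_trans li that by blast
      then show False
        using niso mod_iso_trans[OF li[OF that(1)]] mod_iso_sym[OF li[OF L] li[OF that(1)] that(2)] by blast
    qed
  qed
  have "isotypic A L sconv \<subseteq> {x. orth x (isotypic A L' sconv)}"
    unfolding isotypic_def[of A L]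
  proof (rule sum_of_least)
    show "csubspace {x. orth x (isotypic A L' sconv)}"
      by (rule csubspace_orth) (rule csubspace_isotypic)
    fix L1 assume L1: "L1 \<in> {La. simple_left_ideal A La \<and> mod_iso A La L sconv}"
    then have "isotypic A L' sconv \<subseteq> {y. orth y L1}"
      unfolding isotypic_def
    proof (intro sum_of_least csubspace_orth)
      show "csubspace L1" using L1 li by (auto simp: left_ideal_iff)
      fix L2 assume "L2 \<in> {La. simple_left_ideal A La \<and> mod_iso A La L' sconv}"
      then have "orth x L2" if "x \<in> L1" for x using o[of L1 L2 x] L1 that by blast
      then show "L2 \<subseteq> {y. orth y L1}" using orth_commute[of L1 L2] by blast
    qed
    then show "L1 \<subseteq> {x. orth x (isotypic A L' sconv)}" using orth_commute[of L1] by blast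
  qed
  with x show ?thesis by blast
qed


lemma components_csubspace: "V \<in> isotypic_components A \<Longrightarrow> csubspace V"
  unfolding isotypic_components_def using csubspace_isotypic by blast

lemma components_orth:
  assumes "V \<in> isotypic_components A" "W \<in> isotypic_components A" "V \<noteq> W" "x \<in> V"
  shows "orth x W"
proof -
  obtain L L' where L: "simple_left_ideal A L" "V = isotypic A L sconv"
    and L': "simple_left_ideal A L'" "W = isotypic A L' sconv"
    using assms(1,2) unfolding isotypic_components_def by blast
  have "\<not> mod_iso A L' L sconv"
    using isotypic_cong[of A L' L sconv] assms(3) L L' by (auto simp: simple_left_ideal_def)
  then have "\<not> mod_iso A L L' sconv"
    using mod_iso_sym[of A L' L] L(1) L'(1) by (auto simp: simple_left_ideal_def)
  then show ?thesis using isotypic_orth[OF L(1) L'(1)] assms(4) L L' by blast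
qed

lemma component_nonzero:
  assumes "V \<in> isotypic_components A"
  shows "\<exists>x\<in>V. x \<noteq> (\<lambda>u. 0)"
proof -
  obtain L where L: "simple_left_ideal A L" "V = isotypic A L sconv"
    using assms unfolding isotypic_components_def by blast
  then have "L \<subseteq> V" using isotypic_incl[OF L(1) mod_iso_refl] by (auto simp: simple_left_ideal_def)
  moreover have "\<exists>x\<in>L. x \<noteq> (\<lambda>u. 0)"
    using L(1) csubspace_zero[of L] by (auto simp: simple_left_ideal_def left_ideal_iff)
  ultimately show ?thesis by blast
qed

text \<open>Otherwise the common component would be orthogonal to itself, although it contains a
  nonzero vector.\<close>

lemma isotypic_eq_imp_mod_iso:
  assumes L: "simple_left_ideal A L" and L': "simple_left_ideal A L'"
    and eq: "isotypic A L sconv = isotypic A L' sconv"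
  shows "mod_iso A L L' sconv"
proof (rule ccontr)
  assume "\<not> ?thesis"
  note o = isotypic_orth[OF L L' this]
  have "isotypic A L sconv \<in> isotypic_components A"
    using L unfolding isotypic_components_def by blast
  then obtain x where "x \<in> isotypic A L sconv" "x \<noteq> (\<lambda>u. 0)" using component_nonzero by blast
  then show False using o orth_self eq by metis
qed

text \<open>Nonzero vectors chosen from the components are pairwise orthogonal in a
  finite-dimensional space. Finiteness is what gives the sum over all components its
  meaning.\<close>

lemma finite_components: "finite (isotypic_components A)"
proof -
  obtain x where x: "\<And>V. V \<in> isotypic_components A \<Longrightarrow> x V \<in> V \<and> x V \<noteq> (\<lambda>u. 0)"
    using component_nonzero by metis
  have o: "J (x V) \<bullet> J (x W) = 0"
    if "V \<in> isotypic_components A" "W \<in> isotypic_components A" "V \<noteq> W" for V W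
    using components_orth[OF that] x that unfolding orth_def by blast
  have nz: "J (x V) \<bullet> J (x V) \<noteq> 0" if "V \<in> isotypic_components A" for V
    using x[OF that] J_zero_imp by auto
  have "inj_on (\<lambda>V. J (x V)) (isotypic_components A)"
    using o nz by (intro inj_onI) metis
  moreover have "pairwise orthogonal ((\<lambda>V. J (x V)) ` isotypic_components A)"
    using o unfolding pairwise_def orthogonal_def by blast
  ultimately show ?thesis
    using pairwise_orthogonal_imp_finite finite_imageD by blast
qed

text \<open>Two candidates differ by an element of V that also lies in the sum of the other
  components and so is orthogonal to V. Hence exhibiting one decomposition suffices to compute a
  projection.\<close>

lemma iso_proj_eq:
  assumes V: "V \<in> isotypic_components A" and y: "y \<in> V"
    and xy: "(\<lambda>u. x u - y u) \<in> sum_of (isotypic_components A - {V})" (is "_ \<in> ?S")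
  shows "iso_proj A V x = y"
  unfolding iso_proj_def
proof (rule the_equality)
  fix z assume z: "z \<in> V \<and> (\<lambda>u. x u - z u) \<in> ?S"
  have "csubspace ?S" by (rule csubspace_sum_of) (use components_csubspace in blast)
  then have "(\<lambda>u. (x u - z u) - (x u - y u)) \<in> ?S" using z xy csubspace_diff by blast
  moreover have "?S \<subseteq> {x. orth x V}"
    by (intro sum_of_least csubspace_orth components_csubspace V) (use components_orth V in blast)
  ultimately have "orth (\<lambda>u. y u - z u) V" by auto
  moreover have "(\<lambda>u. y u - z u) \<in> V" using csubspace_diff[OF components_csubspace[OF V]] y z by blast
  ultimately have "(\<lambda>u. y u - z u) = (\<lambda>u. 0)" by (rule orth_self)
  then show "z = y" by (simp add: fun_eq_iff)
qed (use y xy in blast)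

lemma A_eq_sum_of_components: "A \<subseteq> sum_of (isotypic_components A)"
proof -
  have "sum_of {L. simple_left_ideal A L} \<subseteq> sum_of (isotypic_components A)"
  proof (intro sum_of_least csubspace_sum_of components_csubspace subsetI)
    fix L x assume "L \<in> {L. simple_left_ideal A L}" "x \<in> L"
    then have L: "simple_left_ideal A L" "x \<in> isotypic A L sconv"
      using isotypic_incl[of A L L sconv x] mod_iso_refl by (auto simp: simple_left_ideal_def)
    then show "x \<in> sum_of (isotypic_components A)"
      by (intro sum_of_incl[of "isotypic A L sconv"]) (auto simp: isotypic_components_def)
  qed
  then show ?thesis using A_eq_sum_of_simple by metis
qed

lemma iso_proj_decomposition:
  assumes "x \<in> A"
  shows "V \<in> isotypic_components A \<Longrightarrow> iso_proj A V x \<in> V"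
    and "x = (\<lambda>u. \<Sum>V\<in>isotypic_components A. iso_proj A V x u)"
proof -
  obtain F g where F: "finite F" "F \<subseteq> isotypic_components A" "\<forall>V\<in>F. g V \<in> V" "x = (\<lambda>u. \<Sum>V\<in>F. g V u)"
    using A_eq_sum_of_components assms unfolding sum_of_def by blast
  \<comment> \<open>Components that do not occur in the chosen finite sum receive the summand zero,
    so that the decomposition runs over all components.\<close>
  define w where "w V = (if V \<in> F then g V else (\<lambda>u. 0))" for V
  have wV: "w V \<in> V" if "V \<in> isotypic_components A" for V
    using F(3) csubspace_zero[OF components_csubspace[OF that]] by (simp add: w_def)
  have xw: "x u = (\<Sum>V\<in>isotypic_components A. w V u)" for u
    unfolding F(4) by (rule sum.mono_neutral_cong_left) (use F finite_components in \<open>auto simp: w_def\<close>)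
  have eq: "iso_proj A V x = w V" if V: "V \<in> isotypic_components A" for V
  proof (rule iso_proj_eq[OF V wV[OF V]])
    have "x u - w V u = (\<Sum>W\<in>isotypic_components A - {V}. w W u)" for u
      unfolding xw using sum.remove[OF finite_components V, of "\<lambda>V. w V u"] by simp
    then show "(\<lambda>u. x u - w V u) \<in> sum_of (isotypic_components A - {V})"
      using wV finite_components unfolding sum_of_def
      by (intro CollectI exI[of _ "isotypic_components A - {V}"] exI[of _ w]) auto
  qed
  show "iso_proj A V x \<in> V" if "V \<in> isotypic_components A" using eq wV that by simp
  show "x = (\<lambda>u. \<Sum>V\<in>isotypic_components A. iso_proj A V x u)"
    using eq xw by (auto simp: fun_eq_iff)
qed

end

section \<open>The groupoid basis of an inverse semigroup algebra\<close>

locale inv_semigroup =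
  fixes T :: "'a::{finite,semigroup_mult} itself"
  assumes inverse_semigroup: "inverse_semigroup T"
begin

lemma ex1_inverse: "\<exists>!y. (x::'a) * y * x = x \<and> y * x * y = y"
  using inverse_semigroup unfolding inverse_semigroup_def by blast

lemma sinv1 [simp]: "(x::'a) * sinv x * x = x" and sinv2 [simp]: "sinv x * x * sinv x = sinv x"
  using theI'[OF ex1_inverse[of x]] unfolding sinv_def by blast+

lemma sinv_eq: "(x::'a) * y * x = x \<Longrightarrow> y * x * y = y \<Longrightarrow> sinv x = y"
  using ex1_inverse[of x] sinv1[of x] sinv2[of x] by blast

lemma sinv_cancel [simp]:
  "(x::'a) * (sinv x * x) = x" "sinv x * (x * sinv x) = sinv x"
  "(x::'a) * (sinv x * (x * y)) = x * y" "sinv x * (x * (sinv x * y)) = sinv x * y"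
  using sinv1[of x] sinv2[of x] by (simp_all add: mult.assoc[symmetric])

lemma sinv_sinv [simp]: "sinv (sinv (x::'a)) = x"
  by (rule sinv_eq) auto

lemma sinv_idem: "idem (c::'a) \<Longrightarrow> sinv c = c"
  by (rule sinv_eq) (auto simp: idem_def)

lemma idem_dom [simp]: "idem (sinv x * (x::'a))" and idem_ran [simp]: "idem (x * sinv (x::'a))"
  unfolding idem_def by (simp_all add: mult.assoc)

text \<open>With x the inverse of cd, the element d x c is an inverse of cd as well, so x = d x c,
  and this form makes x idempotent. Then x is its own inverse and so equals cd.\<close>

lemma idem_mult:
  assumes c: "idem (c::'a)" and d: "idem d"
  shows "idem (c * d)"
proof -
  have cd: "c * c = c" "d * d = d" "c * (c * z) = c * z" "d * (d * z) = d * z" for z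
    using c d unfolding idem_def by (simp_all add: mult.assoc[symmetric])
  let ?x = "sinv (c * d)"
  have 1: "c * (d * (?x * (c * d))) = c * d" and 2: "?x * (c * (d * ?x)) = ?x"
    using sinv1[of "c * d"] sinv2[of "c * d"] by (simp_all add: mult.assoc)
  have two: "?x * (c * (d * (?x * z))) = ?x * z" for z
    using 2 by (metis mult.assoc)
  have eq: "?x = d * ?x * c"
    by (rule sinv_eq) (simp_all add: mult.assoc cd 1 two)
  have "?x * ?x = (d * ?x * c) * (d * ?x * c)" using eq by simp
  also have "\<dots> = d * (?x * (c * (d * (?x * c))))" by (simp only: mult.assoc)
  also have "\<dots> = d * (?x * c)" by (simp only: two)
  also have "\<dots> = ?x" using eq by (simp only: mult.assoc)
  finally have "idem ?x" by (simp add: idem_def)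
  then show ?thesis using sinv_idem[of ?x] by simp
qed

text \<open>Both products are idempotent, dc satisfies the equations of an inverse of cd, and cd is
  its own inverse.\<close>

lemma idem_commute:
  assumes c: "idem (c::'a)" and d: "idem d"
  shows "c * d = d * c"
proof -
  have "sinv (c * d) = d * c"
    using idem_mult[OF c d] idem_mult[OF d c] c d unfolding idem_def
    by (intro sinv_eq) (metis mult.assoc)+
  then show ?thesis using sinv_idem[OF idem_mult[OF c d]] by simp
qed

text \<open>The idempotents y y^-1 and x^-1 x in the middle of the products commute, after which
  everything cancels.\<close>

lemma sinv_mult [simp]: "sinv ((x::'a) * y) = sinv y * sinv x"
proof (rule sinv_eq)
  have *: "(y * sinv y) * (sinv x * x) = (sinv x * x) * (y * sinv y)"
    by (rule idem_commute) auto
  have "x * y * (sinv y * sinv x) * (x * y) = x * ((y * sinv y) * (sinv x * x)) * y"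
    by (simp add: mult.assoc)
  also have "\<dots> = x * y" unfolding * by (simp add: mult.assoc)
  finally show "x * y * (sinv y * sinv x) * (x * y) = x * y" .
  have "sinv y * sinv x * (x * y) * (sinv y * sinv x) = sinv y * ((sinv x * x) * (y * sinv y)) * sinv x"
    by (simp add: mult.assoc)
  also have "\<dots> = sinv y * sinv x" unfolding *[symmetric] by (simp add: mult.assoc)
  finally show "sinv y * sinv x * (x * y) * (sinv y * sinv x) = sinv y * sinv x" .
qed

text \<open>The witnessing idempotent can always be taken to be \<open>t * sinv t\<close>, which
  turns the order into an equation.\<close>

lemma nle_iff: "nle t (s::'a) \<longleftrightarrow> t = t * sinv t * s"
proof
  assume "nle t s"
  then obtain c where c: "idem c" "t = c * s" unfolding nle_def by blast
  have "t * sinv t * s = c * (s * sinv s) * c * s"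
    unfolding c(2) by (simp add: sinv_idem[OF c(1)] mult.assoc)
  also have "\<dots> = (s * sinv s) * c * c * s" using idem_commute[OF c(1) idem_ran] by simp
  also have "\<dots> = (s * sinv s) * c * s" using c(1) by (simp add: idem_def mult.assoc)
  also have "\<dots> = t" unfolding idem_commute[OF idem_ran c(1)] c(2) by (simp add: mult.assoc)
  finally show "t = t * sinv t * s" by simp
qed (use idem_ran nle_def in blast)

lemma nle_refl [simp]: "nle s (s::'a)" by (simp add: nle_iff)

lemma nle_trans: "nle r (s::'a) \<Longrightarrow> nle s t \<Longrightarrow> nle r t"
  unfolding nle_def by (metis idem_mult mult.assoc)

lemma nle_antisym:
  assumes "nle s (t::'a)" "nle t s" shows "s = t"
proof -
  have "s = (s * sinv s) * ((t * sinv t) * s)"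
    using assms unfolding nle_iff by (metis mult.assoc)
  also have "\<dots> = ((s * sinv s) * (t * sinv t)) * s" by (simp only: mult.assoc)
  also have "\<dots> = ((t * sinv t) * (s * sinv s)) * s"
    by (simp only: idem_commute[OF idem_ran idem_ran])
  also have "\<dots> = (t * sinv t) * s" by (simp only: mult.assoc sinv_cancel)
  also have "\<dots> = t" using assms(2) unfolding nle_iff by (rule sym)
  finally show ?thesis .
qed

lemma nle_mult: 
  assumes "nle s (s'::'a)" "nle t t'" shows "nle (s * t) (s' * t')"
proof -
  obtain c d where c: "idem c" "s = c * s'" "idem d" "t = d * t'"
    using assms unfolding nle_def by blast
  \<comment> \<open>The idempotent d is moved to the left of s' by conjugation: s' d = (s' d s'^-1)
    s'.\<close>
  have "s' * d = s' * ((sinv s' * s') * d)" by (simp add: mult.assoc)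
  also have "\<dots> = (s' * d * sinv s') * s'"
    unfolding idem_commute[OF idem_dom c(3)] by (simp add: mult.assoc)
  finally have 1: "s * t = (c * (s' * d * sinv s')) * (s' * t')"
    unfolding c(2,4) by (metis mult.assoc)
  have "(s' * d * sinv s') * (s' * d * sinv s') = s' * (d * (sinv s' * s')) * d * sinv s'"
    by (simp add: mult.assoc)
  also have "\<dots> = s' * d * sinv s'"
    unfolding idem_commute[OF c(3) idem_dom] using c(3)
    by (simp add: mult.assoc idem_def)
  finally have "idem (s' * d * sinv s')" by (simp add: idem_def)
  then show ?thesis unfolding nle_def using 1 idem_mult[OF c(1)] by blast
qed

lemma nle_sinv: "nle s (t::'a) \<Longrightarrow> nle (sinv s) (sinv t)"
proof -
  assume "nle s t"
  then obtain c where c: "idem c" "s = c * t" unfolding nle_def by blast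
  have "sinv t * c = sinv t * ((t * sinv t) * c)" by (simp add: mult.assoc)
  also have "\<dots> = (sinv t * c * t) * sinv t"
    unfolding idem_commute[OF idem_ran c(1)] by (simp add: mult.assoc)
  finally have 1: "sinv s = (sinv t * c * t) * sinv t" using c by (simp add: sinv_idem)
  have "(sinv t * c * t) * (sinv t * c * t) = sinv t * (c * (t * sinv t)) * c * t"
    by (simp add: mult.assoc)
  also have "\<dots> = sinv t * c * t"
    unfolding idem_commute[OF c(1) idem_ran] using c(1)
    by (simp add: mult.assoc idem_def)
  finally have "idem (sinv t * c * t)" by (simp add: idem_def)
  then show ?thesis unfolding nle_def using 1 by blast
qed

lemma nle_same_ran: "nle s (t::'a) \<Longrightarrow> s * sinv s = t * sinv t \<Longrightarrow> s = t"
  unfolding nle_iff by simp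

lemma wf_nle: "wf {(u, s::'a). nle u s \<and> u \<noteq> s}" and wf_nle_converse: "wf {(s, u::'a). nle u s \<and> u \<noteq> s}"
proof -
  have 1: "trans {(u, s::'a). nle u s \<and> u \<noteq> s}" and 2: "trans {(s, u::'a). nle u s \<and> u \<noteq> s}"
    by (rule transI, use nle_trans nle_antisym in blast)+
  show "wf {(u, s::'a). nle u s \<and> u \<noteq> s}"
    by (rule finite_acyclic_wf) (auto simp: acyclic_def trancl_id[OF 1])
  show "wf {(s, u::'a). nle u s \<and> u \<noteq> s}"
    by (rule finite_acyclic_wf) (auto simp: acyclic_def trancl_id[OF 2])
qed

text \<open>The description in the definition of the Moebius function has a unique solution because the
  order is well-founded.\<close>

lemma mobius_rec:
  "mobius nle t (s::'a) = (if t = s then 1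
       else if nle t s then - (\<Sum>u\<in>{u. nle t u \<and> nle u s \<and> u \<noteq> s}. mobius nle t u) else 0)"
proof -
  let ?r = "{(u, s::'a). nle u s \<and> u \<noteq> s}"
  \<comment> \<open>The recursion descends in s only; t is a fixed parameter.\<close>
  define E where "E t f s = (if t = s then 1 else if nle t s
       then - (\<Sum>u\<in>{u. nle t u \<and> nle u s \<and> u \<noteq> s}. f u) else (0::int))" for t s :: 'a and f
  define m where "m t = wfrec ?r (E t)" for t
  have m: "m t s = E t (m t) s" for t s
  proof -
    have "m t s = E t (cut (m t) ?r s) s" unfolding m_def by (rule wfrec[OF wf_nle])
    also have "\<dots> = E t (m t) s" unfolding E_def by (auto simp: cut_def intro!: sum.cong)
    finally show ?thesis .
  qed
  have uniq: "m' = m" if m': "\<forall>t s. m' t s = E t (m' t) s" for m'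
  proof (intro ext)
    fix t s show "m' t s = m t s"
    proof (induction s rule: wf_induct_rule[OF wf_nle])
      case (1 s)
      then have "E t (m' t) s = E t (m t) s" unfolding E_def by (auto intro!: sum.cong)
      then show ?case using m m' by metis
    qed
  qed
  have "mobius nle = m"
    unfolding mobius_def using m uniq by (intro the_equality) (auto simp: E_def)
  then show ?thesis using m[of t s] by (simp add: E_def)
qed

lemma mobius_sum:
  assumes "nle t (s::'a)"
  shows "(\<Sum>u\<in>{u. nle t u \<and> nle u s}. mobius nle t u) = (if t = s then 1 else 0)"
proof (cases "t = s")
  case True
  then have "{u. nle t u \<and> nle u s} = {s}" using nle_antisym by auto
  then show ?thesis using True mobius_rec[of s s] by simp
next
  case False
  have "{u. nle t u \<and> nle u s} = insert s {u. nle t u \<and> nle u s \<and> u \<noteq> s}" using assms by auto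
  then show ?thesis using False assms mobius_rec[of t s] by simp
qed


section \<open>Moebius inversion and the coordinates of the groupoid basis\<close>

lemma gfloor_self: "gfloor s (s::'a) = 1"
  using mobius_rec[of s s] by (simp add: gfloor_def)

text \<open>The coordinate of \<open>x\<close> at \<open>\<lfloor>s\<rfloor>\<close>: by Moebius inversion each \<open>u\<close> is the sum of the
  \<open>\<lfloor>s\<rfloor>\<close> with \<open>s \<le> u\<close>.\<close>

definition theta :: "('a \<Rightarrow> complex) \<Rightarrow> 'a \<Rightarrow> complex" where
  "theta x s = (\<Sum>u\<in>{u. nle s u}. x u)"

definition gsum :: "('a \<Rightarrow> complex) \<Rightarrow> 'a \<Rightarrow> complex" where
  "gsum x = (\<lambda>u. \<Sum>s\<in>UNIV. x s * gfloor s u)"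

lemma theta_alt: "theta x s = (\<Sum>u\<in>UNIV. if nle s u then x u else 0)"
  by (simp add: theta_def sum.If_cases)

lemma theta_add: "theta (\<lambda>u. x u + y u) = (\<lambda>s. theta x s + theta y s)"
  by (simp add: theta_def fun_eq_iff sum.distrib)

lemma theta_scale: "theta (\<lambda>u. c * x u) = (\<lambda>s. c * theta x s)"
  by (simp add: theta_def fun_eq_iff sum_distrib_left)

text \<open>After the sums are exchanged, the coefficient of x u at v is the sum of the Moebius
  function over the interval from v to u, which is 1 for v = u and 0 otherwise; the interval is
  empty unless v \<le> u.\<close>

lemma gsum_theta [simp]: "gsum (theta x) = x"
proof
  fix v
  have "gsum (theta x) v = (\<Sum>s\<in>UNIV. \<Sum>u\<in>UNIV. if nle s u then x u * gfloor s v else 0)"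
    by (simp add: gsum_def theta_def sum_distrib_right sum.If_cases)
  also have "\<dots> = (\<Sum>u\<in>UNIV. \<Sum>s\<in>UNIV. if nle s u then x u * gfloor s v else 0)"
    by (rule sum.swap)
  also have "\<dots> = (\<Sum>u\<in>UNIV. if v = u then x u else 0)"
  proof (rule sum.cong[OF refl])
    fix u
    have "(\<Sum>s\<in>UNIV. if nle s u then x u * gfloor s v else 0)
        = (\<Sum>s\<in>UNIV. if nle v s \<and> nle s u then x u * of_int (mobius nle v s) else 0)"
      by (rule sum.cong) (auto simp: gfloor_def)
    also have "\<dots> = x u * of_int (\<Sum>s\<in>{s. nle v s \<and> nle s u}. mobius nle v s)"
      by (simp add: sum.If_cases sum_distrib_left)
    also have "\<dots> = (if v = u then x u else 0)"
    proof (cases "nle v u")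
      case True
      then show ?thesis by (simp only: mobius_sum[OF True]) simp
    next
      case False
      then have e: "{s. nle v s \<and> nle s u} = {}" using nle_trans by blast
      show ?thesis unfolding e using False by auto
    qed
    finally show "(\<Sum>s\<in>UNIV. if nle s u then x u * gfloor s v else 0) = (if v = u then x u else 0)" .
  qed
  finally show "gsum (theta x) v = x v" by simp
qed

text \<open>Triangularity: \<open>gfloor t\<close> is supported below t and has coefficient 1 at t.
  Descending from the maximal elements, the value of \<open>gsum x\<close> at s reduces to x
  s.\<close>

lemma gsum_eq_0:
  assumes "gsum x = (\<lambda>u. 0)"
  shows "x s = 0"
proof (induction s rule: wf_induct_rule[OF wf_nle_converse])
  case (1 s)
  have "gsum x s = (\<Sum>t\<in>{s}. x t * gfloor t s)"
    unfolding gsum_def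
    by (rule sum.mono_neutral_right) (use 1 in \<open>auto simp: gfloor_def\<close>)
  then show ?case using assms by (simp add: gfloor_self)
qed

lemma theta_gsum [simp]: "theta (gsum x) = x"
proof -
  have "gsum (\<lambda>s. y s - x s) = (\<lambda>u. gsum y u - gsum x u)" for y
    by (simp add: gsum_def left_diff_distrib sum_subtractf)
  from this[of "theta (gsum x)"] show ?thesis using gsum_eq_0[of "\<lambda>s. theta (gsum x) s - x s"] by (auto simp: fun_eq_iff)
qed

lemma theta_inject: "theta x = theta y \<longleftrightarrow> x = y"
  by (metis gsum_theta)

lemma gsum_sdelta: "gsum (sdelta s) = gfloor s"
proof -
  have "gsum (sdelta s) u = (\<Sum>t\<in>{s}. sdelta s t * gfloor t u)" for u
    unfolding gsum_def by (rule sum.mono_neutral_right) (auto simp: sdelta_def)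
  then show ?thesis by (simp add: fun_eq_iff sdelta_def)
qed

lemma theta_gfloor [simp]: "theta (gfloor s) = sdelta s"
  using theta_gsum[of "sdelta s"] by (simp add: gsum_sdelta)

text \<open>The product of the groupoid algebra: \<open>t = s\<^sup>-\<^sup>1u\<close> is the only factor with \<open>st = u\<close> that is
  composable with \<open>s\<close>.\<close>

definition gconv :: "('a \<Rightarrow> complex) \<Rightarrow> ('a \<Rightarrow> complex) \<Rightarrow> 'a \<Rightarrow> complex" where
  "gconv x y u = (\<Sum>s\<in>{s. s * sinv s = u * sinv u}. x s * y (sinv s * u))"

text \<open>The reason why \<open>theta\<close> is multiplicative. For w \<le> s t there is exactly
  one composable factorisation w = u v with u \<le> s and v \<le> t, namely u = w w^-1 s and v =
  u^-1 w; without w \<le> s t there is none.\<close>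

lemma factor_iff:
  "(u * sinv u = w * sinv w \<and> nle u s \<and> nle (sinv u * w) t)
    \<longleftrightarrow> nle w (s * t) \<and> u = w * sinv w * (s::'a)"
proof
  assume a: "u * sinv u = w * sinv w \<and> nle u s \<and> nle (sinv u * w) t"
  then have "nle (u * (sinv u * w)) (s * t)" by (intro nle_mult) auto
  moreover have "u * (sinv u * w) = w"
    using a by (simp add: mult.assoc[symmetric])
  moreover have "u = w * sinv w * s" using a unfolding nle_iff by metis
  ultimately show "nle w (s * t) \<and> u = w * sinv w * s" by simp
next
  assume a: "nle w (s * t) \<and> u = w * sinv w * s"
  have 1: "nle (w * sinv w) ((s * t) * sinv (s * t))" using nle_mult nle_sinv a by blast
  have "nle (s * t * sinv (s * t)) (s * sinv s)"
    unfolding nle_def by (intro exI[of _ "s * t * sinv (s * t)"] conjI idem_ran) (simp add: mult.assoc)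
  then have "nle (w * sinv w) (s * sinv s)" using 1 nle_trans by blast
  then have 2: "w * sinv w * (s * sinv s) = w * sinv w"
    by (auto simp: nle_iff mult.assoc)
  have u: "u = w * sinv w * s" using a by blast
  have "u * sinv u = (w * sinv w * (s * sinv s)) * (w * sinv w)"
    unfolding u by (simp add: mult.assoc)
  then have 3: "u * sinv u = w * sinv w" unfolding 2 by (simp add: mult.assoc)
  have "nle (sinv s * w) (sinv s * (s * t))" using a by (intro nle_mult) auto
  moreover have "nle (sinv s * (s * t)) t"
    unfolding nle_def using idem_dom by (metis mult.assoc)
  moreover have "sinv u * w = sinv s * w" unfolding u by (simp add: mult.assoc)
  ultimately have "nle (sinv u * w) t" using nle_trans by metis
  moreover have "nle u s" unfolding nle_def u using idem_ran by blast
  ultimately show "u * sinv u = w * sinv w \<and> nle u s \<and> nle (sinv u * w) t" using 3 by blast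
qed

text \<open>Both sides expand to sums of the x s * y t: the left one over pairs (s, t) with w \<le>
  s t, the right one over triples that add a composable factorisation of w below (s, t). By
  \<open>factor_iff\<close> each such pair extends to exactly one triple.\<close>

lemma theta_sconv: "theta (sconv x y) = gconv (theta x) (theta y)"
proof
  fix w :: 'a
  let ?P = "\<lambda>u s t. u * sinv u = w * sinv w \<and> nle u s \<and> nle (sinv u * w) t"
  have "theta (sconv x y) w
      = (\<Sum>v\<in>UNIV. \<Sum>s\<in>UNIV. \<Sum>t\<in>UNIV. if nle w v then if s * t = v then x s * y t else 0 else 0)"
    by (auto simp: theta_alt sconv_def intro!: sum.cong)
  also have "\<dots> = (\<Sum>s\<in>UNIV. \<Sum>v\<in>UNIV. \<Sum>t\<in>UNIV. if nle w v then if s * t = v then x s * y t else 0 else 0)"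
    by (rule sum.swap)
  also have "\<dots> = (\<Sum>s\<in>UNIV. \<Sum>t\<in>UNIV. \<Sum>v\<in>UNIV. if nle w v then if s * t = v then x s * y t else 0 else 0)"
    by (rule sum.cong[OF refl], rule sum.swap)
  also have "\<dots> = (\<Sum>s\<in>UNIV. \<Sum>t\<in>UNIV. if nle w (s * t) then x s * y t else 0)"
  proof (intro sum.cong refl)
    fix s t
    have "(\<Sum>v\<in>UNIV. if nle w v then if s * t = v then x s * y t else 0 else 0)
      = (\<Sum>v\<in>UNIV. if s * t = v then if nle w v then x s * y t else 0 else 0)"
      by (rule sum.cong) auto
    then show "(\<Sum>v\<in>UNIV. if nle w v then if s * t = v then x s * y t else 0 else 0)
      = (if nle w (s * t) then x s * y t else 0)" by simp
  qed
  also have "\<dots> = (\<Sum>s\<in>UNIV. \<Sum>t\<in>UNIV. \<Sum>u\<in>UNIV. if ?P u s t then x s * y t else 0)"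
  proof (intro sum.cong refl)
    fix s t
    have "(\<Sum>u\<in>UNIV. if ?P u s t then x s * y t else 0)
      = (\<Sum>u\<in>UNIV. if u = w * sinv w * s then if nle w (s * t) then x s * y t else 0 else 0)"
      unfolding factor_iff by (rule sum.cong) auto
    then show "(if nle w (s * t) then x s * y t else 0)
      = (\<Sum>u\<in>UNIV. if ?P u s t then x s * y t else 0)" by simp
  qed
  also have "\<dots> = (\<Sum>s\<in>UNIV. \<Sum>u\<in>UNIV. \<Sum>t\<in>UNIV. if ?P u s t then x s * y t else 0)"
    by (rule sum.cong[OF refl], rule sum.swap)
  also have "\<dots> = (\<Sum>u\<in>UNIV. \<Sum>s\<in>UNIV. \<Sum>t\<in>UNIV. if ?P u s t then x s * y t else 0)"
    by (rule sum.swap)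
  also have "\<dots> = (\<Sum>u\<in>UNIV. if u * sinv u = w * sinv w
      then \<Sum>s\<in>UNIV. \<Sum>t\<in>UNIV. (if nle u s then x s else 0) * (if nle (sinv u * w) t then y t else 0) else 0)"
    by (intro sum.cong refl) (auto intro!: sum.cong sum.neutral)
  also have "\<dots> = gconv (theta x) (theta y) w"
    by (simp add: gconv_def theta_def sum_product sum.If_cases
        flip: sum_product sum_distrib_left sum_distrib_right)
  finally show "theta (sconv x y) w = gconv (theta x) (theta y) w" .
qed

text \<open>The pairs (s, u) with equal range idempotents are permuted by the involution (s, u) ->
  (s^-1, s^-1 u); reindexing along it exchanges the roles of u and s^-1 u.\<close>

lemma gconv_adjoint:
  "(\<Sum>u\<in>UNIV. gconv a x u * cnj (y u)) = (\<Sum>u\<in>UNIV. x u * cnj (gconv (\<lambda>s. cnj (a (sinv s))) y u))"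
proof -
  let ?P = "{(s, u::'a). s * sinv s = u * sinv u}"
  have *: "(\<Sum>u\<in>UNIV. \<Sum>s\<in>{s. s * sinv s = u * sinv u}. h s u) = (\<Sum>(s, u)\<in>?P. h s u)"
    for h :: "'a \<Rightarrow> 'a \<Rightarrow> complex"
  proof -
    have "(\<Sum>u\<in>UNIV. \<Sum>s\<in>{s. s * sinv s = u * sinv u}. h s u)
      = (\<Sum>(u, s)\<in>(SIGMA u:UNIV. {s. s * sinv s = u * sinv u}). h s u)"
      by (rule sum.Sigma) auto
    also have "\<dots> = (\<Sum>(s, u)\<in>?P. h s u)"
      by (rule sum.reindex_bij_witness[of _ "\<lambda>(s, u). (u, s)" "\<lambda>(u, s). (s, u)"]) auto
    finally show ?thesis .
  qed
  have inv: "(sinv s * sinv (sinv s) = (sinv s * u) * sinv (sinv s * u)) \<and> s * (sinv s * u) = u"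
    if "s * sinv s = u * sinv u" for s u :: 'a
  proof
    have "s * (sinv s * u) = u * sinv u * u" by (simp only: mult.assoc[symmetric] that)
    then show "s * (sinv s * u) = u" by simp
    have "(sinv s * u) * sinv (sinv s * u) = sinv s * (u * sinv u) * s" by (simp add: mult.assoc)
    also have "\<dots> = sinv s * s" unfolding that[symmetric] by (simp add: mult.assoc)
    finally show "sinv s * sinv (sinv s) = (sinv s * u) * sinv (sinv s * u)" by simp
  qed
  have "(\<Sum>u\<in>UNIV. gconv a x u * cnj (y u)) = (\<Sum>(s, u)\<in>?P. a s * x (sinv s * u) * cnj (y u))"
    by (simp add: gconv_def sum_distrib_right *)
  also have "\<dots> = (\<Sum>(s, u)\<in>?P. a (sinv s) * x u * cnj (y (sinv s * u)))"
    by (rule sum.reindex_bij_witness[of _ "\<lambda>(s, u). (sinv s, sinv s * u)" "\<lambda>(s, u). (sinv s, sinv s * u)"])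
      (use inv in auto)
  also have "\<dots> = (\<Sum>u\<in>UNIV. x u * cnj (gconv (\<lambda>s. cnj (a (sinv s))) y u))"
    by (simp add: gconv_def sum_distrib_left mult_ac *)
  finally show ?thesis .
qed

end

section \<open>Irreducible representations of a maximal subgroup\<close>

lemma csubspace_cvec: "csubspace (cvec d)"
  by (auto simp: csubspace_def cvec_def)

definition evec :: "nat \<Rightarrow> nat \<Rightarrow> complex" where "evec j = (\<lambda>i. if i = j then 1 else 0)"

lemma evec_in_cvec: "j < d \<Longrightarrow> evec j \<in> cvec d"
  by (auto simp: evec_def cvec_def)

lemma cvec_expand: "v \<in> cvec d \<Longrightarrow> v = (\<lambda>i. \<Sum>j<d. v j * evec j i)"
  by (auto simp: evec_def cvec_def fun_eq_iff if_distrib cong: if_cong)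

lemma clinear_on_cvec:
  assumes "clinear_on (cvec d) \<psi>" "v \<in> cvec d"
  shows "\<psi> v i = (\<Sum>j<d. \<psi> (evec j) i * v j)"
proof -
  have "\<psi> v = \<psi> (\<lambda>i. \<Sum>j<d. v j * evec j i)" using cvec_expand[OF assms(2)] by simp
  also have "\<dots> = (\<lambda>i. \<Sum>j<d. \<psi> (\<lambda>i. v j * evec j i) i)"
    by (rule clinear_on_sum[OF assms(1) csubspace_cvec])
      (use csubspace_scale[OF csubspace_cvec] evec_in_cvec in blast)
  also have "\<dots> = (\<lambda>i. \<Sum>j<d. \<psi> (evec j) i * v j)"
    using clinear_onD(2)[OF assms(1) evec_in_cvec] by (simp add: mult.commute)
  finally show ?thesis by (rule fun_cong)
qed

lemma matvec_in_cvec: "matvec d M v \<in> cvec d"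
  by (simp add: matvec_def cvec_def)

lemma clinear_matvec: "clinear_on L (matvec d M)"
  by (auto simp: clinear_on_def matvec_def fun_eq_iff sum.distrib[symmetric] sum_distrib_left algebra_simps)

lemma matvec_evec: "j < d \<Longrightarrow> i < d \<Longrightarrow> matvec d M (evec j) i = M i j"
  by (simp add: matvec_def evec_def if_distrib cong: if_cong)

text \<open>The dimension is the size of a basis; the coordinates are the coefficients in it,
  enumerated from 0 and extended by zero. This lets a simple ideal be written as a matrix
  representation.\<close>

lemma csubspace_coordinates:
  fixes L :: "('a::finite \<Rightarrow> complex) set"
  assumes L: "csubspace L"
  shows "\<exists>d \<phi>. bij_betw \<phi> L (cvec d) \<and> clinear_on L \<phi>"
proof -
  let ?V = "vec_lambda ` L :: (complex ^ 'a) set"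
  have add: "vec_lambda (\<lambda>u. x u + y u) = vec_lambda x + vec_lambda y" for x y :: "'a \<Rightarrow> complex"
    by (simp add: vec_eq_iff)
  have scale: "vec_lambda (\<lambda>u. c * x u) = c *s vec_lambda x" for c and x :: "'a \<Rightarrow> complex"
    by (simp add: vec_eq_iff)
  have V: "vec.subspace ?V"
    unfolding vec.subspace_def
  proof (intro conjI ballI allI)
    have "vec_lambda (\<lambda>u. 0) = (0 :: complex ^ 'a)" by (simp add: vec_eq_iff)
    then show "0 \<in> ?V" using csubspace_zero[OF L] by (metis imageI)
    show "x + y \<in> ?V" if "x \<in> ?V" "y \<in> ?V" for x y
      using that csubspace_add[OF L] add by (auto simp flip: add)
    show "c *s x \<in> ?V" if "x \<in> ?V" for c x
      using that csubspace_scale[OF L] by (auto simp flip: scale)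
  qed
  obtain B where B: "B \<subseteq> ?V" "vec.independent B" "?V \<subseteq> vec.span B"
    using vec.maximal_independent_subset by blast
  have fin: "finite B" using vec.finiteI_independent[OF B(2)] .
  have spB: "vec.span B = ?V" using B V by (metis vec.span_subspace)
  obtain b where b: "bij_betw b {..<card B} B" using ex_bij_betw_nat_finite[OF fin] by (auto simp: atLeast0LessThan)
  let ?d = "card B"
  define \<phi> where "\<phi> x = (\<lambda>i. if i < ?d then vec.representation B (vec_lambda x) (b i) else 0)" for x :: "'a \<Rightarrow> complex"
  have inV: "vec_lambda x \<in> vec.span B" if "x \<in> L" for x using that spB by blast
  have lin: "clinear_on L \<phi>"
    unfolding clinear_on_def \<phi>_def
    using inV by (auto simp: add scale vec.representation_add[OF B(2)] vec.representation_scale[OF B(2)] fun_eq_iff)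
  have expand: "vec_lambda x = (\<Sum>i<?d. \<phi> x i *s b i)" if "x \<in> L" for x
  proof -
    have "vec_lambda x = (\<Sum>v\<in>B. vec.representation B (vec_lambda x) v *s v)"
      using vec.sum_representation_eq[OF B(2) inV[OF that] fin] by simp
    also have "\<dots> = (\<Sum>i<?d. vec.representation B (vec_lambda x) (b i) *s b i)"
      by (rule sum.reindex_bij_betw[OF b, symmetric])
    finally show ?thesis by (simp add: \<phi>_def)
  qed
  have "inj_on \<phi> L"
  proof (rule clinear_on_inj[OF lin L])
    fix x assume x: "x \<in> L" "\<phi> x = (\<lambda>i. 0)"
    then have "vec_lambda x = (0 :: complex ^ 'a)" using expand by simp
    then show "x = (\<lambda>u. 0)" by (simp add: vec_eq_iff fun_eq_iff)
  qed
  moreover have "\<phi> ` L = cvec ?d"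
  proof
    show "\<phi> ` L \<subseteq> cvec ?d" by (auto simp: \<phi>_def cvec_def)
    show "cvec ?d \<subseteq> \<phi> ` L"
    proof
      fix v assume v: "v \<in> cvec ?d"
      define w where "w = (\<Sum>i<?d. v i *s b i)"
      have bi: "b i \<in> B" if "i < ?d" for i using that b by (auto simp: bij_betw_def)
      have "w \<in> ?V"
        unfolding w_def spB[symmetric]
        by (intro vec.span_sum vec.span_scale vec.span_base) (use bi in auto)
      then obtain x where x: "x \<in> L" "vec_lambda x = w" by blast
      have "vec.representation B w (b j) = v j" if j: "j < ?d" for j
      proof -
        have "vec.representation B w = (\<lambda>c. \<Sum>i<?d. vec.representation B (v i *s b i) c)"
          unfolding w_def
          by (rule vec.representation_sum[OF B(2)]) (use bi vec.span_scale vec.span_base in blast)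
        then have "vec.representation B w (b j) = (\<Sum>i<?d. v i * (if b j = b i then 1 else 0))"
          using bi by (auto simp: vec.representation_scale[OF B(2) vec.span_base] 
              vec.representation_basis[OF B(2)] intro!: sum.cong)
        also have "\<dots> = (\<Sum>i<?d. if i = j then v i else 0)"
          using b j by (intro sum.cong) (auto simp: bij_betw_def inj_on_def)
        finally show ?thesis using j by simp
      qed
      then have "\<phi> x = v" using v x(2) by (auto simp: \<phi>_def cvec_def fun_eq_iff)
      then show "v \<in> \<phi> ` L" using x(1) by blast
    qed
  qed
  ultimately show ?thesis using lin unfolding bij_betw_def by blast
qed

text \<open>The traces of PQ and QP agree, and they are d' and d.\<close>

lemma inverse_matrices_imp_same_size:
  fixes P Q :: "nat \<Rightarrow> nat \<Rightarrow> complex"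
  assumes "\<And>i j. i < d' \<Longrightarrow> j < d' \<Longrightarrow> (\<Sum>l<d. P i l * Q l j) = (if i = j then 1 else 0)"
    and "\<And>i j. i < d \<Longrightarrow> j < d \<Longrightarrow> (\<Sum>l<d'. Q i l * P l j) = (if i = j then 1 else 0)"
  shows "d = d'"
proof -
  have "(\<Sum>i<d'. \<Sum>l<d. P i l * Q l i) = (\<Sum>l<d. \<Sum>i<d'. Q l i * P i l)"
    by (subst sum.swap) (simp add: mult.commute)
  then have "of_nat d' = (of_nat d :: complex)" using assms by simp
  then show ?thesis by simp
qed

lemma equiv_grepI:
  assumes bij: "bij_betw \<psi> (cvec d) (cvec d')" and lin: "clinear_on (cvec d) \<psi>"
    and tw: "\<And>g v. g \<in> G \<Longrightarrow> v \<in> cvec d \<Longrightarrow> \<psi> (matvec d (\<rho> g) v) = matvec d' (\<rho>' g) (\<psi> v)"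
  shows "equiv_grep G \<rho> d \<rho>' d'"
proof -
  let ?k = "inv_into (cvec d) \<psi>"
  have lin': "clinear_on (cvec d') ?k" by (rule clinear_on_inv_into[OF bij lin csubspace_cvec])
  have k: "?k v \<in> cvec d" "\<psi> (?k v) = v" if "v \<in> cvec d'" for v
    using that bij by (auto simp: bij_betw_def inv_into_into f_inv_into_f)
  have k': "?k (\<psi> v) = v" "\<psi> v \<in> cvec d'" if "v \<in> cvec d" for v
    using that bij by (auto simp: bij_betw_def)
  define P where "P i j = \<psi> (evec j) i" for i j
  define Q where "Q i j = ?k (evec j) i" for i j
  have PQ: "(\<Sum>l<d. P i l * Q l j) = (if i = j then 1 else 0)" if "j < d'" for i j
    using clinear_on_cvec[OF lin k(1)[OF evec_in_cvec[OF that]], of i] k(2)[OF evec_in_cvec[OF that]]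
    by (simp add: P_def Q_def evec_def)
  have QP: "(\<Sum>l<d'. Q i l * P l j) = (if i = j then 1 else 0)" if "j < d" for i j
    using clinear_on_cvec[OF lin' k'(2)[OF evec_in_cvec[OF that]], of i] k'(1)[OF evec_in_cvec[OF that]]
    by (simp add: P_def Q_def evec_def)
  have d: "d = d'" by (rule inverse_matrices_imp_same_size[where P=P and Q=Q]) (use PQ QP in auto)
  have "(\<Sum>l<d. P i l * \<rho> g l j) = (\<Sum>l<d. \<rho>' g i l * P l j)" if g: "g \<in> G" and ij: "i < d" "j < d" for g i j
  proof -
    have "\<psi> (matvec d (\<rho> g) (evec j)) i = (\<Sum>l<d. P i l * \<rho> g l j)"
      using clinear_on_cvec[OF lin matvec_in_cvec[of d "\<rho> g" "evec j"], of i] ij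
      by (simp add: P_def matvec_evec)
    moreover have "matvec d' (\<rho>' g) (\<psi> (evec j)) i = (\<Sum>l<d. \<rho>' g i l * P l j)"
      using ij d by (simp add: matvec_def P_def)
    ultimately show ?thesis using tw[OF g evec_in_cvec[OF ij(2)]] by simp
  qed
  then show ?thesis unfolding equiv_grep_def using d PQ QP by blast
qed

context inv_semigroup
begin

lemma theta_zero [simp]: "theta (\<lambda>u. 0) = (\<lambda>s. 0)" by (simp add: theta_def fun_eq_iff)

lemma inner_vec_complex: "vec_lambda x \<bullet> vec_lambda y = Re (\<Sum>i\<in>UNIV. x i * cnj (y i))"
  by (simp add: inner_vec_def inner_complex_def)

text \<open>\<open>theta\<close> turns the product into \<open>gconv\<close>, for which
  \<open>gconv_adjoint\<close> names the adjoint; \<open>gsum\<close> converts its coordinates back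
  into an element of CS.\<close>

lemma star_algebra_UNIV: "star_algebra (UNIV :: ('a \<Rightarrow> complex) set) (\<lambda>x. \<chi> i. theta x i)"
proof
  fix a :: "'a \<Rightarrow> complex"
  let ?a = "gsum (\<lambda>s. cnj (theta a (sinv s)))"
  show "\<exists>a'\<in>UNIV. \<forall>x\<in>UNIV. \<forall>y\<in>UNIV.
      vec_lambda (theta (sconv a x)) \<bullet> vec_lambda (theta y) = vec_lambda (theta x) \<bullet> vec_lambda (theta (sconv a' y))"
    by (intro bexI[of _ ?a] ballI) (simp_all add: inner_vec_complex theta_sconv gconv_adjoint)
next
  fix x assume "vec_lambda (theta x) = (0 :: (complex, 'a) vec)"
  then have "theta x = theta (\<lambda>u. 0)" by (simp add: vec_eq_iff fun_eq_iff)
  then show "x = (\<lambda>u. 0)" by (simp only: theta_inject)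
qed (auto simp: csubspace_def theta_add theta_scale vec_eq_iff)

end

section \<open>The group algebra of a maximal subgroup\<close>

locale inv_semigroup_idem = inv_semigroup T for T :: "'a::{finite,semigroup_mult} itself" +
  fixes e :: 'a
  assumes idem_e: "idem e"
begin

abbreviation G :: "'a set" where "G \<equiv> maxsub e"

lemma G_iff: "g \<in> G \<longleftrightarrow> sinv g * g = e \<and> g * sinv g = e"
  by (simp add: maxsub_def)

lemma e_e: "e * e = e" "sinv e = e" using idem_e sinv_idem by (auto simp: idem_def)

lemma e_in_G: "e \<in> G" by (simp add: G_iff e_e)

lemma G_unit: "g \<in> G \<Longrightarrow> e * g = g" "g \<in> G \<Longrightarrow> g * e = g"
  unfolding G_iff by (metis sinv1, metis sinv1 mult.assoc)

lemma G_sinv: "g \<in> G \<Longrightarrow> sinv g \<in> G" by (simp add: G_iff)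

lemma G_mult: assumes "g \<in> G" "h \<in> G" shows "g * h \<in> G"
proof -
  have "sinv h * sinv g * (g * h) = sinv h * ((sinv g * g) * h)"
    "g * h * (sinv h * sinv g) = g * ((h * sinv h) * sinv g)" by (simp_all only: mult.assoc)
  then show ?thesis using assms G_unit[OF assms(2)] G_unit[OF G_sinv[OF assms(1)]] by (simp add: G_iff)
qed

lemma csubspace_galg: "csubspace (galg H)"
  by (auto simp: csubspace_def galg_def)

lemma sdelta_in_galg: "g \<in> H \<Longrightarrow> sdelta g \<in> galg H"
  by (auto simp: sdelta_def galg_def)

lemma G_quotient: "s \<in> G \<Longrightarrow> sinv s * u \<in> G \<Longrightarrow> s * sinv s = u * sinv u \<Longrightarrow> u \<in> G"
proof -
  assume a: "s \<in> G" "sinv s * u \<in> G" "s * sinv s = u * sinv u"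
  have "u = s * (sinv s * u)" using a(3) by (metis mult.assoc sinv1)
  then show ?thesis using G_mult[OF a(1,2)] by simp
qed

text \<open>All elements of G share one domain and range idempotent, and for s and u in G the only t
  in G with s t = u is s^-1 u. So the semigroup product and the groupoid product agree on functions
  supported on G.\<close>

lemma galg_sconv:
  assumes x: "x \<in> galg G" and y: "y \<in> galg G"
  shows "sconv x y = gconv x y" and "sconv x y \<in> galg G"
    and "u \<in> G \<Longrightarrow> sconv x y u = (\<Sum>g\<in>G. x g * y (sinv g * u))"
proof -
  have out: "s \<in> G \<and> t \<in> G" if "x s * y t \<noteq> 0" for s t
    using that x y by (auto simp: galg_def)
  have 1: "sconv x y u = (if u \<in> G then \<Sum>g\<in>G. x g * y (sinv g * u) else 0)" for u
  proof -
    have in_t: "(\<Sum>t\<in>UNIV. if s * t = u then x s * y t else 0)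
        = (if u \<in> G \<and> s \<in> G then x s * y (sinv s * u) else 0)" for s
    proof -
      have "(if s * t = u then x s * y t else 0)
          = (if t = sinv s * u then if u \<in> G \<and> s \<in> G then x s * y t else 0 else 0)" for t
      proof (cases "x s * y t = 0")
        case False
        then have st: "s \<in> G" "t \<in> G" using out by auto
        have "s * t = u \<longleftrightarrow> t = sinv s * u \<and> u \<in> G"
        proof
          assume "s * t = u"
          then show "t = sinv s * u \<and> u \<in> G" 
            using st G_mult[OF st] G_unit[OF st(2)] by (auto simp: G_iff mult.assoc[symmetric])
        next
          assume "t = sinv s * u \<and> u \<in> G"
          then show "s * t = u" using st(1) G_unit[of u] by (auto simp: G_iff mult.assoc[symmetric])
        qed
        then show ?thesis using st by auto
      qed auto
      then show ?thesis by simp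
    qed
    show ?thesis unfolding sconv_def in_t by (auto simp: sum.If_cases)
  qed
  show "u \<in> G \<Longrightarrow> sconv x y u = (\<Sum>g\<in>G. x g * y (sinv g * u))" by (simp add: 1)
  show "sconv x y \<in> galg G" by (simp add: 1 galg_def)
  have "gconv x y u = (if u \<in> G then \<Sum>g\<in>G. x g * y (sinv g * u) else 0)" for u
  proof (cases "u \<in> G")
    case True
    then have ue: "u * sinv u = e" by (simp add: G_iff)
    have "(\<Sum>s\<in>{s. s * sinv s = e}. x s * y (sinv s * u)) = (\<Sum>g\<in>G. x g * y (sinv g * u))"
    proof (rule sum.mono_neutral_right)
      show "G \<subseteq> {s. s * sinv s = e}" using G_iff by blast
    qed (use x in \<open>auto simp: galg_def\<close>)
    then show ?thesis using True by (simp add: gconv_def ue)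
  next
    case False
    then have "x s * y (sinv s * u) = 0" if "s * sinv s = u * sinv u" for s
      using out[of s "sinv s * u"] G_quotient that by blast
    then have "gconv x y u = 0" unfolding gconv_def by (intro sum.neutral) blast
    then show ?thesis using False by simp
  qed
  then show "sconv x y = gconv x y" by (simp add: 1 fun_eq_iff)
qed

text \<open>Here the form is taken in natural coordinates; \<open>gconv_adjoint\<close> still
  applies because the two products agree on \<open>galg G\<close>.\<close>

lemma star_algebra_galg: "star_algebra (galg G) vec_lambda"
proof
  fix a assume a: "a \<in> galg G"
  let ?a = "\<lambda>s. cnj (a (sinv s))"
  have a': "?a \<in> galg G" using a G_sinv by (auto simp: galg_def) (metis sinv_sinv)
  then show "\<exists>a'\<in>galg G. \<forall>x\<in>galg G. \<forall>y\<in>galg G.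
      vec_lambda (sconv a x) \<bullet> vec_lambda y = vec_lambda x \<bullet> vec_lambda (sconv a' y)"
    by (intro bexI[of _ ?a] ballI) (simp_all add: inner_vec_complex galg_sconv(1) a gconv_adjoint)
next
  fix x assume "vec_lambda x = (0 :: (complex, 'a) vec)"
  then show "x = (\<lambda>u. 0)" by (simp add: vec_eq_iff fun_eq_iff)
qed (auto simp: csubspace_galg galg_sconv(2) vec_eq_iff)

lemma sconv_sdelta_galg:
  assumes "g \<in> G" "x \<in> galg G"
  shows "sconv (sdelta g) x = (\<lambda>u. if u \<in> G then x (sinv g * u) else 0)"
proof
  fix u
  have "(\<Sum>h\<in>G. sdelta g h * x (sinv h * u)) = (\<Sum>h\<in>{g}. sdelta g h * x (sinv h * u))"
    by (rule sum.mono_neutral_right) (use assms in \<open>auto simp: sdelta_def\<close>)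
  then show "sconv (sdelta g) x u = (if u \<in> G then x (sinv g * u) else 0)"
    using galg_sconv(2,3)[OF sdelta_in_galg[OF assms(1)] assms(2)] by (auto simp: galg_def sdelta_def)
qed

lemma galg_expand: "a \<in> galg G \<Longrightarrow> a = (\<lambda>u. \<Sum>g\<in>G. a g * sdelta g u)"
  by (auto simp: fun_eq_iff galg_def sdelta_def if_distrib cong: if_cong)

lemma sconv_galg_left: "a \<in> galg G \<Longrightarrow> sconv a x = (\<lambda>u. \<Sum>g\<in>G. a g * sconv (sdelta g) x u)"
  by (subst galg_expand) (auto simp: sconv_sum_left sconv_scale_left)

lemma gact_eq: "gact G \<rho> d a v = (\<lambda>i. \<Sum>g\<in>G. a g * matvec d (\<rho> g) v i)"
  by (auto simp: gact_def matvec_def fun_eq_iff)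

lemma gact_sdelta: "g \<in> G \<Longrightarrow> gact G \<rho> d (sdelta g) v = matvec d (\<rho> g) v"
  by (simp add: gact_eq sdelta_def if_distrib[of "\<lambda>z. z * _"] cong: if_cong)

lemma module_map_gactI:
  assumes "left_ideal (galg G) L" "clinear_on L \<phi>"
    and "\<And>g x. g \<in> G \<Longrightarrow> x \<in> L \<Longrightarrow> \<phi> (sconv (sdelta g) x) = matvec d (\<rho> g) (\<phi> x)"
  shows "module_map (galg G) L (gact G \<rho> d) \<phi>"
  unfolding module_map_def
proof (intro conjI ballI assms(2))
  fix a x assume a: "a \<in> galg G" and x: "x \<in> L"
  have L: "csubspace L" using assms(1) by (simp add: left_ideal_iff)
  have 1: "sconv (sdelta g) x \<in> L" if "g \<in> G" for g
    using assms(1) x sdelta_in_galg[OF that] by (simp add: left_ideal_def)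
  have "\<phi> (sconv a x) = (\<lambda>i. \<Sum>g\<in>G. \<phi> (\<lambda>u. a g * sconv (sdelta g) x u) i)"
    unfolding sconv_galg_left[OF a]
    by (rule clinear_on_sum[OF assms(2) L]) (use 1 csubspace_scale[OF L] in blast)
  also have "\<dots> = gact G \<rho> d a (\<phi> x)"
    using clinear_onD(2)[OF assms(2) 1] assms(3)[OF _ x] by (simp add: gact_eq)
  finally show "\<phi> (sconv a x) = gact G \<rho> d a (\<phi> x)" .
qed


lemma left_ideal_galg: "left_ideal (galg G) (galg G)"
  using galg_sconv(2) csubspace_galg by (simp add: left_ideal_iff)

lemma sconv_e_galg: "x \<in> galg G \<Longrightarrow> sconv (sdelta e) x = x"
  using sconv_sdelta_galg[OF e_in_G] G_unit by (auto simp: e_e galg_def fun_eq_iff)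

lemma sconv_sdelta_mult:
  assumes "g \<in> G" "h \<in> G" "x \<in> galg G"
  shows "sconv (sdelta (g * h)) x = sconv (sdelta g) (sconv (sdelta h) x)"
proof -
  note g = assms(1) and h = assms(2) and x = assms(3)
  have "sconv (sdelta h) x \<in> galg G" using galg_sconv(2)[OF sdelta_in_galg[OF h] x] .
  from sconv_sdelta_galg[OF g this]
  show ?thesis
    unfolding sconv_sdelta_galg[OF h x] sconv_sdelta_galg[OF G_mult[OF g h] x]
    using G_mult[OF G_sinv[OF g]] by (simp add: mult.assoc fun_eq_iff)
qed

lemma irreducible_grep_iff:
  "irreducible_grep G e \<rho> d \<longleftrightarrow> is_grep G e \<rho> d \<and> 0 < d \<and>
     (\<forall>U. csubspace U \<and> U \<subseteq> cvec d \<and> (\<forall>g\<in>G. \<forall>v\<in>U. matvec d (\<rho> g) v \<in> U)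
        \<longrightarrow> U = {\<lambda>i. 0} \<or> U = cvec d)"
  unfolding irreducible_grep_def csubspace_def
  by (intro conj_cong arg_cong[where f=All] ext refl imp_cong iffI; elim conjE; intro conjI; assumption)

lemma irreducible_grepD:
  assumes "irreducible_grep G e \<rho> d" "csubspace U" "U \<subseteq> cvec d"
    and "\<And>g v. g \<in> G \<Longrightarrow> v \<in> U \<Longrightarrow> matvec d (\<rho> g) v \<in> U"
  shows "U = {\<lambda>i. 0} \<or> U = cvec d"
  using assms unfolding irreducible_grep_iff by simp

lemma image_of_ideal:
  assumes irr: "irreducible_grep G e \<rho> d" and L: "left_ideal (galg G) L"
    and \<phi>: "module_map (galg G) L (gact G \<rho> d) \<phi>" "\<phi> ` L \<subseteq> cvec d"
  shows "\<phi> ` L = {\<lambda>i. 0} \<or> \<phi> ` L = cvec d"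
proof (rule irreducible_grepD[OF irr _ \<phi>(2)])
  show "csubspace (\<phi> ` L)"
    using clinear_on_image[OF module_map_clinear[OF \<phi>(1)]] L by (simp add: left_ideal_iff)
  fix g v assume g: "g \<in> G" and v: "v \<in> \<phi> ` L"
  then obtain x where x: "x \<in> L" "v = \<phi> x" by blast
  have "sconv (sdelta g) x \<in> L" using L x sdelta_in_galg[OF g] by (simp add: left_ideal_def)
  moreover have "matvec d (\<rho> g) v = \<phi> (sconv (sdelta g) x)"
    using module_map_act[OF \<phi>(1) sdelta_in_galg[OF g] x(1)] gact_sdelta[OF g] x(2) by metis
  ultimately show "matvec d (\<rho> g) v \<in> \<phi> ` L" by blast
qed

lemma simple_if_iso_irreducible:
  assumes irr: "irreducible_grep G e \<rho> d" and L: "left_ideal (galg G) L"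
    and iso: "mod_iso (galg G) L (cvec d) (gact G \<rho> d)"
  shows "simple_left_ideal (galg G) L"
proof -
  obtain \<phi> where \<phi>: "bij_betw \<phi> L (cvec d)" "module_map (galg G) L (gact G \<rho> d) \<phi>"
    using iso unfolding mod_iso_iff by blast
  have sub: "csubspace L" using L by (simp add: left_ideal_iff)
  have z: "\<phi> (\<lambda>u. 0) = (\<lambda>i. 0)" using clinear_on_zero[OF module_map_clinear[OF \<phi>(2)] sub] .
  have "evec 0 \<in> cvec d" "evec 0 \<noteq> (\<lambda>i. 0)"
    using irr evec_in_cvec by (auto simp: irreducible_grep_def evec_def fun_eq_iff)
  then have nz: "L \<noteq> {\<lambda>u. 0}" using \<phi>(1) z by (auto simp: bij_betw_def)
  have "L' = {\<lambda>u. 0} \<or> L' = L" if L': "left_ideal (galg G) L'" "L' \<subseteq> L" for L'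
  proof -
    have mm: "module_map (galg G) L' (gact G \<rho> d) \<phi>"
      using \<phi>(2) L'(2) unfolding module_map_def clinear_on_def by blast
    have zL: "(\<lambda>u. 0) \<in> L'" using L'(1) by (simp add: left_ideal_def)
    have "\<phi> ` L' = {\<lambda>i. 0} \<or> \<phi> ` L' = cvec d"
      by (rule image_of_ideal[OF irr L'(1) mm]) (use \<phi>(1) L'(2) in \<open>auto simp: bij_betw_def\<close>)
    then show ?thesis
    proof
      assume a: "\<phi> ` L' = {\<lambda>i. 0}"
      have "x = (\<lambda>u. 0)" if "x \<in> L'" for x
        using that a z zL L'(2) \<phi>(1) unfolding bij_betw_def
        by (metis imageI inj_onD singletonD subsetD)
      then show ?thesis using zL by blast
    next
      assume "\<phi> ` L' = cvec d"
      then show ?thesis using \<phi>(1) L'(2) unfolding bij_betw_def by (metis inj_on_image_eq_iff order_refl)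
    qed
  qed
  then show ?thesis using L nz unfolding simple_left_ideal_def by blast
qed

text \<open>By irreducibility, the orbit map x -> x v of a nonzero vector v is a surjection of CG
  onto the representation. The orthogonal complement of its kernel is a left ideal on which it is
  injective and still surjective.\<close>

lemma irreducible_occurs:
  assumes irr: "irreducible_grep G e \<rho> d"
  shows "\<exists>L. simple_left_ideal (galg G) L \<and> mod_iso (galg G) L (cvec d) (gact G \<rho> d)"
proof -
  interpret g: star_algebra "galg G" vec_lambda by (rule star_algebra_galg)
  have d: "0 < d" and rep: "is_grep G e \<rho> d" using irr by (auto simp: irreducible_grep_def)
  let ?v = "evec 0"
  define \<psi> where "\<psi> x = gact G \<rho> d x ?v" for x
  have \<psi>_eq: "\<psi> x = (\<lambda>i. \<Sum>g\<in>G. x g * matvec d (\<rho> g) ?v i)" for x by (simp add: \<psi>_def gact_eq)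
  have lin: "clinear_on (galg G) \<psi>"
    unfolding clinear_on_def \<psi>_eq
    by (auto simp: fun_eq_iff sum.distrib[symmetric] sum_distrib_left algebra_simps)
  have mm: "module_map (galg G) (galg G) (gact G \<rho> d) \<psi>"
  proof (rule module_map_gactI[OF left_ideal_galg lin])
    fix g x assume g: "g \<in> G" and x: "x \<in> galg G"
    have mv: "matvec d (\<rho> (g * h)) ?v i = matvec d (\<rho> g) (matvec d (\<rho> h) ?v) i" if h: "h \<in> G" for h i
    proof (cases "i < d")
      case True
      then have "matvec d (\<rho> (g * h)) ?v i = (\<Sum>l<d. \<rho> g i l * \<rho> h l 0)"
        using rep g h d by (simp add: matvec_evec is_grep_def)
      also have "\<dots> = (\<Sum>l<d. \<rho> g i l * matvec d (\<rho> h) ?v l)" using d by (simp add: matvec_evec)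
      finally show ?thesis using True by (simp add: matvec_def)
    qed (simp add: matvec_def)
    have "\<psi> (sconv (sdelta g) x) i = matvec d (\<rho> g) (\<psi> x) i" for i
    proof -
      have "\<psi> (sconv (sdelta g) x) i = (\<Sum>k\<in>G. x (sinv g * k) * matvec d (\<rho> k) ?v i)"
        using sconv_sdelta_galg[OF g x] by (simp add: \<psi>_eq)
      also have "\<dots> = (\<Sum>h\<in>G. x h * matvec d (\<rho> (g * h)) ?v i)"
      proof (rule sum.reindex_bij_witness[of _ "\<lambda>h. g * h" "\<lambda>k. sinv g * k"])
        fix k assume k: "k \<in> G"
        have "g * (sinv g * k) = e * k" "sinv g * (g * k) = e * k" 
          using g by (simp_all add: G_iff flip: mult.assoc)
        then show "g * (sinv g * k) = k" "sinv g * (g * k) = k" using G_unit[OF k] by simp_all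
        then show "x (sinv g * k) * matvec d (\<rho> (g * (sinv g * k))) ?v i = x (sinv g * k) * matvec d (\<rho> k) ?v i"
          by simp
      qed (use g G_mult G_sinv in auto)
      also have "\<dots> = (\<Sum>h\<in>G. x h * matvec d (\<rho> g) (matvec d (\<rho> h) ?v) i)"
        by (intro sum.cong refl) (simp only: mv)
      also have "\<dots> = (\<Sum>h\<in>G. matvec d (\<rho> g) (\<lambda>i. x h * matvec d (\<rho> h) ?v i) i)"
        using clinear_onD(2)[OF clinear_matvec[of UNIV d "\<rho> g"]] by simp
      also have "\<dots> = matvec d (\<rho> g) (\<psi> x) i"
        unfolding \<psi>_eq
        using clinear_on_sum[OF clinear_matvec[of UNIV d "\<rho> g"], of G "\<lambda>h i. x h * matvec d (\<rho> h) ?v i"]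
        by (simp add: csubspace_def)
      finally show ?thesis .
    qed
    then show "\<psi> (sconv (sdelta g) x) = matvec d (\<rho> g) (\<psi> x)" by blast
  qed
  have \<psi>_cvec: "\<psi> x \<in> cvec d" for x by (simp add: \<psi>_def gact_def cvec_def)
  let ?K = "{x\<in>galg G. \<psi> x = (\<lambda>i. 0)}"
  have K: "left_ideal (galg G) ?K"
    by (rule left_ideal_kernel[OF left_ideal_galg mm]) (simp add: gact_def fun_eq_iff)
  let ?N = "{x\<in>galg G. g.orth x ?K}"
  have N: "left_ideal (galg G) ?N" by (rule g.left_ideal_orth[OF K])
  have "\<psi> (sdelta e) = matvec d (\<rho> e) ?v" using gact_sdelta[OF e_in_G] by (simp add: \<psi>_def)
  then have "\<psi> (sdelta e) 0 = 1" using d rep by (simp add: matvec_evec is_grep_def)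
  then have "\<psi> ` galg G \<noteq> {\<lambda>i. 0}" using sdelta_in_galg[OF e_in_G] by (metis imageI singletonD zero_neq_one)
  then have surj: "\<psi> ` galg G = cvec d"
    using image_of_ideal[OF irr left_ideal_galg mm] \<psi>_cvec by blast
  have "cvec d \<subseteq> \<psi> ` ?N"
  proof
    fix w assume "w \<in> cvec d"
    then obtain x where x: "x \<in> galg G" "w = \<psi> x" using surj by blast
    obtain y where y: "y \<in> ?K" "g.orth (\<lambda>u. x u - y u) ?K"
      using g.projection_exists K unfolding left_ideal_iff by blast
    have "\<psi> (\<lambda>u. x u - y u) = w"
      using clinear_on_diff[OF lin csubspace_galg x(1)] y(1) x(2) by simp
    moreover have "(\<lambda>u. x u - y u) \<in> ?N" using csubspace_diff[OF csubspace_galg x(1)] y by simp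
    ultimately show "w \<in> \<psi> ` ?N" by blast
  qed
  moreover have mmN: "module_map (galg G) ?N (gact G \<rho> d) \<psi>"
    using mm unfolding module_map_def clinear_on_def by blast
  moreover have "inj_on \<psi> ?N"
  proof (rule clinear_on_inj[OF module_map_clinear[OF mmN]])
    show "csubspace ?N" using N by (simp add: left_ideal_iff)
    show "x = (\<lambda>u. 0)" if "x \<in> ?N" "\<psi> x = (\<lambda>i. 0)" for x using that g.orth_self by blast
  qed
  ultimately have "mod_iso (galg G) ?N (cvec d) (gact G \<rho> d)"
    unfolding mod_iso_iff bij_betw_def using \<psi>_cvec by blast
  then show ?thesis using simple_if_iso_irreducible[OF irr N] by blast
qed

text \<open>Transport of structure: coordinates on L turn left multiplication by g into a matrix,
  and an invariant subspace U pulls back to a left ideal inside L.\<close>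

lemma simple_ideal_matrix_rep:
  assumes L: "simple_left_ideal (galg G) L"
  shows "\<exists>\<rho> d. irreducible_grep G e \<rho> d \<and> mod_iso (galg G) L (cvec d) (gact G \<rho> d)"
proof -
  have li: "left_ideal (galg G) L" and sub: "csubspace L" "L \<subseteq> galg G"
    using L by (auto simp: simple_left_ideal_def left_ideal_iff)
  obtain d \<phi> where \<phi>: "bij_betw \<phi> L (cvec d)" "clinear_on L \<phi>"
    using csubspace_coordinates[OF sub(1)] by blast
  let ?k = "inv_into L \<phi>"
  have k: "?k v \<in> L" "\<phi> (?k v) = v" if "v \<in> cvec d" for v
    using that \<phi>(1) by (auto simp: bij_betw_def inv_into_into f_inv_into_f)
  have k': "?k (\<phi> x) = x" "\<phi> x \<in> cvec d" if "x \<in> L" for x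
    using that \<phi>(1) by (auto simp: bij_betw_def)
  have act: "sconv (sdelta g) x \<in> L" if "g \<in> G" "x \<in> L" for g x
    using that(2) li sdelta_in_galg[OF that(1)] by (auto simp: left_ideal_def)
  define \<rho> where "\<rho> g i j = \<phi> (sconv (sdelta g) (?k (evec j))) i" for g and i j :: nat
  have lin: "clinear_on (cvec d) (\<lambda>v. \<phi> (sconv (sdelta g) (?k v)))" if g: "g \<in> G" for g
    using clinear_onD[OF clinear_on_inv_into[OF \<phi> sub(1)]] clinear_onD[OF \<phi>(2)] act[OF g] k(1)
    unfolding clinear_on_def by (simp add: sconv_add_right sconv_scale_right)
  have mv: "\<phi> (sconv (sdelta g) x) = matvec d (\<rho> g) (\<phi> x)" if g: "g \<in> G" and x: "x \<in> L" for g x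
  proof
    fix i
    have "\<phi> (sconv (sdelta g) (?k (\<phi> x))) i = (\<Sum>j<d. \<rho> g i j * \<phi> x j)"
      using clinear_on_cvec[OF lin[OF g] k'(2)[OF x]] by (simp add: \<rho>_def)
    moreover have "\<phi> (sconv (sdelta g) x) i = 0" if "\<not> i < d"
      using that k'(2)[OF act[OF g x]] by (simp add: cvec_def)
    ultimately show "\<phi> (sconv (sdelta g) x) i = matvec d (\<rho> g) (\<phi> x) i"
      using k'(1)[OF x] by (simp add: matvec_def)
  qed
  have iso: "mod_iso (galg G) L (cvec d) (gact G \<rho> d)"
    unfolding mod_iso_iff using \<phi> module_map_gactI[OF li \<phi>(2) mv] by blast
  have z: "\<phi> (\<lambda>u. 0) = (\<lambda>i. 0)" using clinear_on_zero[OF \<phi>(2) sub(1)] .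
  have "\<rho> e i j = (if i = j then 1 else 0)" if "j < d" for i j
    using sconv_e_galg[OF subsetD[OF sub(2) k(1)[OF evec_in_cvec[OF that]]]] k(2)[OF evec_in_cvec[OF that]]
    by (simp add: \<rho>_def evec_def)
  moreover have "\<rho> (g * h) i j = (\<Sum>l<d. \<rho> g i l * \<rho> h l j)" if gh: "g \<in> G" "h \<in> G" and ij: "i < d" "j < d" for g h i j
  proof -
    let ?x = "?k (evec j)"
    have x: "?x \<in> L" using k(1)[OF evec_in_cvec[OF ij(2)]] .
    have "\<rho> (g * h) i j = \<phi> (sconv (sdelta g) (sconv (sdelta h) ?x)) i"
      using sconv_sdelta_mult[OF gh subsetD[OF sub(2) x]] by (simp add: \<rho>_def)
    also have "\<dots> = matvec d (\<rho> g) (\<phi> (sconv (sdelta h) ?x)) i" using mv[OF gh(1) act[OF gh(2) x]] by simp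
    finally show ?thesis using ij by (simp add: matvec_def \<rho>_def)
  qed
  ultimately have rep: "is_grep G e \<rho> d" by (simp add: is_grep_def)
  have "0 < d"
  proof (rule ccontr)
    assume "\<not> 0 < d"
    then have "\<phi> x = (\<lambda>i. 0)" if "x \<in> L" for x using k'(2)[OF that] by (auto simp: cvec_def)
    then have "x = (\<lambda>u. 0)" if "x \<in> L" for x using that k'(1) z csubspace_zero[OF sub(1)] by metis
    then have "L = {\<lambda>u. 0}" using csubspace_zero[OF sub(1)] by blast
    then show False using L by (simp add: simple_left_ideal_def)
  qed
  moreover have "U = {\<lambda>i. 0} \<or> U = cvec d" if U: "U \<subseteq> cvec d" "csubspace U"
    "\<And>g v. g \<in> G \<Longrightarrow> v \<in> U \<Longrightarrow> matvec d (\<rho> g) v \<in> U" for U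
  proof -
    let ?L = "{x\<in>L. \<phi> x \<in> U}"
    have im: "\<phi> ` ?L = U" using U(1) k by force
    have "sconv a x \<in> ?L" if a: "a \<in> galg G" and x: "x \<in> ?L" for a x
    proof -
      have "\<phi> (sconv a x) = gact G \<rho> d a (\<phi> x)"
        using module_map_act[OF module_map_gactI[OF li \<phi>(2) mv] a] x by blast
      also have "\<dots> \<in> U" unfolding gact_eq
        by (rule csubspace_sum[OF U(2)], rule csubspace_scale[OF U(2)], rule U(3)) (use x in auto)
      finally show ?thesis using a x li by (simp add: left_ideal_def)
    qed
    moreover have "csubspace ?L"
      using sub(1) U(2) clinear_onD[OF \<phi>(2)] z unfolding csubspace_def by simp
    ultimately have "left_ideal (galg G) ?L" using sub(2) by (auto simp: left_ideal_iff)
    then have "?L = {\<lambda>u. 0} \<or> ?L = L" using L unfolding simple_left_ideal_def by blast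
    then show ?thesis
    proof
      assume "?L = {\<lambda>u. 0}"
      then have "U = \<phi> ` {\<lambda>u. 0}" using im by simp
      then show ?thesis using z by simp
    next
      assume "?L = L"
      then have "U = \<phi> ` L" using im by simp
      then show ?thesis using \<phi>(1) by (simp add: bij_betw_def)
    qed
  qed
  ultimately have "irreducible_grep G e \<rho> d" using rep unfolding irreducible_grep_iff by blast
  then show ?thesis using iso by blast
qed

lemma mod_iso_imp_equiv_grep:
  assumes li: "left_ideal (galg G) L"
    and "mod_iso (galg G) L (cvec d) (gact G \<rho> d)" "mod_iso (galg G) L (cvec d') (gact G \<rho>' d')"
  shows "equiv_grep G \<rho> d \<rho>' d'"
proof -
  obtain \<phi> \<phi>' where \<phi>: "bij_betw \<phi> L (cvec d)" "module_map (galg G) L (gact G \<rho> d) \<phi>"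
    and \<phi>': "bij_betw \<phi>' L (cvec d')" "module_map (galg G) L (gact G \<rho>' d') \<phi>'"
    using assms(2,3) unfolding mod_iso_iff by blast
  have sub: "csubspace L" using li by (simp add: left_ideal_iff)
  let ?k = "inv_into L \<phi>"
  have k: "?k v \<in> L" "\<phi> (?k v) = v" if "v \<in> cvec d" for v
    using that \<phi>(1) by (auto simp: bij_betw_def inv_into_into f_inv_into_f)
  have k': "?k (\<phi> x) = x" if "x \<in> L" for x
    using that \<phi>(1) by (auto simp: bij_betw_def)
  show ?thesis
  proof (rule equiv_grepI)
    show "bij_betw (\<phi>' \<circ> ?k) (cvec d) (cvec d')"
      using bij_betw_trans[OF bij_betw_inv_into[OF \<phi>(1)] \<phi>'(1)] .
    show "clinear_on (cvec d) (\<phi>' \<circ> ?k)"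
      using clinear_onD[OF clinear_on_inv_into[OF \<phi>(1) module_map_clinear[OF \<phi>(2)] sub]]
        clinear_onD[OF module_map_clinear[OF \<phi>'(2)]] k(1)
      unfolding clinear_on_def by simp
    fix g v assume g: "g \<in> G" and v: "v \<in> cvec d"
    let ?x = "?k v"
    have gx: "sconv (sdelta g) ?x \<in> L"
      using li k(1)[OF v] sdelta_in_galg[OF g] by (simp add: left_ideal_def)
    have "matvec d (\<rho> g) v = \<phi> (sconv (sdelta g) ?x)"
      using module_map_act[OF \<phi>(2) sdelta_in_galg[OF g] k(1)[OF v]] k(2)[OF v] gact_sdelta[OF g] by metis
    then have "(\<phi>' \<circ> ?k) (matvec d (\<rho> g) v) = \<phi>' (sconv (sdelta g) ?x)" using k'[OF gx] by simp
    also have "\<dots> = matvec d' (\<rho>' g) (\<phi>' ?x)"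
      using module_map_act[OF \<phi>'(2) sdelta_in_galg[OF g] k(1)[OF v]] gact_sdelta[OF g] by metis
    finally show "(\<phi>' \<circ> ?k) (matvec d (\<rho> g) v) = matvec d' (\<rho>' g) ((\<phi>' \<circ> ?k) v)" by simp
  qed
qed

text \<open>An equivalence satisfies P \<rho> = \<rho>' P, so the inverse matrix Q carries the
  module of \<rho>' to that of \<rho>; the given isomorphism is composed with Q.\<close>

lemma mod_iso_equiv_grep:
  assumes li: "left_ideal (galg G) L"
    and eq: "equiv_grep G \<rho> d \<rho>' d'" and iso: "mod_iso (galg G) L (cvec d') (gact G \<rho>' d')"
  shows "mod_iso (galg G) L (cvec d) (gact G \<rho> d)"
proof -
  have dd: "d' = d" using eq by (simp add: equiv_grep_def)
  obtain P Q where
    PQ: "\<forall>i<d. \<forall>j<d. (\<Sum>l<d. P i l * Q l j) = (if i = j then 1 else 0)"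
    and QP: "\<forall>i<d. \<forall>j<d. (\<Sum>l<d. Q i l * P l j) = (if i = j then 1 else 0)"
    and tw: "\<forall>g\<in>G. \<forall>i<d. \<forall>j<d. (\<Sum>l<d. P i l * \<rho> g l j) = (\<Sum>l<d. \<rho>' g i l * P l j)"
    using eq unfolding equiv_grep_def by (elim conjE exE)
  obtain \<phi> where \<phi>: "bij_betw \<phi> L (cvec d)" "module_map (galg G) L (gact G \<rho>' d) \<phi>"
    using iso dd unfolding mod_iso_iff by blast
  have comp: "matvec d M (matvec d N v) = matvec d (\<lambda>i j. \<Sum>l<d. M i l * N l j) v" for M N v
  proof
    fix i
    have "(\<Sum>l<d. M i l * (\<Sum>j<d. N l j * v j)) = (\<Sum>l<d. \<Sum>j<d. M i l * N l j * v j)"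
      by (simp add: sum_distrib_left mult.assoc)
    also have "\<dots> = (\<Sum>j<d. \<Sum>l<d. M i l * N l j * v j)" by (rule sum.swap)
    finally show "matvec d M (matvec d N v) i = matvec d (\<lambda>i j. \<Sum>l<d. M i l * N l j) v i"
      by (simp add: matvec_def sum_distrib_right)
  qed
  have cong: "matvec d M v = matvec d N v" if "\<And>i j. i < d \<Longrightarrow> j < d \<Longrightarrow> M i j = N i j" for M N v
    using that by (auto simp: matvec_def fun_eq_iff intro!: sum.cong)
  have one: "matvec d (\<lambda>i j. if i = j then 1 else 0) v = v" if "v \<in> cvec d" for v
    using that by (auto simp: matvec_def cvec_def fun_eq_iff if_distrib[of "\<lambda>z. z * _"] cong: if_cong)
  have QPv: "matvec d Q (matvec d P v) = v" if "v \<in> cvec d" for v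
    unfolding comp using cong[where v = v, OF QP[rule_format]] one[OF that] by simp
  have PQv: "matvec d P (matvec d Q v) = v" if "v \<in> cvec d" for v
    unfolding comp using cong[where v = v, OF PQ[rule_format]] one[OF that] by simp
  have bij: "bij_betw (matvec d Q) (cvec d) (cvec d)"
    by (rule bij_betwI[of _ _ _ "matvec d P"]) (auto simp: QPv PQv matvec_in_cvec)
  have twv: "matvec d Q (matvec d (\<rho>' g) v) = matvec d (\<rho> g) (matvec d Q v)" if g: "g \<in> G" and v: "v \<in> cvec d" for g v
  proof -
    let ?w = "matvec d Q v"
    have "matvec d P (matvec d (\<rho> g) ?w) = matvec d (\<rho>' g) (matvec d P ?w)"
      unfolding comp[of P "\<rho> g"] comp[of "\<rho>' g" P] by (rule cong[OF tw[rule_format, OF g]])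
    then have "matvec d P (matvec d (\<rho> g) ?w) = matvec d (\<rho>' g) v" using PQv[OF v] by simp
    then show ?thesis using QPv[OF matvec_in_cvec] by metis
  qed
  have \<phi>v: "\<phi> x \<in> cvec d" if "x \<in> L" for x using that \<phi>(1) by (auto simp: bij_betw_def)
  have "module_map (galg G) L (gact G \<rho> d) (matvec d Q \<circ> \<phi>)"
  proof (rule module_map_gactI[OF li])
    show "clinear_on L (matvec d Q \<circ> \<phi>)"
      using clinear_onD[OF clinear_matvec[of UNIV d Q]] clinear_onD[OF module_map_clinear[OF \<phi>(2)]]
      unfolding clinear_on_def by simp
    fix g x assume g: "g \<in> G" and x: "x \<in> L"
    then show "(matvec d Q \<circ> \<phi>) (sconv (sdelta g) x) = matvec d (\<rho> g) ((matvec d Q \<circ> \<phi>) x)"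
      using module_map_act[OF \<phi>(2) sdelta_in_galg[OF g] x] gact_sdelta[OF g] twv[OF g \<phi>v[OF x]] by simp
  qed
  then show ?thesis unfolding mod_iso_iff using bij_betw_trans[OF \<phi>(1) bij] by blast
qed

text \<open>Every irreducible representation occurs in CG, and every simple ideal has a matrix
  representation, which is equivalent to a member of R. Since there are finitely many components,
  the bijection also makes R finite.\<close>

lemma components_galg:
  assumes R: "complete_irr G e R"
  shows "bij_betw (\<lambda>(\<rho>, d). isotypic (galg G) (cvec d) (gact G \<rho> d)) R (isotypic_components (galg G))"
    (is "bij_betw ?W R ?C")
  unfolding bij_betw_def
proof
  interpret g: star_algebra "galg G" vec_lambda by (rule star_algebra_galg)
  have irr: "irreducible_grep G e \<rho> d" if "(\<rho>, d) \<in> R" for \<rho> d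
    using R that unfolding complete_irr_def by blast
  have uniq: "(\<rho>, d) = (\<rho>', d')" if "(\<rho>, d) \<in> R" "(\<rho>', d') \<in> R" "equiv_grep G \<rho> d \<rho>' d'" for \<rho> d \<rho>' d'
    using R that unfolding complete_irr_def by blast
  have li: "left_ideal (galg G) L" if "simple_left_ideal (galg G) L" for L
    using that by (simp add: simple_left_ideal_def)
  show "inj_on ?W R"
  proof (rule inj_onI, clarify)
    fix \<rho> d \<rho>' d' assume r: "(\<rho>, d) \<in> R" "(\<rho>', d') \<in> R"
      and eq: "isotypic (galg G) (cvec d) (gact G \<rho> d) = isotypic (galg G) (cvec d') (gact G \<rho>' d')"
    obtain L where L: "simple_left_ideal (galg G) L" "mod_iso (galg G) L (cvec d) (gact G \<rho> d)"
      using irreducible_occurs[OF irr[OF r(1)]] by blast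
    obtain L' where L': "simple_left_ideal (galg G) L'" "mod_iso (galg G) L' (cvec d') (gact G \<rho>' d')"
      using irreducible_occurs[OF irr[OF r(2)]] by blast
    have "mod_iso (galg G) L L' sconv"
      using g.isotypic_eq_imp_mod_iso[OF L(1) L'(1)] eq
        isotypic_cong[OF li[OF L(1)] L(2)] isotypic_cong[OF li[OF L'(1)] L'(2)] by simp
    then have "equiv_grep G \<rho> d \<rho>' d'"
      using mod_iso_imp_equiv_grep[OF li[OF L(1)] L(2)] mod_iso_trans[OF li[OF L'(1)] _ L'(2)] by blast
    then show "\<rho> = \<rho>' \<and> d = d'" using uniq[OF r] by simp
  qed
  show "?W ` R = ?C"
  proof
    show "?W ` R \<subseteq> ?C"
    proof clarify
      fix \<rho> d assume r: "(\<rho>, d) \<in> R"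
      obtain L where L: "simple_left_ideal (galg G) L" "mod_iso (galg G) L (cvec d) (gact G \<rho> d)"
        using irreducible_occurs[OF irr[OF r]] by blast
      then show "isotypic (galg G) (cvec d) (gact G \<rho> d) \<in> ?C"
        using isotypic_cong[OF li[OF L(1)] L(2)] unfolding isotypic_components_def by blast
    qed
    show "?C \<subseteq> ?W ` R"
    proof
      fix V assume "V \<in> ?C"
      then obtain L where L: "simple_left_ideal (galg G) L" "V = isotypic (galg G) L sconv"
        unfolding isotypic_components_def by blast
      obtain \<rho>' d' where r': "irreducible_grep G e \<rho>' d'" "mod_iso (galg G) L (cvec d') (gact G \<rho>' d')"
        using simple_ideal_matrix_rep[OF L(1)] by blast
      then obtain \<rho> d where r: "(\<rho>, d) \<in> R" "equiv_grep G \<rho> d \<rho>' d'"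
        using R unfolding complete_irr_def by blast
      then have "V = isotypic (galg G) (cvec d) (gact G \<rho> d)"
        using isotypic_cong[OF li[OF L(1)] mod_iso_equiv_grep[OF li[OF L(1)] r(2) r'(2)]] L(2) by simp
      then show "V \<in> ?W ` R" using r(1) by force
    qed
  qed
qed

end

section \<open>Matrix units over the group algebra\<close>

context inv_semigroup
begin

lemma nle_same_dom:
  assumes "nle s (t::'a)" "sinv s * s = sinv t * t" shows "s = t"
proof -
  have "sinv s = sinv t" using nle_same_ran[OF nle_sinv[OF assms(1)]] assms(2) by simp
  then show ?thesis by (metis sinv_sinv)
qed

lemma ran_mult:
  assumes "sinv s * s = t * sinv (t::'a)"
  shows "s * t * sinv (s * t) = s * sinv s" and "sinv (s * t) * (s * t) = sinv t * t"
proof -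
  have "s * t * sinv (s * t) = s * (t * sinv t) * sinv s" by (simp add: mult.assoc)
  then show "s * t * sinv (s * t) = s * sinv s" unfolding assms[symmetric] by (simp add: mult.assoc)
  have "sinv (s * t) * (s * t) = sinv t * (sinv s * s) * t" by (simp add: mult.assoc)
  then show "sinv (s * t) * (s * t) = sinv t * t" unfolding assms by (simp add: mult.assoc)
qed

lemma quotient_eq_iff:
  assumes "s * sinv s = u * sinv (u::'a)"
  shows "sinv s * u = t \<and> sinv s * s = t * sinv t \<longleftrightarrow> u = s * t \<and> sinv s * s = t * sinv t"
proof -
  have "s * (sinv s * u) = u" using assms by (metis mult.assoc sinv1)
  moreover have "sinv s * (s * t) = t" if "sinv s * s = t * sinv t"
    using that by (metis mult.assoc sinv1)
  ultimately show ?thesis by auto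
qed

lemma dom_quotient:
  assumes "s * sinv s = u * sinv (u::'a)"
  shows "sinv (sinv s * u) * (sinv s * u) = sinv u * u" and "(sinv s * u) * sinv (sinv s * u) = sinv s * s"
  using ran_mult[of "sinv s" u] assms by simp_all

text \<open>The assumptions on x are made to cover both \<open>gfloor g\<close>, whose only nonzero
  coordinate is at g, and g itself, whose coordinates are the indicator of the elements below g.
  Only elements with the domain of g are composable with t, so both act on t alike.\<close>

lemma gconv_sdelta_right:
  assumes dom: "sinv g * g = t * sinv (t::'a)"
    and x: "x g = 1" "\<And>s. s \<noteq> g \<Longrightarrow> sinv s * s = sinv g * g \<Longrightarrow> x s = 0"
  shows "gconv x (sdelta t) = sdelta (g * t)"
proof
  fix u
  have "x s * sdelta t (sinv s * u) = (if s = g \<and> u = g * t then 1 else 0)"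
    if su: "s * sinv s = u * sinv u" for s
  proof (cases "sinv s * u = t")
    case True
    then have "sinv s * s = sinv g * g" using dom_quotient(2)[OF su] dom by simp
    then show ?thesis using True x quotient_eq_iff[OF su, of t] dom by (auto simp: sdelta_def)
  next
    case False
    then show ?thesis using quotient_eq_iff[OF su, of t] dom by (auto simp: sdelta_def)
  qed
  then have "gconv x (sdelta t) u = (\<Sum>s\<in>{s. s * sinv s = u * sinv u}. if s = g \<and> u = g * t then 1 else 0)"
    unfolding gconv_def by (intro sum.cong) auto
  also have "\<dots> = (\<Sum>s\<in>{s. s * sinv s = u * sinv u}. if s = g then if u = g * t then 1 else 0 else 0)"
    by (rule sum.cong) auto
  also have "\<dots> = sdelta (g * t) u"
    using ran_mult(1)[OF dom] by (auto simp: sdelta_def)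
  finally show "gconv x (sdelta t) u = sdelta (g * t) u" .
qed

lemma sconv_gfloor_gfloor:
  assumes "sinv g * g = t * sinv (t::'a)"
  shows "sconv (gfloor g) (gfloor t) = gfloor (g * t)"
proof -
  have "theta (sconv (gfloor g) (gfloor t)) = theta (gfloor (g * t))"
    unfolding theta_sconv theta_gfloor by (rule gconv_sdelta_right[OF assms]) (auto simp: sdelta_def)
  then show ?thesis by (simp only: theta_inject)
qed

lemma theta_sdelta: "theta (sdelta g) s = (if nle s g then 1 else 0)"
proof -
  have "theta (sdelta g) s = (\<Sum>u\<in>UNIV. if u = g then if nle s g then 1 else 0 else 0)"
    unfolding theta_alt by (rule sum.cong) (auto simp: sdelta_def)
  then show ?thesis by simp
qed

text \<open>An element below g with the same domain idempotent is g. So among the summands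
  \<open>gfloor s\<close> of g, for s \<le> g, only \<open>gfloor g\<close> is composable with
  t.\<close>

lemma sconv_sdelta_gfloor:
  assumes "sinv g * g = t * sinv (t::'a)"
  shows "sconv (sdelta g) (gfloor t) = gfloor (g * t)"
proof -
  have "theta (sconv (sdelta g) (gfloor t)) = theta (gfloor (g * t))"
    unfolding theta_sconv theta_gfloor
    by (rule gconv_sdelta_right[OF assms]) (use nle_same_dom in \<open>auto simp: theta_sdelta\<close>)
  then show ?thesis by (simp only: theta_inject)
qed

lemma theta_sum: "theta (\<lambda>u. \<Sum>i\<in>I. x i u) = (\<lambda>s. \<Sum>i\<in>I. theta (x i) s)"
  unfolding theta_def by (subst sum.swap) (rule refl)

text \<open>The \<open>gfloor s\<close> form a basis with coordinates \<open>theta\<close>, so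
  exactly one linear map has the values prescribed in \<open>rhobar\<close>, and the definite
  description can be evaluated.\<close>

lemma rhobar_eq:
  "rhobar (D :: 'a set) p \<rho> d x v w = (\<Sum>s\<in>UNIV. theta x s * rhobar_basis D p \<rho> d s v w)"
proof -
  define R0 where "R0 x v w = (\<Sum>s\<in>UNIV. theta x s * rhobar_basis D p \<rho> d s v w)" for x v w
  have "rhobar D p \<rho> d = R0"
    unfolding rhobar_def
  proof (rule the_equality, intro conjI allI)
    show "R0 (\<lambda>u. x u + y u) = (\<lambda>v w. R0 x v w + R0 y v w)" for x y
      by (simp add: R0_def theta_add fun_eq_iff algebra_simps sum.distrib)
    show "R0 (\<lambda>u. c * x u) = (\<lambda>v w. c * R0 x v w)" for c x
      by (simp add: R0_def theta_scale fun_eq_iff sum_distrib_left mult.assoc)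
    show "R0 (gfloor s) = rhobar_basis D p \<rho> d s" for s
      by (simp add: R0_def sdelta_def fun_eq_iff if_distrib[of "\<lambda>z. z * _"] cong: if_cong)
  next
    fix R assume R: "(\<forall>x y. R (\<lambda>u. x u + y u) = (\<lambda>v w. R x v w + R y v w)) \<and>
      (\<forall>c x. R (\<lambda>u. c * x u) = (\<lambda>v w. c * R x v w)) \<and> (\<forall>s. R (gfloor s) = rhobar_basis D p \<rho> d s)"
    show "R = R0"
    proof (intro ext)
      fix x v w
      have lin: "clinear_on UNIV (\<lambda>x. R x v)" using R by (simp add: clinear_on_def)
      have "R x v = R (\<lambda>u. \<Sum>s\<in>UNIV. theta x s * gfloor s u) v"
        using gsum_theta[of x] by (simp add: gsum_def)
      also have "\<dots> = (\<lambda>w. \<Sum>s\<in>UNIV. R (\<lambda>u. theta x s * gfloor s u) v w)"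
        by (rule clinear_on_sum[OF lin]) (auto simp: csubspace_def)
      finally show "R x v w = R0 x v w" using R by (simp add: R0_def)
    qed
  qed
  then show ?thesis by (simp add: R0_def)
qed

end

section \<open>Arrows of a D-class and matrix entries over the group algebra\<close>

locale transversal = inv_semigroup_idem T e for T :: "'a::{finite,semigroup_mult} itself" and e :: 'a +
  fixes p :: "'a \<Rightarrow> 'a"
  assumes p_spec: "c \<in> Dclass e \<Longrightarrow> idem c \<Longrightarrow> sinv (p c) * p c = e \<and> p c * sinv (p c) = c"
    and p_e: "p e = e"
begin

definition ids :: "'a set" where "ids = {c \<in> Dclass e. idem c}"

lemma p_ids: "c \<in> ids \<Longrightarrow> sinv (p c) * p c = e" "c \<in> ids \<Longrightarrow> p c * sinv (p c) = c"
  using p_spec unfolding ids_def by blast+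

lemma Dclass_iff: "s \<in> Dclass e \<longleftrightarrow> (\<exists>u. sinv u * u = sinv s * s \<and> u * sinv u = e)"
  by (simp add: Dclass_def Drel_def e_e)

lemma dom_in_ids: "sinv s * s \<in> ids \<longleftrightarrow> s \<in> Dclass e"
proof -
  have "sinv (sinv s * s) * (sinv s * s) = sinv s * s" by (simp add: mult.assoc)
  then show ?thesis unfolding ids_def by (simp add: Dclass_iff)
qed

lemma e_in_ids: "e \<in> ids"
  unfolding ids_def using idem_e by (auto simp: Dclass_iff e_e intro!: exI[of _ e])

text \<open>If u leads from the domain of s to e, then u s^-1 leads from the domain of s^-1 to
  e.\<close>

lemma Dclass_sinv: assumes "s \<in> Dclass e" shows "sinv s \<in> Dclass e"
proof -
  obtain u where u: "sinv u * u = sinv s * s" "u * sinv u = e" using assms by (auto simp: Dclass_iff)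
  then have "sinv u * u = sinv s * sinv (sinv s)" by simp
  from ran_mult[OF this] u have "sinv (u * sinv s) * (u * sinv s) = sinv (sinv s) * sinv s"
    "(u * sinv s) * sinv (u * sinv s) = e" by simp_all
  then show ?thesis unfolding Dclass_iff by blast
qed

lemma ran_in_ids: "s * sinv s \<in> ids \<longleftrightarrow> s \<in> Dclass e"
  using dom_in_ids[of "sinv s"] Dclass_sinv[of s] Dclass_sinv[of "sinv s"] by auto

text \<open>The group coordinate of s. Together with the range and domain idempotents it identifies
  an element of the D-class with a matrix unit times an element of G.\<close>

definition iso_part :: "'a \<Rightarrow> 'a" where
  "iso_part s = sinv (p (s * sinv s)) * s * p (sinv s * s)"

lemma
  assumes "s \<in> Dclass e"
  shows iso_part_in_G: "iso_part s \<in> G"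
    and arrow_iso_part: "p (s * sinv s) * iso_part s * sinv (p (sinv s * s)) = s"
proof -
  let ?r = "p (s * sinv s)" and ?d = "p (sinv s * s)"
  have r: "sinv ?r * ?r = e" "?r * sinv ?r = s * sinv s"
    and d: "sinv ?d * ?d = e" "?d * sinv ?d = sinv s * s"
    using p_ids assms ran_in_ids dom_in_ids by blast+
  have 1: "sinv (sinv ?r) * sinv ?r = s * sinv s" "sinv s * s = ?d * sinv ?d" using r d by simp_all
  have 2: "sinv ?r * s * sinv (sinv ?r * s) = e" "sinv (sinv ?r * s) * (sinv ?r * s) = ?d * sinv ?d"
    using ran_mult[OF 1(1)] 1 r by simp_all
  show "iso_part s \<in> G" unfolding iso_part_def G_iff using ran_mult[OF 2(2)] 2(1) d by simp
  have "?r * iso_part s * sinv ?d = (?r * sinv ?r) * s * (?d * sinv ?d)"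
    unfolding iso_part_def by (simp only: mult.assoc)
  then show "?r * iso_part s * sinv ?d = s" unfolding r d by (simp add: mult.assoc)
qed

text \<open>Consecutive factors of \<open>p c * g * sinv (p a)\<close> are composable, so range and
  domain are read off at the two ends, and conjugating back cancels the p's.\<close>

lemma
  assumes c: "c \<in> ids" and a: "a \<in> ids" and g: "g \<in> G"
  shows arrow_dom: "sinv (p c * g * sinv (p a)) * (p c * g * sinv (p a)) = a"
    and arrow_ran: "(p c * g * sinv (p a)) * sinv (p c * g * sinv (p a)) = c"
    and iso_part_arrow: "iso_part (p c * g * sinv (p a)) = g"
proof -
  let ?s = "p c * g * sinv (p a)"
  have 1: "sinv (p c) * p c = g * sinv g" using p_ids(1)[OF c] g by (simp add: G_iff)
  have 2: "sinv (p c * g) * (p c * g) = sinv (p a) * sinv (sinv (p a))"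
    using ran_mult[OF 1] p_ids(1)[OF a] g by (simp add: G_iff)
  show dom: "sinv ?s * ?s = a" using ran_mult[OF 2] p_ids(2)[OF a] by simp
  show ran: "?s * sinv ?s = c" using ran_mult[OF 2] ran_mult[OF 1] p_ids(2)[OF c] by simp
  have "iso_part ?s = (sinv (p c) * p c) * g * (sinv (p a) * p a)"
    unfolding iso_part_def dom ran by (simp only: mult.assoc)
  then show "iso_part ?s = g" using p_ids a c G_unit[OF g] by simp
qed

text \<open>Left division by s moves row c to the row given by the domain of s and divides the group
  coordinate by \<open>iso_part s\<close>; this is the index shift in the matrix product
  \<open>entry_sconv\<close>.\<close>

lemma arrow_quotient:
  assumes c: "c \<in> ids" and g: "g \<in> G" and s: "s * sinv s = c"
  shows "sinv s * (p c * g * sinv (p a))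
    = p (sinv s * s) * (sinv (iso_part s) * g) * sinv (p a)"
proof -
  have sD: "s \<in> Dclass e" using ran_in_ids[of s] s c by simp
  let ?d = "p (sinv s * s)"
  have d: "?d * sinv ?d = sinv s * s" using p_ids(2) dom_in_ids sD by blast
  have "sinv s = (?d * sinv ?d) * sinv s" unfolding d by simp
  then have "sinv s * (p c * g * sinv (p a)) = ?d * (sinv ?d * sinv s * p c * g) * sinv (p a)"
    by (metis mult.assoc)
  then show ?thesis unfolding iso_part_def s by (simp add: mult.assoc)
qed

text \<open>The entry at position \<open>(c, a)\<close> of the matrix over the group algebra that the isomorphism
  of \<open>\<complex>D\<^sub>k\<close> with \<open>M\<^sub>r(\<complex>G)\<close> assigns to the D-class component of \<open>x\<close>.\<close>

definition entry :: "'a \<Rightarrow> 'a \<Rightarrow> ('a \<Rightarrow> complex) \<Rightarrow> 'a \<Rightarrow> complex" where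
  "entry a c x = (\<lambda>g. if g \<in> G then theta x (p c * g * sinv (p a)) else 0)"

definition col :: "'a \<Rightarrow> ('a \<Rightarrow> complex) set" where
  "col a = {x. \<forall>s. sinv s * s \<noteq> a \<longrightarrow> theta x s = 0}"

definition of_col :: "'a \<Rightarrow> ('a \<Rightarrow> 'a \<Rightarrow> complex) \<Rightarrow> 'a \<Rightarrow> complex" where
  "of_col a l = gsum (\<lambda>s. if sinv s * s = a then l (s * sinv s) (iso_part s) else 0)"

lemma entry_add: "entry a c (\<lambda>u. x u + y u) = (\<lambda>g. entry a c x g + entry a c y g)"
  and entry_scale: "entry a c (\<lambda>u. z * x u) = (\<lambda>g. z * entry a c x g)"
  by (auto simp: entry_def theta_add theta_scale fun_eq_iff)

lemma entry_zero: "entry a c (\<lambda>u. 0) = (\<lambda>g. 0)" by (simp add: entry_def fun_eq_iff)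

lemma clinear_entry: "clinear_on L (entry a c)"
  by (simp add: clinear_on_def entry_add entry_scale)

lemma entry_in_galg: "entry a c x \<in> galg G"
  by (simp add: entry_def galg_def)

lemma csubspace_col: "csubspace (col a)"
  by (auto simp: csubspace_def col_def theta_add theta_scale)

lemma of_col_in_col: "of_col a l \<in> col a"
  by (simp add: of_col_def col_def)

lemma entry_of_col:
  assumes "a \<in> ids" "c \<in> ids" "l c \<in> galg G"
  shows "entry a c (of_col a l) = l c"
  using assms arrow_dom[of c a] arrow_ran[of c a] iso_part_arrow[of c a]
  by (auto simp: entry_def of_col_def galg_def fun_eq_iff simp del: sinv_mult)

lemma theta_entry:
  assumes "a \<in> ids" "sinv s * s = a"
  shows "theta x s = entry a (s * sinv s) x (iso_part s)"
proof -
  have "s \<in> Dclass e" using assms dom_in_ids by blast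
  then have "iso_part s \<in> G" "p (s * sinv s) * iso_part s * sinv (p a) = s"
    using iso_part_in_G arrow_iso_part[of s] assms(2) by simp_all
  then show ?thesis by (simp only: entry_def if_True)
qed

lemma col_eqI:
  assumes a: "a \<in> ids" and x: "x \<in> col a" and y: "y \<in> col a"
    and eq: "\<And>c. c \<in> ids \<Longrightarrow> entry a c x = entry a c y"
  shows "x = y"
proof -
  have "theta x s = theta y s" for s
  proof (cases "sinv s * s = a")
    case True
    then have "s * sinv s \<in> ids" using a dom_in_ids ran_in_ids by blast
    then show ?thesis using theta_entry[OF a True] eq by simp
  qed (use x y in \<open>auto simp: col_def\<close>)
  then show ?thesis using theta_inject by blast
qed

text \<open>Column a of a matrix product: row c of y consists of the s with range c, and each of
  them multiplies the entry of x in the row given by its domain.\<close>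

lemma entry_sconv:
  assumes a: "a \<in> ids" and c: "c \<in> ids"
  shows "entry a c (sconv y x)
    = (\<lambda>g. \<Sum>s\<in>{s. s * sinv s = c}. theta y s * sconv (sdelta (iso_part s)) (entry a (sinv s * s) x) g)"
proof
  fix g
  have sD: "s \<in> Dclass e" if "s * sinv s = c" for s using ran_in_ids that c by blast
  show "entry a c (sconv y x) g
    = (\<Sum>s\<in>{s. s * sinv s = c}. theta y s * sconv (sdelta (iso_part s)) (entry a (sinv s * s) x) g)"
  proof (cases "g \<in> G")
    case True
    have "entry a c (sconv y x) g = gconv (theta y) (theta x) (p c * g * sinv (p a))"
      using True by (simp add: entry_def theta_sconv)
    also have "\<dots> = (\<Sum>s\<in>{s. s * sinv s = c}. theta y s * theta x (sinv s * (p c * g * sinv (p a))))"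
      unfolding gconv_def arrow_ran[OF c a True] by (rule refl)
    also have "\<dots> = (\<Sum>s\<in>{s. s * sinv s = c}. theta y s * sconv (sdelta (iso_part s)) (entry a (sinv s * s) x) g)"
    proof (intro sum.cong refl)
      fix s assume "s \<in> {s. s * sinv s = c}"
      then have s: "s * sinv s = c" by simp
      have k: "iso_part s \<in> G" using iso_part_in_G sD[OF s] by blast
      have "sconv (sdelta (iso_part s)) (entry a (sinv s * s) x) g = entry a (sinv s * s) x (sinv (iso_part s) * g)"
        using sconv_sdelta_galg[OF k entry_in_galg] True by simp
      also have "\<dots> = theta x (sinv s * (p c * g * sinv (p a)))"
        unfolding arrow_quotient[OF c True s] entry_def using G_mult[OF G_sinv[OF k] True] by simp
      finally show "theta y s * theta x (sinv s * (p c * g * sinv (p a)))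
        = theta y s * sconv (sdelta (iso_part s)) (entry a (sinv s * s) x) g" by simp
    qed
    finally show ?thesis .
  next
    case False
    have "sconv (sdelta (iso_part s)) (entry a (sinv s * s) x) g = 0" if "s * sinv s = c" for s
      using sconv_sdelta_galg[OF iso_part_in_G[OF sD[OF that]] entry_in_galg] False by simp
    then show ?thesis using False by (simp add: entry_def)
  qed
qed

lemma col_sconv:
  assumes "x \<in> col a"
  shows "sconv y x \<in> col a"
proof -
  have "gconv (theta y) (theta x) u = 0" if u: "sinv u * u \<noteq> a" for u
    unfolding gconv_def
  proof (rule sum.neutral, rule ballI)
    fix s assume "s \<in> {s. s * sinv s = u * sinv u}"
    then have "sinv (sinv s * u) * (sinv s * u) \<noteq> a" using dom_quotient(1)[of s u] u by simp
    then have "theta x (sinv s * u) = 0" using assms unfolding col_def by blast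
    then show "theta y s * theta x (sinv s * u) = 0" by simp
  qed
  then show ?thesis by (simp add: col_def theta_sconv)
qed

lemma entry_gfloor:
  assumes "a \<in> ids" "c \<in> ids"
  shows "entry a c (sconv (gfloor s) x)
    = (if s * sinv s = c then sconv (sdelta (iso_part s)) (entry a (sinv s * s) x) else (\<lambda>g. 0))"
  unfolding entry_sconv[OF assms]
  by (auto simp: sdelta_def fun_eq_iff if_distrib[of "\<lambda>z. z * _"] cong: if_cong)

lemma iso_part_G: "g \<in> G \<Longrightarrow> iso_part g = g"
  using G_unit by (simp add: iso_part_def G_iff p_e e_e)

text \<open>\<open>gsum y\<close> is the matrix with y at position (e, e) and zeros elsewhere; p e =
  e ensures that the group coordinate of g in G is g itself.\<close>

lemma entry_e_gsum:
  assumes a: "a \<in> ids" and y: "y \<in> galg G"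
  shows "entry a e (sconv (gsum y) x) = sconv y (entry a e x)"
proof
  fix g
  have "(\<Sum>s\<in>{s. s * sinv s = e}. y s * sconv (sdelta (iso_part s)) (entry a (sinv s * s) x) g)
    = (\<Sum>s\<in>G. y s * sconv (sdelta s) (entry a e x) g)"
  proof (rule sum.mono_neutral_cong_right)
    show "y s * sconv (sdelta (iso_part s)) (entry a (sinv s * s) x) g = y s * sconv (sdelta s) (entry a e x) g"
      if "s \<in> G" for s using that iso_part_G[OF that] by (simp add: G_iff)
  qed (use y in \<open>auto simp: galg_def maxsub_def\<close>)
  then show "entry a e (sconv (gsum y) x) g = sconv y (entry a e x) g"
    using entry_sconv[OF a e_in_ids, of "gsum y" x] sconv_galg_left[OF y, of "entry a e x"] by simp
qed

text \<open>\<open>gfloor (p c)\<close> is the matrix unit at (c, e), since its group coordinate is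
  e. It moves row e to row c.\<close>

lemma entry_p:
  assumes a: "a \<in> ids" and c: "c \<in> ids" "c' \<in> ids"
  shows "entry a c' (sconv (gfloor (p c)) x) = (if c' = c then entry a e x else (\<lambda>g. 0))"
proof -
  have "iso_part (p c) = e" unfolding iso_part_def p_ids[OF c(1)] p_e e_e(1) ..
  then show ?thesis
    using entry_gfloor[OF a c(2), of "p c" x] p_ids[OF c(1)] sconv_e_galg[OF entry_in_galg] by auto
qed

text \<open>The matrix unit at (e, c), which moves row c to row e.\<close>

lemma entry_e_p_sinv:
  assumes a: "a \<in> ids" and c: "c \<in> ids"
  shows "entry a e (sconv (gfloor (sinv (p c))) x) = entry a c x"
proof -
  have "iso_part (sinv (p c)) = e"
    unfolding iso_part_def using p_ids[OF c] by (simp add: p_e e_e mult.assoc)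
  then show ?thesis
    using entry_gfloor[OF a e_in_ids, of "sinv (p c)" x] p_ids[OF c] sconv_e_galg[OF entry_in_galg] by simp
qed

text \<open>The matrices over \<open>\<complex>G\<close> that vanish outside column \<open>a\<close> and have all entries in \<open>L\<close>.\<close>

definition induced :: "'a \<Rightarrow> ('a \<Rightarrow> complex) set \<Rightarrow> ('a \<Rightarrow> complex) set" where
  "induced a L = {x \<in> col a. \<forall>c\<in>ids. entry a c x \<in> L}"

lemma left_ideal_induced:
  assumes a: "a \<in> ids" and L: "left_ideal (galg G) L"
  shows "left_ideal UNIV (induced a L)"
  unfolding left_ideal_iff
proof (intro conjI ballI)
  have sub: "csubspace L" using L by (simp add: left_ideal_iff)
  show "csubspace (induced a L)"
    using csubspace_col[of a] sub unfolding csubspace_def induced_def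
    by (simp add: entry_add entry_scale entry_zero)
  fix y x assume x: "x \<in> induced a L"
  have "entry a c (sconv y x) \<in> L" if c: "c \<in> ids" for c
    unfolding entry_sconv[OF a c]
  proof (rule csubspace_sum[OF sub], rule csubspace_scale[OF sub])
    fix s assume "s \<in> {s. s * sinv s = c}"
    then have s: "s \<in> Dclass e" using ran_in_ids c by blast
    then have "entry a (sinv s * s) x \<in> L" using x dom_in_ids by (simp add: induced_def)
    then show "sconv (sdelta (iso_part s)) (entry a (sinv s * s) x) \<in> L"
      using L sdelta_in_galg[OF iso_part_in_G[OF s]] by (simp add: left_ideal_def)
  qed
  then show "sconv y x \<in> induced a L" using x col_sconv by (simp add: induced_def)
qed simp

text \<open>Matrix units bring any nonzero entry of a left ideal N inside \<open>induced a L\<close>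
  into row e. So the row-e entries of N form a nonzero left ideal of CG inside L, which must be L;
  matrix units then spread row e over all rows and produce every element of
  \<open>induced a L\<close>.\<close>

lemma simple_induced:
  assumes a: "a \<in> ids" and L: "simple_left_ideal (galg G) L"
  shows "simple_left_ideal UNIV (induced a L)"
proof -
  have li: "left_ideal (galg G) L" and sub: "csubspace L" "L \<subseteq> galg G"
    using L by (auto simp: simple_left_ideal_def left_ideal_iff)
  have "induced a L \<noteq> {\<lambda>u. 0}"
  proof
    assume i: "induced a L = {\<lambda>u. 0}"
    have "l = (\<lambda>u. 0)" if l: "l \<in> L" for l
    proof -
      have en: "entry a c (of_col a (\<lambda>_. l)) = l" if "c \<in> ids" for c
        using entry_of_col[OF a that] l sub(2) by auto
      then have "of_col a (\<lambda>_. l) \<in> induced a L" using l of_col_in_col by (simp add: induced_def)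
      then have "of_col a (\<lambda>_. l) = (\<lambda>u. 0)" using i by blast
      then show ?thesis using en[OF e_in_ids] by (simp add: entry_zero)
    qed
    then have "L = {\<lambda>u. 0}" using csubspace_zero[OF sub(1)] by blast
    then show False using L by (simp add: simple_left_ideal_def)
  qed
  moreover have "N = {\<lambda>u. 0} \<or> N = induced a L" if N: "left_ideal UNIV N" "N \<subseteq> induced a L" for N
  proof (cases "N = {\<lambda>u. 0}")
    case False
    have subN: "csubspace N" and actN: "\<And>y x. x \<in> N \<Longrightarrow> sconv y x \<in> N"
      using N(1) by (auto simp: left_ideal_iff)
    have colN: "N \<subseteq> col a" using N(2) by (auto simp: induced_def)
    obtain x where x: "x \<in> N" "x \<noteq> (\<lambda>u. 0)" using False csubspace_zero[OF subN] by blast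
    have "\<exists>c\<in>ids. entry a c x \<noteq> (\<lambda>u. 0)"
    proof (rule ccontr)
      assume "\<not> ?thesis"
      then have "entry a c x = entry a c (\<lambda>u. 0)" if "c \<in> ids" for c
        using that by (simp add: entry_zero)
      from col_eqI[OF a subsetD[OF colN x(1)] csubspace_zero[OF csubspace_col] this]
      have "x = (\<lambda>u. 0)" .
      then show False using x by blast
    qed
    then obtain c where c: "c \<in> ids" "entry a c x \<noteq> (\<lambda>u. 0)" by blast
    have "left_ideal (galg G) (entry a e ` N)"
      unfolding left_ideal_iff
    proof (intro conjI ballI)
      show "entry a e ` N \<subseteq> galg G" using entry_in_galg by blast
      show "csubspace (entry a e ` N)" by (rule clinear_on_image[OF clinear_entry subN])
      fix y z assume y: "y \<in> galg G" and "z \<in> entry a e ` N"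
      then obtain n where "n \<in> N" "z = entry a e n" by blast
      then show "sconv y z \<in> entry a e ` N"
        using entry_e_gsum[OF a y, of n] actN[of n "gsum y"] by (metis imageI)
    qed
    moreover have "entry a e ` N \<subseteq> L" using N(2) e_in_ids by (auto simp: induced_def)
    moreover have "entry a c x \<in> entry a e ` N"
      using entry_e_p_sinv[OF a c(1), of x] actN[OF x(1)] by (metis imageI)
    ultimately have eN: "entry a e ` N = L" using L c(2) unfolding simple_left_ideal_def by blast
    have "z \<in> N" if z: "z \<in> induced a L" for z
    proof -
      have "\<exists>n\<in>N. entry a e n = entry a c z" if "c \<in> ids" for c
      proof -
        have "entry a c z \<in> entry a e ` N" using z eN that by (simp add: induced_def)
        then show ?thesis by (metis imageE)
      qed
      then obtain n where n: "\<And>c. c \<in> ids \<Longrightarrow> n c \<in> N \<and> entry a e (n c) = entry a c z" by metis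
      \<comment> \<open>The element n c of N has in row e the entry wanted in row c; the matrix unit
        at (c, e) moves it there and leaves the other rows zero.\<close>
      let ?z = "\<lambda>u. \<Sum>c\<in>ids. sconv (gfloor (p c)) (n c) u"
      have zN: "?z \<in> N" by (rule csubspace_sum[OF subN]) (use n actN in blast)
      have "z = ?z"
      proof (rule col_eqI[OF a])
        show "z \<in> col a" "?z \<in> col a" using z zN colN by (auto simp: induced_def)
        fix c' assume c': "c' \<in> ids"
        have "entry a c' ?z = (\<lambda>g. \<Sum>c\<in>ids. entry a c' (sconv (gfloor (p c)) (n c)) g)"
          by (rule clinear_on_sum[OF clinear_entry[of UNIV]]) (auto simp: csubspace_def)
        also have "\<dots> = (\<lambda>g. \<Sum>c\<in>ids. if c = c' then entry a c z g else 0)"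
        proof (intro ext sum.cong refl)
          fix g c assume c: "c \<in> ids"
          show "entry a c' (sconv (gfloor (p c)) (n c)) g = (if c = c' then entry a c z g else 0)"
            unfolding entry_p[OF a c c'] using n[OF c] by auto
        qed
        also have "\<dots> = entry a c' z" using c' by simp
        finally show "entry a c' z = entry a c' ?z" by simp
      qed
      with zN show ?thesis by simp
    qed
    then show ?thesis using N(2) by blast
  qed simp
  ultimately show ?thesis using left_ideal_induced[OF a li] unfolding simple_left_ideal_def by blast
qed

text \<open>The isomorphism \<phi> is applied to each entry of the column. Both actions are the same
  matrix product, once with group elements and once with their matrices under \<rho> as
  coefficients.\<close>

lemma mod_iso_induced:
  assumes a: "a \<in> ids" and li: "left_ideal (galg G) L"
    and iso: "mod_iso (galg G) L (cvec d) (gact G \<rho> d)"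
  shows "mod_iso UNIV (induced a L) (rhobar_space (Dclass e) d) (rhobar (Dclass e) p \<rho> d)"
proof -
  obtain \<phi> where \<phi>: "bij_betw \<phi> L (cvec d)" "module_map (galg G) L (gact G \<rho> d) \<phi>"
    using iso unfolding mod_iso_iff by blast
  have sub: "csubspace L" "L \<subseteq> galg G" using li by (auto simp: left_ideal_iff)
  have lin: "clinear_on L \<phi>" by (rule module_map_clinear[OF \<phi>(2)])
  have z: "\<phi> (\<lambda>u. 0) = (\<lambda>i. 0)" using clinear_on_zero[OF lin sub(1)] .
  define \<Phi> where "\<Phi> x = (\<lambda>(c, i). if c \<in> ids then \<phi> (entry a c x) i else 0)" for x
  have iL: "entry a c x \<in> L" if "x \<in> induced a L" "c \<in> ids" for x c using that by (simp add: induced_def)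
  have subI: "csubspace (induced a L)" using left_ideal_induced[OF a li] by (simp add: left_ideal_iff)
  have \<phi>v: "\<phi> l i = 0" if "l \<in> L" "\<not> i < d" for l i
  proof -
    have "\<phi> l \<in> cvec d" using that(1) \<phi>(1) by (auto simp: bij_betw_def)
    then show ?thesis using that(2) by (simp add: cvec_def)
  qed
  have linI: "clinear_on (induced a L) \<Phi>"
    unfolding clinear_on_def \<Phi>_def
    using clinear_onD[OF lin] iL by (auto simp: entry_add entry_scale fun_eq_iff)
  have "module_map UNIV (induced a L) (rhobar (Dclass e) p \<rho> d) \<Phi>"
    unfolding module_map_def
  proof (intro conjI linI ballI ext)
    fix y x and ci :: "'a \<times> nat" assume x: "x \<in> induced a L"
    obtain c i where ci: "ci = (c, i)" by (cases ci)
    have rb: "rhobar (Dclass e) p \<rho> d y (\<Phi> x) (c, i)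
      = (\<Sum>s\<in>UNIV. theta y s * (if s \<in> Dclass e \<and> c = s * sinv s \<and> i < d
          then \<Sum>j<d. \<rho> (iso_part s) i j * \<Phi> x (sinv s * s, j) else 0))"
      unfolding rhobar_eq rhobar_basis_def iso_part_def by simp
    show "\<Phi> (sconv y x) ci = rhobar (Dclass e) p \<rho> d y (\<Phi> x) ci"
    proof (cases "c \<in> ids")
      case True
      let ?S = "{s. s * sinv s = c}"
      have sD: "s \<in> Dclass e" if "s \<in> ?S" for s using that ran_in_ids True by blast
      have eL: "entry a (sinv s * s) x \<in> L" if "s \<in> ?S" for s using iL[OF x] dom_in_ids sD[OF that] by blast
      have aL: "sconv (sdelta (iso_part s)) (entry a (sinv s * s) x) \<in> L" if "s \<in> ?S" for s
        using li eL[OF that] sdelta_in_galg[OF iso_part_in_G[OF sD[OF that]]] by (simp add: left_ideal_def)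
      have "\<Phi> (sconv y x) ci = \<phi> (\<lambda>g. \<Sum>s\<in>?S. theta y s * sconv (sdelta (iso_part s)) (entry a (sinv s * s) x) g) i"
        using True by (simp add: \<Phi>_def ci entry_sconv[OF a True, of y x])
      also have "\<dots> = (\<Sum>s\<in>?S. \<phi> (\<lambda>g. theta y s * sconv (sdelta (iso_part s)) (entry a (sinv s * s) x) g) i)"
        using clinear_on_sum[OF lin sub(1), of ?S "\<lambda>s g. theta y s * sconv (sdelta (iso_part s)) (entry a (sinv s * s) x) g"]
          csubspace_scale[OF sub(1) aL] by simp
      also have "\<dots> = (\<Sum>s\<in>?S. theta y s * matvec d (\<rho> (iso_part s)) (\<phi> (entry a (sinv s * s) x)) i)"
      proof (intro sum.cong refl)
        fix s assume s: "s \<in> ?S"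
        have "\<phi> (sconv (sdelta (iso_part s)) (entry a (sinv s * s) x)) = matvec d (\<rho> (iso_part s)) (\<phi> (entry a (sinv s * s) x))"
          using module_map_act[OF \<phi>(2) sdelta_in_galg[OF iso_part_in_G[OF sD[OF s]]] eL[OF s]]
            gact_sdelta[OF iso_part_in_G[OF sD[OF s]]] by metis
        then show "\<phi> (\<lambda>g. theta y s * sconv (sdelta (iso_part s)) (entry a (sinv s * s) x) g) i
          = theta y s * matvec d (\<rho> (iso_part s)) (\<phi> (entry a (sinv s * s) x)) i"
          using clinear_onD(2)[OF lin aL[OF s]] by simp
      qed
      also have "\<dots> = rhobar (Dclass e) p \<rho> d y (\<Phi> x) (c, i)"
        unfolding rb
      proof (rule sum.mono_neutral_cong_left)
        fix s assume s: "s \<in> ?S"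
        have "\<Phi> x (sinv s * s, j) = \<phi> (entry a (sinv s * s) x) j" for j
          using dom_in_ids sD[OF s] by (simp add: \<Phi>_def)
        then show "theta y s * matvec d (\<rho> (iso_part s)) (\<phi> (entry a (sinv s * s) x)) i
          = theta y s * (if s \<in> Dclass e \<and> c = s * sinv s \<and> i < d
            then \<Sum>j<d. \<rho> (iso_part s) i j * \<Phi> x (sinv s * s, j) else 0)"
          using s sD[OF s] by (simp add: matvec_def)
      qed auto
      finally show ?thesis by (simp add: ci)
    next
      case False
      then have "\<not> (s \<in> Dclass e \<and> c = s * sinv s \<and> i < d)" for s using ran_in_ids by blast
      then have "rhobar (Dclass e) p \<rho> d y (\<Phi> x) (c, i) = 0" unfolding rb by (simp only: if_False mult_zero_right sum.neutral_const)
      then show ?thesis using False by (simp add: ci \<Phi>_def)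
    qed
  qed
  moreover have "inj_on \<Phi> (induced a L)"
  proof (rule clinear_on_inj[OF linI subI])
    fix x assume x: "x \<in> induced a L" "\<Phi> x = (\<lambda>i. 0)"
    show "x = (\<lambda>u. 0)"
    proof (rule col_eqI[OF a])
      fix c assume c: "c \<in> ids"
      have "\<phi> (entry a c x) = (\<lambda>i. 0)"
      proof
        fix i show "\<phi> (entry a c x) i = 0" using fun_cong[OF x(2), of "(c, i)"] c by (simp add: \<Phi>_def)
      qed
      then show "entry a c x = entry a c (\<lambda>u. 0)"
        using \<phi>(1) iL[OF x(1) c] z csubspace_zero[OF sub(1)] unfolding bij_betw_def entry_zero
        by (metis inj_onD)
    qed (use x csubspace_zero[OF csubspace_col] in \<open>auto simp: induced_def\<close>)
  qed
  moreover have "\<Phi> ` induced a L = rhobar_space (Dclass e) d"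
  proof
    show "\<Phi> ` induced a L \<subseteq> rhobar_space (Dclass e) d"
    proof (rule image_subsetI)
      fix x assume x: "x \<in> induced a L"
      then show "\<Phi> x \<in> rhobar_space (Dclass e) d"
        using \<phi>v[OF iL[OF x]] by (auto simp: rhobar_space_def \<Phi>_def ids_def)
    qed
    show "rhobar_space (Dclass e) d \<subseteq> \<Phi> ` induced a L"
    proof
      fix v assume v: "v \<in> rhobar_space (Dclass e) d"
      define l where "l c = inv_into L \<phi> (\<lambda>i. v (c, i))" for c
      have vc: "(\<lambda>i. v (c, i)) \<in> cvec d" for c using v by (simp add: rhobar_space_def cvec_def)
      have l: "l c \<in> L" "\<phi> (l c) = (\<lambda>i. v (c, i))" for c
      proof -
        have "inv_into L \<phi> w \<in> L \<and> \<phi> (inv_into L \<phi> w) = w" if "w \<in> cvec d" for w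
          using that \<phi>(1) by (auto simp: bij_betw_def inv_into_into f_inv_into_f)
        from this[OF vc[of c]] show "l c \<in> L" "\<phi> (l c) = (\<lambda>i. v (c, i))" by (simp_all add: l_def)
      qed
      have en: "entry a c (of_col a l) = l c" if "c \<in> ids" for c
        using entry_of_col[where l = l, OF a that] l(1) sub(2) by blast
      then have "of_col a l \<in> induced a L" using l of_col_in_col by (simp add: induced_def)
      moreover have "\<Phi> (of_col a l) = v"
      proof
        fix ci :: "'a \<times> nat"
        obtain c i where ci: "ci = (c, i)" by (cases ci)
        have "v (c, i) = 0" if "c \<notin> ids" using v that unfolding rhobar_space_def ids_def by blast
        then show "\<Phi> (of_col a l) ci = v ci"
          using en[of c] l(2)[of c] by (simp add: \<Phi>_def ci)
      qed
      ultimately show "v \<in> \<Phi> ` induced a L" by blast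
    qed
  qed
  ultimately show ?thesis unfolding mod_iso_iff bij_betw_def by blast
qed

text \<open>L is recovered from \<open>induced a L\<close> as row e, the part fixed by left
  multiplication with \<open>gfloor e\<close>. A module isomorphism preserves this part, so it
  restricts to an injective map from L to L', which is onto by simplicity of L'.\<close>

lemma mod_iso_induced_imp:
  assumes a: "a \<in> ids" and L: "simple_left_ideal (galg G) L" and L': "simple_left_ideal (galg G) L'"
    and iso: "mod_iso UNIV (induced a L) (induced a L') sconv"
  shows "mod_iso (galg G) L L' sconv"
proof -
  have li: "left_ideal (galg G) L" "left_ideal (galg G) L'" and sub: "csubspace L" "L \<subseteq> galg G"
    using L L' by (auto simp: simple_left_ideal_def left_ideal_iff)
  obtain \<Psi> where \<Psi>: "bij_betw \<Psi> (induced a L) (induced a L')" "module_map UNIV (induced a L) sconv \<Psi>"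
    using iso unfolding mod_iso_iff by blast
  have subI: "csubspace (induced a L)" using left_ideal_induced[OF a li(1)] by (simp add: left_ideal_iff)
  have zI: "(\<lambda>u. 0) \<in> induced a L" using csubspace_zero[OF subI] .
  have z\<Psi>: "\<Psi> (\<lambda>u. 0) = (\<lambda>u. 0)"
    using clinear_on_zero[OF module_map_clinear[OF \<Psi>(2)] subI] .
  define \<epsilon> where "\<epsilon> l = of_col a (\<lambda>c. if c = e then l else (\<lambda>u. 0))" for l
  have en: "entry a c (\<epsilon> l) = (if c = e then l else (\<lambda>u. 0))" if "l \<in> galg G" "c \<in> ids" for l c
    unfolding \<epsilon>_def
    by (rule entry_of_col[OF a that(2)]) (simp add: that(1) csubspace_zero[OF csubspace_galg])
  have \<epsilon>col: "\<epsilon> l \<in> col a" for l by (simp add: \<epsilon>_def of_col_in_col)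
  have \<epsilon>I: "\<epsilon> l \<in> induced a L" if "l \<in> L" for l
    using that en[of l] sub csubspace_zero[OF sub(1)] \<epsilon>col by (auto simp: induced_def)
  have \<epsilon>_eqI: "\<epsilon> l = x" if "l \<in> galg G" "x \<in> col a"
    "\<And>c. c \<in> ids \<Longrightarrow> entry a c x = (if c = e then l else (\<lambda>u. 0))" for l x
    by (rule col_eqI[OF a \<epsilon>col that(2)]) (simp add: en that)
  have \<epsilon>_add: "\<epsilon> (\<lambda>u. l u + l' u) = (\<lambda>u. \<epsilon> l u + \<epsilon> l' u)" if "l \<in> L" "l' \<in> L" for l l'
  proof (rule \<epsilon>_eqI)
    have lG: "l \<in> galg G" "l' \<in> galg G" using that sub by auto
    then show "(\<lambda>u. l u + l' u) \<in> galg G" by (rule csubspace_add[OF csubspace_galg])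
    show "(\<lambda>u. \<epsilon> l u + \<epsilon> l' u) \<in> col a" by (rule csubspace_add[OF csubspace_col \<epsilon>col \<epsilon>col])
    show "entry a c (\<lambda>u. \<epsilon> l u + \<epsilon> l' u) = (if c = e then \<lambda>u. l u + l' u else (\<lambda>u. 0))"
      if "c \<in> ids" for c
      unfolding entry_add en[OF lG(1) that] en[OF lG(2) that] by simp
  qed
  have \<epsilon>_scale: "\<epsilon> (\<lambda>u. z * l u) = (\<lambda>u. z * \<epsilon> l u)" if "l \<in> L" for l z
  proof (rule \<epsilon>_eqI)
    have lG: "l \<in> galg G" using that sub by auto
    then show "(\<lambda>u. z * l u) \<in> galg G" by (rule csubspace_scale[OF csubspace_galg])
    show "(\<lambda>u. z * \<epsilon> l u) \<in> col a" by (rule csubspace_scale[OF csubspace_col \<epsilon>col])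
    show "entry a c (\<lambda>u. z * \<epsilon> l u) = (if c = e then \<lambda>u. z * l u else (\<lambda>u. 0))"
      if "c \<in> ids" for c
      unfolding entry_scale en[OF lG that] by simp
  qed
  have entry_gsum: "entry a c (sconv (gsum y) x) = (\<lambda>u. 0)" if "y \<in> galg G" "c \<in> ids" "c \<noteq> e" for y c x
    unfolding entry_sconv[OF a that(2)]
    using that by (auto simp: fun_eq_iff galg_def G_iff intro!: sum.neutral)
  have \<epsilon>_act: "\<epsilon> (sconv y l) = sconv (gsum y) (\<epsilon> l)" if "y \<in> galg G" "l \<in> L" for y l
  proof (rule \<epsilon>_eqI)
    show "sconv y l \<in> galg G" using galg_sconv(2) that sub by blast
    show "sconv (gsum y) (\<epsilon> l) \<in> col a" by (rule col_sconv[OF \<epsilon>col])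
    fix c assume c: "c \<in> ids"
    show "entry a c (sconv (gsum y) (\<epsilon> l)) = (if c = e then sconv y l else (\<lambda>u. 0))"
      using entry_gsum[OF that(1) c] entry_e_gsum[OF a that(1), of "\<epsilon> l"] en[OF subsetD[OF sub(2) that(2)] e_in_ids]
      by simp
  qed
  define \<eta> where "\<eta> l = entry a e (\<Psi> (\<epsilon> l))" for l
  have \<Psi>I: "\<Psi> x \<in> induced a L'" if "x \<in> induced a L" for x using that \<Psi>(1) by (auto simp: bij_betw_def)
  have mm: "module_map (galg G) L sconv \<eta>"
    unfolding module_map_def clinear_on_def
  proof (intro conjI ballI allI)
    fix x y assume "x \<in> L" "y \<in> L"
    then show "\<eta> (\<lambda>u. x u + y u) = (\<lambda>i. \<eta> x i + \<eta> y i)"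
      using module_mapD(1)[OF \<Psi>(2) \<epsilon>I \<epsilon>I] by (simp add: \<eta>_def \<epsilon>_add entry_add)
  next
    fix z x assume "x \<in> L"
    then show "\<eta> (\<lambda>u. z * x u) = (\<lambda>i. z * \<eta> x i)"
      using module_mapD(2)[OF \<Psi>(2) \<epsilon>I] by (simp add: \<eta>_def \<epsilon>_scale entry_scale)
  next
    fix y x assume "y \<in> galg G" "x \<in> L"
    then show "\<eta> (sconv y x) = sconv y (\<eta> x)"
      using module_mapD(3)[OF \<Psi>(2) _ \<epsilon>I] entry_e_gsum[OF a] by (simp add: \<eta>_def \<epsilon>_act)
  qed
  have inj: "inj_on \<eta> L"
  proof (rule clinear_on_inj[OF module_map_clinear[OF mm] sub(1)])
    fix l assume l: "l \<in> L" "\<eta> l = (\<lambda>u. 0)"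
    have lG: "l \<in> galg G" using l sub by blast
    \<comment> \<open>\<open>gsum (sdelta e)\<close> is \<open>gfloor e\<close>, the idempotent that
      cuts out row e. Since \<Psi> commutes with its action, the image of
      \<open>\<epsilon> l\<close> has no entries outside row e, and its vanishing can be tested in
      row e.\<close>
    have "\<epsilon> l = sconv (gsum (sdelta e)) (\<epsilon> l)"
      using \<epsilon>_act[OF sdelta_in_galg[OF e_in_G] l(1)] sconv_e_galg[OF lG] by simp
    then have "\<Psi> (\<epsilon> l) = sconv (gsum (sdelta e)) (\<Psi> (\<epsilon> l))"
      using module_mapD(3)[OF \<Psi>(2) UNIV_I \<epsilon>I[OF l(1)]] by metis
    then have "entry a c (\<Psi> (\<epsilon> l)) = (\<lambda>u. 0)" if "c \<in> ids" for c
      using entry_gsum[OF sdelta_in_galg[OF e_in_G] that] l(2) unfolding \<eta>_def by metis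
    then have "entry a c (\<Psi> (\<epsilon> l)) = entry a c (\<lambda>u. 0)" if "c \<in> ids" for c
      using that by (simp add: entry_zero)
    moreover have "\<Psi> (\<epsilon> l) \<in> col a" using \<Psi>I[OF \<epsilon>I[OF l(1)]] by (simp add: induced_def)
    ultimately have "\<Psi> (\<epsilon> l) = (\<lambda>u. 0)"
      using col_eqI[OF a _ csubspace_zero[OF csubspace_col]] by blast
    then have "\<epsilon> l = (\<lambda>u. 0)"
      using \<Psi>(1) \<epsilon>I[OF l(1)] zI z\<Psi> unfolding bij_betw_def by (metis inj_onD)
    then show "l = (\<lambda>u. 0)" using en[OF lG e_in_ids] by (simp add: entry_zero)
  qed
  have im: "\<eta> ` L \<subseteq> L'" using \<Psi>I \<epsilon>I e_in_ids by (auto simp: \<eta>_def induced_def)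
  have "left_ideal (galg G) (\<eta> ` L)"
    by (rule left_ideal_image[OF li(1) mm]) (use im li(2) in \<open>auto simp: left_ideal_def\<close>)
  moreover have "\<eta> ` L \<noteq> {\<lambda>u. 0}"
  proof
    assume "\<eta> ` L = {\<lambda>u. 0}"
    then have "\<eta> l = \<eta> (\<lambda>u. 0)" if "l \<in> L" for l
      using that csubspace_zero[OF sub(1)] by (metis imageI singletonD)
    then have "l = (\<lambda>u. 0)" if "l \<in> L" for l
      using that inj_onD[OF inj _ that csubspace_zero[OF sub(1)]] by simp
    then have "L = {\<lambda>u. 0}" using csubspace_zero[OF sub(1)] by blast
    then show False using L by (simp add: simple_left_ideal_def)
  qed
  ultimately have "\<eta> ` L = L'" using L' im unfolding simple_left_ideal_def by blast
  then show ?thesis using inj mm unfolding mod_iso_iff bij_betw_def by blast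
qed

text \<open>The matrix with \<open>l\<close> at position \<open>(b, a)\<close> and zeros elsewhere.\<close>

definition place :: "'a \<Rightarrow> 'a \<Rightarrow> ('a \<Rightarrow> complex) \<Rightarrow> 'a \<Rightarrow> complex" where
  "place b a l = (\<lambda>u. \<Sum>g\<in>G. l g * gfloor (p b * g * sinv (p a)) u)"

text \<open>The domain of each factor is the range of the next, so products of floors collapse to
  floors of products. Replacing \<open>gfloor g\<close> by g in the middle changes nothing, by
  \<open>sconv_sdelta_gfloor\<close>.\<close>

lemma sconv_place:
  assumes a: "a \<in> ids" and b: "b \<in> ids"
  shows "sconv (gfloor (p b)) (sconv (\<lambda>u. \<Sum>g\<in>G. l g * gfloor g u) (gfloor (sinv (p a)))) = place b a l"
    and "l \<in> galg G \<Longrightarrow> sconv (gfloor (p b)) (sconv l (gfloor (sinv (p a)))) = place b a l"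
proof -
  have 1: "sinv g * g = sinv (p a) * sinv (sinv (p a))" if "g \<in> G" for g
    using that p_ids(1)[OF a] by (simp add: G_iff)
  have 2: "sinv (p b) * p b = (g * sinv (p a)) * sinv (g * sinv (p a))" if "g \<in> G" for g
    using ran_mult(1)[OF 1[OF that]] that p_ids(1)[OF b] by (simp add: G_iff)
  have *: "sconv (gfloor (p b)) (\<lambda>u. \<Sum>g\<in>G. l g * gfloor (g * sinv (p a)) u) = place b a l"
    unfolding sconv_sum_right sconv_scale_right place_def
    by (intro ext sum.cong refl) (simp add: sconv_gfloor_gfloor[OF 2] mult.assoc del: sinv_mult)
  have "sconv (\<lambda>u. \<Sum>g\<in>G. l g * gfloor g u) (gfloor (sinv (p a))) = (\<lambda>u. \<Sum>g\<in>G. l g * gfloor (g * sinv (p a)) u)"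
    unfolding sconv_sum_left sconv_scale_left
    by (intro ext sum.cong refl) (simp add: sconv_gfloor_gfloor[OF 1])
  then show "sconv (gfloor (p b)) (sconv (\<lambda>u. \<Sum>g\<in>G. l g * gfloor g u) (gfloor (sinv (p a)))) = place b a l"
    using * by simp
  assume l: "l \<in> galg G"
  have "sconv l (gfloor (sinv (p a))) = (\<lambda>u. \<Sum>g\<in>G. l g * gfloor (g * sinv (p a)) u)"
    unfolding sconv_galg_left[OF l]
    by (intro ext sum.cong refl) (simp add: sconv_sdelta_gfloor[OF 1])
  then show "sconv (gfloor (p b)) (sconv l (gfloor (sinv (p a)))) = place b a l"
    using * by simp
qed

text \<open>An arrow s from a to b determines its group coordinate, so only the summand with g =
  \<open>iso_part s\<close> can contribute.\<close>

lemma theta_place: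
  assumes a: "a \<in> ids" and b: "b \<in> ids"
  shows "theta (place b a l) s = (if sinv s * s = a \<and> s * sinv s = b then l (iso_part s) else 0)"
proof -
  have "theta (place b a l) s = (\<Sum>g\<in>G. l g * sdelta (p b * g * sinv (p a)) s)"
    unfolding place_def theta_sum theta_scale by simp
  also have "\<dots> = (\<Sum>g\<in>G. if g = iso_part s then if sinv s * s = a \<and> s * sinv s = b then l g else 0 else 0)"
  proof (intro sum.cong refl)
    fix g assume g: "g \<in> G"
    have "s = p b * g * sinv (p a) \<longleftrightarrow> g = iso_part s \<and> sinv s * s = a \<and> s * sinv s = b"
      using arrow_dom[OF b a g] arrow_ran[OF b a g] iso_part_arrow[OF b a g] arrow_iso_part[of s]
        dom_in_ids[of s] a by auto
    then show "l g * sdelta (p b * g * sinv (p a)) s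
        = (if g = iso_part s then if sinv s * s = a \<and> s * sinv s = b then l g else 0 else 0)"
      unfolding sdelta_def by auto
  qed
  also have "\<dots> = (if sinv s * s = a \<and> s * sinv s = b then l (iso_part s) else 0)"
    using iso_part_in_G[of s] dom_in_ids[of s] a by auto
  finally show ?thesis .
qed

lemma clinear_place: "clinear_on UNIV (place b a)"
  by (auto simp: clinear_on_def place_def fun_eq_iff algebra_simps sum.distrib sum_distrib_left)

lemma place_in_induced:
  assumes a: "a \<in> ids" and b: "b \<in> ids" and L: "csubspace L" "L \<subseteq> galg G" and l: "l \<in> L"
  shows "place b a l \<in> induced a L"
proof -
  have "entry a c (place b a l) = (if c = b then l else (\<lambda>u. 0))" if c: "c \<in> ids" for c
  proof
    fix g
    have "l g = 0" if "g \<notin> G" using that l L(2) by (auto simp: galg_def)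
    then show "entry a c (place b a l) g = (if c = b then l else (\<lambda>u. 0)) g"
      using arrow_dom[OF c a, of g] arrow_ran[OF c a, of g] iso_part_arrow[OF c a, of g]
      by (auto simp: entry_def theta_place[OF a b] simp del: sinv_mult)
  qed
  then show ?thesis
    using l csubspace_zero[OF L(1)] by (auto simp: induced_def col_def theta_place[OF a b])
qed

lemma fG_of_in_galg:
  assumes a: "a \<in> ids" and b: "b \<in> ids"
  shows "fG_of e p a b f \<in> galg G"
proof -
  have "sinv (p b) * s * p a \<in> G" if "s \<in> Dclass e" "s * sinv s = b" "sinv s * s = a" for s
    using iso_part_in_G[OF that(1)] that(2,3) by (simp add: iso_part_def)
  then show ?thesis unfolding galg_def fG_of_def by (auto intro!: sum.neutral)
qed

text \<open>\<open>fG_of\<close> moves the coefficient of s to \<open>iso_part s\<close>, which is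
  injective on the elements with domain a and range b; \<open>place\<close> moves it back.\<close>

lemma place_fG_of:
  assumes a: "a \<in> ids" and b: "b \<in> ids"
    and f: "\<And>s. \<not> (s \<in> Dclass e \<and> sinv s * s = a \<and> s * sinv s = b) \<Longrightarrow> f s = 0"
  shows "place b a (fG_of e p a b f) = gsum f"
proof -
  have "theta (place b a (fG_of e p a b f)) s = f s" for s
  proof (cases "sinv s * s = a \<and> s * sinv s = b")
    case True
    then have sD: "s \<in> Dclass e" using dom_in_ids a by blast
    have "sinv (p b) * t * p a = iso_part s \<longleftrightarrow> t = s"
      if t: "t \<in> Dclass e" "t * sinv t = b" "sinv t * t = a" for t
      using arrow_iso_part[OF t(1)] arrow_iso_part[OF sD] True t unfolding iso_part_def by metis
    then have "fG_of e p a b f (iso_part s)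
        = (\<Sum>t\<in>{t \<in> Dclass e. t * sinv t = b \<and> sinv t * t = a}. if t = s then f t else 0)"
      unfolding fG_of_def by (intro sum.cong) auto
    also have "\<dots> = f s" using True sD by simp
    finally show ?thesis using True by (simp add: theta_place[OF a b])
  next
    case False
    then have "f s = 0" using f by blast
    then show ?thesis unfolding theta_place[OF a b] if_not_P[OF False] by simp
  qed
  then have "theta (place b a (fG_of e p a b f)) = theta (gsum f)" by (simp add: fun_eq_iff)
  then show ?thesis by (simp only: theta_inject)
qed


section \<open>Transport of isotypic components to the semigroup algebra\<close>

lemma place_zero: "place b a (\<lambda>u. 0) = (\<lambda>u. 0)"
  by (simp add: place_def)

lemma irreducible_induced:
  assumes a: "a \<in> ids" and irr: "irreducible_grep G e \<rho> d"
  obtains L where "simple_left_ideal (galg G) L" "mod_iso (galg G) L (cvec d) (gact G \<rho> d)"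
    and "isotypic UNIV (rhobar_space (Dclass e) d) (rhobar (Dclass e) p \<rho> d)
      = isotypic UNIV (induced a L) sconv"
proof -
  obtain L where L: "simple_left_ideal (galg G) L" "mod_iso (galg G) L (cvec d) (gact G \<rho> d)"
    using irreducible_occurs[OF irr] by blast
  have li: "left_ideal (galg G) L" using L(1) by (simp add: simple_left_ideal_def)
  show ?thesis
    using that[OF L isotypic_cong[OF left_ideal_induced[OF a li] mod_iso_induced[OF a li L(2)]]] .
qed

text \<open>By linearity it suffices to consider a simple ideal L of type \<rho>; it is mapped into
  \<open>induced a L\<close>, which is simple of type rho-bar.\<close>

lemma place_isotypic:
  assumes a: "a \<in> ids" and b: "b \<in> ids"
    and x: "x \<in> isotypic (galg G) (cvec d) (gact G \<rho> d)"
  shows "place b a x \<in> isotypic UNIV (rhobar_space (Dclass e) d) (rhobar (Dclass e) p \<rho> d)"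
    (is "_ \<in> ?V")
proof -
  have V: "csubspace ?V" by (rule csubspace_isotypic)
  have "isotypic (galg G) (cvec d) (gact G \<rho> d) \<subseteq> {x. place b a x \<in> ?V}"
    unfolding isotypic_def[of "galg G"]
  proof (rule sum_of_least)
    show "csubspace {x. place b a x \<in> ?V}"
      using V clinear_onD[OF clinear_place] unfolding csubspace_def by (simp add: place_zero)
    fix L assume "L \<in> {L. simple_left_ideal (galg G) L \<and> mod_iso (galg G) L (cvec d) (gact G \<rho> d)}"
    then have L: "simple_left_ideal (galg G) L" "mod_iso (galg G) L (cvec d) (gact G \<rho> d)" by auto
    have li: "left_ideal (galg G) L" "csubspace L" "L \<subseteq> galg G"
      using L(1) by (auto simp: simple_left_ideal_def left_ideal_iff)
    show "L \<subseteq> {x. place b a x \<in> ?V}"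
    proof (rule subsetI, rule CollectI)
      fix l assume "l \<in> L"
      then show "place b a l \<in> ?V"
        by (intro isotypic_incl[OF simple_induced[OF a L(1)] mod_iso_induced[OF a li(1) L(2)]]
            place_in_induced[OF a b li(2,3)])
    qed
  qed
  with x show ?thesis by blast
qed

text \<open>Equal components force the two induced ideals to be isomorphic, and then the ideals of
  CG they come from. This separates the summands of one representation from the components of the
  others.\<close>

lemma isotypic_rhobar_inj:
  assumes a: "a \<in> ids" and irr: "irreducible_grep G e \<rho> d" "irreducible_grep G e \<rho>' d'"
    and eq: "isotypic UNIV (rhobar_space (Dclass e) d) (rhobar (Dclass e) p \<rho> d)
      = isotypic UNIV (rhobar_space (Dclass e) d') (rhobar (Dclass e) p \<rho>' d')"
  shows "equiv_grep G \<rho> d \<rho>' d'"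
proof -
  interpret s: star_algebra "UNIV :: ('a \<Rightarrow> complex) set" "\<lambda>x. \<chi> i. theta x i"
    by (rule star_algebra_UNIV)
  obtain L where L: "simple_left_ideal (galg G) L" "mod_iso (galg G) L (cvec d) (gact G \<rho> d)"
    "isotypic UNIV (rhobar_space (Dclass e) d) (rhobar (Dclass e) p \<rho> d) = isotypic UNIV (induced a L) sconv"
    using irreducible_induced[OF a irr(1)] .
  obtain L' where L': "simple_left_ideal (galg G) L'" "mod_iso (galg G) L' (cvec d') (gact G \<rho>' d')"
    "isotypic UNIV (rhobar_space (Dclass e) d') (rhobar (Dclass e) p \<rho>' d') = isotypic UNIV (induced a L') sconv"
    using irreducible_induced[OF a irr(2)] .
  have "mod_iso UNIV (induced a L) (induced a L') sconv"
    using s.isotypic_eq_imp_mod_iso[OF simple_induced[OF a L(1)] simple_induced[OF a L'(1)]] eq L(3) L'(3)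
    by simp
  then have "mod_iso (galg G) L L' sconv" by (rule mod_iso_induced_imp[OF a L(1) L'(1)])
  moreover have "left_ideal (galg G) L" "left_ideal (galg G) L'"
    using L(1) L'(1) by (auto simp: simple_left_ideal_def)
  ultimately show ?thesis
    using mod_iso_imp_equiv_grep[OF _ L(2)] mod_iso_trans[OF _ _ L'(2)] by blast
qed

lemma isotypic_decomposition:
  fixes R :: "(('a \<Rightarrow> nat \<Rightarrow> nat \<Rightarrow> complex) \<times> nat) set"
  assumes a: "a \<in> ids" and b: "b \<in> ids" and R: "complete_irr G e R" and x: "x \<in> galg G"
  defines "w \<equiv> \<lambda>\<rho> d. iso_proj (galg G) (isotypic (galg G) (cvec d) (gact G \<rho> d)) x"
    and "V \<equiv> \<lambda>\<rho> d. isotypic UNIV (rhobar_space (Dclass e) d) (rhobar (Dclass e) p \<rho> d)"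
  shows "place b a x = (\<lambda>u. \<Sum>(\<rho>, d)\<in>R. place b a (w \<rho> d) u)"
    and "(\<rho>, d) \<in> R \<Longrightarrow> w \<rho> d \<in> galg G"
    and "(\<rho>, d) \<in> R \<Longrightarrow> iso_proj UNIV (V \<rho> d) (place b a x) = place b a (w \<rho> d)"
proof -
  interpret g: star_algebra "galg G" vec_lambda by (rule star_algebra_galg)
  interpret s: star_algebra "UNIV :: ('a \<Rightarrow> complex) set" "\<lambda>x. \<chi> i. theta x i"
    by (rule star_algebra_UNIV)
  let ?W = "\<lambda>(\<rho>, d). isotypic (galg G) (cvec d) (gact G \<rho> d)"
  note bij = components_galg[OF R]
  have irr: "irreducible_grep G e \<rho> d" if "(\<rho>, d) \<in> R" for \<rho> d
    using R that unfolding complete_irr_def by blast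
  have uniq: "(\<rho>, d) = (\<rho>', d')" if "(\<rho>, d) \<in> R" "(\<rho>', d') \<in> R" "equiv_grep G \<rho> d \<rho>' d'" for \<rho> d \<rho>' d'
    using R that unfolding complete_irr_def by blast
  \<comment> \<open>Finiteness of R is inherited from the components; a sum over an infinite R would
    be zero by convention.\<close>
  have fin: "finite R" using bij g.finite_components bij_betw_finite by blast
  have W: "isotypic (galg G) (cvec d) (gact G \<rho> d) \<in> isotypic_components (galg G)" if "(\<rho>, d) \<in> R" for \<rho> d
    using bij_betwE[OF bij] that by force
  have wW: "w \<rho> d \<in> isotypic (galg G) (cvec d) (gact G \<rho> d)" if "(\<rho>, d) \<in> R" for \<rho> d
    using g.iso_proj_decomposition(1)[OF x W[OF that]] by (simp add: w_def)
  have "isotypic (galg G) (cvec d) (gact G \<rho> d) \<subseteq> galg G" for \<rho> d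
    unfolding isotypic_def
    by (rule sum_of_least[OF csubspace_galg]) (auto simp: simple_left_ideal_def left_ideal_def)
  then show wG: "w \<rho> d \<in> galg G" if "(\<rho>, d) \<in> R" for \<rho> d using wW[OF that] by blast
  have "x = (\<lambda>u. \<Sum>V\<in>isotypic_components (galg G). iso_proj (galg G) V x u)"
    by (rule g.iso_proj_decomposition(2)[OF x])
  also have "\<dots> = (\<lambda>u. \<Sum>r\<in>R. iso_proj (galg G) (?W r) x u)"
    by (rule ext, rule sum.reindex_bij_betw[OF bij, symmetric])
  also have "\<dots> = (\<lambda>u. \<Sum>r\<in>R. w (fst r) (snd r) u)"
    by (simp add: w_def case_prod_beta)
  finally have xw: "x = (\<lambda>u. \<Sum>r\<in>R. w (fst r) (snd r) u)" .
  have "place b a x = place b a (\<lambda>u. \<Sum>r\<in>R. w (fst r) (snd r) u)" using xw by simp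
  also have "\<dots> = (\<lambda>u. \<Sum>r\<in>R. place b a (w (fst r) (snd r)) u)"
    by (rule clinear_on_sum[OF clinear_place]) (auto simp: csubspace_def)
  finally have sum: "place b a x = (\<lambda>u. \<Sum>r\<in>R. place b a (w (fst r) (snd r)) u)" .
  then show "place b a x = (\<lambda>u. \<Sum>(\<rho>, d)\<in>R. place b a (w \<rho> d) u)"
    by (simp add: case_prod_beta)
  have V: "V \<rho> d \<in> isotypic_components UNIV" if r: "(\<rho>, d) \<in> R" for \<rho> d
  proof -
    obtain L where "simple_left_ideal (galg G) L" "V \<rho> d = isotypic UNIV (induced a L) sconv"
      using irreducible_induced[OF a irr[OF r]] unfolding V_def by metis
    then show ?thesis using simple_induced[OF a] unfolding isotypic_components_def by blast
  qed
  have inV: "place b a (w \<rho> d) \<in> V \<rho> d" if "(\<rho>, d) \<in> R" for \<rho> d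
    unfolding V_def by (rule place_isotypic[OF a b wW[OF that]])
  show "iso_proj UNIV (V \<rho> d) (place b a x) = place b a (w \<rho> d)" if r: "(\<rho>, d) \<in> R" for \<rho> d
  proof (rule s.iso_proj_eq[OF V[OF r] inV[OF r]])
    have "place b a x u - place b a (w \<rho> d) u = (\<Sum>r\<in>R - {(\<rho>, d)}. place b a (w (fst r) (snd r)) u)" for u
      using sum.remove[OF fin r, of "\<lambda>r. place b a (w (fst r) (snd r)) u"] sum by simp
    \<comment> \<open>The remainder consists of the summands of the other representations, each of
      which lies in a component different from \<open>V \<rho> d\<close>.\<close>
    moreover have "(\<lambda>u. \<Sum>r\<in>R - {(\<rho>, d)}. place b a (w (fst r) (snd r)) u)
        \<in> sum_of (isotypic_components UNIV - {V \<rho> d})"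
    proof (rule csubspace_sum)
      show "csubspace (sum_of (isotypic_components (UNIV :: ('a \<Rightarrow> complex) set) - {V \<rho> d}))"
        by (rule csubspace_sum_of) (use s.components_csubspace in blast)
      fix r' assume r': "r' \<in> R - {(\<rho>, d)}"
      obtain \<rho>' d' where r'_eq: "r' = (\<rho>', d')" by (cases r')
      have r'R: "(\<rho>', d') \<in> R" using r' r'_eq by blast
      have "V \<rho>' d' \<noteq> V \<rho> d"
        using isotypic_rhobar_inj[OF a irr[OF r'R] irr[OF r]] uniq[OF r'R r] r' r'_eq
        unfolding V_def by blast
      then show "place b a (w (fst r') (snd r')) \<in> sum_of (isotypic_components UNIV - {V \<rho> d})"
        using sum_of_incl[of "V \<rho>' d'"] V[OF r'R] inV[OF r'R] r'_eq by simp
    qed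
    ultimately show "(\<lambda>u. place b a x u - place b a (w \<rho> d) u)
        \<in> sum_of (isotypic_components UNIV - {V \<rho> d})" by simp
  qed
qed

end

theorem theoremC2:
  fixes e a b :: "'a::{finite,semigroup_mult}"
    and p :: "'a \<Rightarrow> 'a"
    and f :: "'a \<Rightarrow> complex"
    and R :: "(('a \<Rightarrow> nat \<Rightarrow> nat \<Rightarrow> complex) \<times> nat) set"
  assumes inv_sg: "inverse_semigroup TYPE('a)"
    and e_idem: "idem e"
    and p_def: "\<And>c. c \<in> Dclass e \<Longrightarrow> idem c \<Longrightarrow> sinv (p c) * p c = e \<and> p c * sinv (p c) = c"
    and p_e: "p e = e"
    and a_idem: "idem a" and a_D: "a \<in> Dclass e"
    and b_idem: "idem b" and b_D: "b \<in> Dclass e"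
    and f_supp: "\<And>s. \<not> (s \<in> Dclass e \<and> sinv s * s = a \<and> s * sinv s = b) \<Longrightarrow> f s = 0"
    and IRR: "complete_irr (maxsub e) e R"
  defines "F \<equiv> (\<lambda>u. \<Sum>s\<in>UNIV. f s * gfloor s u)"
    and "fGi \<equiv> (\<lambda>\<rho> d. iso_proj (galg (maxsub e))
                    (isotypic (galg (maxsub e)) (cvec d) (gact (maxsub e) \<rho> d)) (fG_of e p a b f))"
    and "Vi \<equiv> (\<lambda>\<rho> d. isotypic UNIV (rhobar_space (Dclass e) d) (rhobar (Dclass e) p \<rho> d))"
  shows "F = (\<lambda>u. \<Sum>(\<rho>, d)\<in>R. sconv (gfloor (p b)) (sconv (fGi \<rho> d) (gfloor (sinv (p a)))) u)
    \<and> (\<forall>(\<rho>, d)\<in>R. sconv (gfloor (p b)) (sconv (fGi \<rho> d) (gfloor (sinv (p a))))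
                      = iso_proj UNIV (Vi \<rho> d) F)
    \<and> (\<forall>(\<rho>, d)\<in>R. sconv (gfloor (p b)) (sconv (fGi \<rho> d) (gfloor (sinv (p a))))
                      = sconv (gfloor (p b))
                          (sconv (\<lambda>u. \<Sum>g\<in>maxsub e. fGi \<rho> d g * gfloor g u) (gfloor (sinv (p a)))))"
proof -
  interpret transversal "TYPE('a)" e p
    by unfold_locales (use inv_sg e_idem p_def p_e in auto)
  have a: "a \<in> ids" and b: "b \<in> ids" using a_idem a_D b_idem b_D by (auto simp: ids_def)
  note fG = fG_of_in_galg[OF a b, of f]
  \<comment> \<open>From here on all three claims are statements about
    \<open>place b a\<close>.\<close>
  have F: "F = place b a (fG_of e p a b f)"
    using place_fG_of[OF a b f_supp] by (simp add: F_def gsum_def)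
  note dec = isotypic_decomposition[OF a b IRR fG]
  have sum: "F = (\<lambda>u. \<Sum>(\<rho>, d)\<in>R. place b a (fGi \<rho> d) u)"
    unfolding F fGi_def by (rule dec(1))
  have pl: "sconv (gfloor (p b)) (sconv (fGi \<rho> d) (gfloor (sinv (p a)))) = place b a (fGi \<rho> d)"
    if "(\<rho>, d) \<in> R" for \<rho> d
    using sconv_place(2)[OF a b] dec(2)[OF that] by (simp add: fGi_def)
  show ?thesis
  proof (intro conjI)
    show "F = (\<lambda>u. \<Sum>(\<rho>, d)\<in>R. sconv (gfloor (p b)) (sconv (fGi \<rho> d) (gfloor (sinv (p a)))) u)"
      unfolding sum by (intro ext sum.cong refl) (auto simp: pl)
    show "\<forall>(\<rho>, d)\<in>R. sconv (gfloor (p b)) (sconv (fGi \<rho> d) (gfloor (sinv (p a))))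
                      = iso_proj UNIV (Vi \<rho> d) F"
    proof clarify
      fix \<rho> d assume r: "(\<rho>, d) \<in> R"
      show "sconv (gfloor (p b)) (sconv (fGi \<rho> d) (gfloor (sinv (p a)))) = iso_proj UNIV (Vi \<rho> d) F"
        unfolding pl[OF r] F unfolding fGi_def Vi_def by (rule dec(3)[OF r, symmetric])
    qed
    show "\<forall>(\<rho>, d)\<in>R. sconv (gfloor (p b)) (sconv (fGi \<rho> d) (gfloor (sinv (p a))))
                      = sconv (gfloor (p b))
                          (sconv (\<lambda>u. \<Sum>g\<in>maxsub e. fGi \<rho> d g * gfloor g u) (gfloor (sinv (p a))))"
      using pl sconv_place(1)[OF a b] by auto
  qed
qed

end
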